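(* Let $p\in[1,+\infty)$ and $(s_n)_n\subset(0,1)$ with $s_n\to0^+$ as $n\to+\infty$. (1) Compactness: assume $p\neq1$ and let $(u_n)_n\subset L^p(\mathbb{T}_T^d)$ satisfy $\sup_{n} s_n\mathcal{F}_p^{s_n}(u_n)\le C$ for some $C\in\mathbb{R}$. Then, up to a subsequence, $u_n-\fint u_n\rightharpoonup u$ weakly in $L^p(\mathbb{T}_T^d)$ for some $u\in L^p(\mathbb{T}_T^d)$ with $\fint u=0$. (2) $\Gamma$-liminf: for every $u\in L^p(\mathbb{T}_T^d)$ and every $(u_n)_n\subset L^p(\mathbb{T}_T^d)$ with $u_n\rightharpoonup u$ weakly in $L^p(\mathbb{T}_T^d)$, \[ \liminf_{n\to+\infty} s_n\mathcal{F}_p^{s_n}(u_n)\ge\frac{d\,\omega_d}{p\,T^d}\mathcal{F}_p^0(u). \] (3) $\Gamma$-limsup: for every $u\in L^p(\mathbb{T}_T^d)$ there exists $(u_n)_n\subset L^p(\mathbb{T}_T^d)$ with $u_n\rightharpoonup u$ weakly in $L^p(\mathbb{T}_T^d)$ and \[ \limsup_{n\to+\infty} s_n\mathcal{F}_p^{s_n}(u_n)\le\frac{d\,\omega_d}{p\,T^d}\mathcal{F}_p^0(u). \]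
   Context: $T>0$, $Q_T=[0,T]^d$. $L^p(\mathbb{T}_T^d)$ is the space of measurable $u:\mathbb{R}^d\to\mathbb{R}$ which are $T$-periodic in each coordinate direction (a.e.) with $u|_{Q_T}\in L^p(Q_T)$, normed by $\|u\|=(\int_{Q_T}|u|^p)^{1/p}$; weak convergence in $L^p(\mathbb{T}_T^d)$ means weak convergence in this Banach space. $\fint u=T^{-d}\int_{Q_T}u$. For $s\in(0,1)$, $\mathcal{F}_p^s(u)=\int_{Q_T}\int_{\mathbb{R}^d}\frac{|u(x)-u(y)|^p}{|x-y|^{d+sp}}\,\mathrm{d}y\,\mathrm{d}x\in[0,+\infty]$ and $\mathcal{F}_p^0(u)=\int_{Q_T}\int_{Q_T}|u(x)-u(y)|^p\,\mathrm{d}y\,\mathrm{d}x$. $\omega_d$ is the Lebesgue measure of the unit ball of $\mathbb{R}^d$ (so $d\omega_d=\mathcal{H}^{d-1}(\mathbb{S}^{d-1})$). *)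

theory Defs
  imports "HOL-Analysis.Analysis"
begin

definition cube :: "real \<Rightarrow> 'a::euclidean_space set" where
  "cube T = cbox 0 (T *\<^sub>R One)"

definition periodic_ae :: "real \<Rightarrow> ('a::euclidean_space \<Rightarrow> real) \<Rightarrow> bool" where
  "periodic_ae T u \<longleftrightarrow> (\<forall>b\<in>Basis. AE x in lebesgue. u (x + T *\<^sub>R b) = u x)"

definition Lp_torus :: "real \<Rightarrow> real \<Rightarrow> ('a::euclidean_space \<Rightarrow> real) set" where
  "Lp_torus p T = {u. u \<in> borel_measurable lebesgue \<and> periodic_ae T u \<and>
      (\<integral>\<^sup>+ x\<in>cube T. ennreal (\<bar>u x\<bar> powr p) \<partial>lebesgue) < \<infinity>}"

definition Lp_norm :: "real \<Rightarrow> real \<Rightarrow> ('a::euclidean_space \<Rightarrow> real) \<Rightarrow> real" where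
  "Lp_norm p T u = enn2real (\<integral>\<^sup>+ x\<in>cube T. ennreal (\<bar>u x\<bar> powr p) \<partial>lebesgue) powr (1 / p)"

definition bdd_lin_functional :: "real \<Rightarrow> real \<Rightarrow> (('a::euclidean_space \<Rightarrow> real) \<Rightarrow> real) \<Rightarrow> bool" where
  "bdd_lin_functional p T \<phi> \<longleftrightarrow>
     (\<forall>f\<in>Lp_torus p T. \<forall>g\<in>Lp_torus p T. \<phi> (\<lambda>x. f x + g x) = \<phi> f + \<phi> g) \<and>
     (\<forall>f\<in>Lp_torus p T. \<forall>c. \<phi> (\<lambda>x. c * f x) = c * \<phi> f) \<and>
     (\<exists>C. \<forall>f\<in>Lp_torus p T. \<bar>\<phi> f\<bar> \<le> C * Lp_norm p T f)"

definition weak_conv :: "real \<Rightarrow> real \<Rightarrow> (nat \<Rightarrow> 'a::euclidean_space \<Rightarrow> real) \<Rightarrow> ('a \<Rightarrow> real) \<Rightarrow> bool" where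
  "weak_conv p T v v0 \<longleftrightarrow> (\<forall>n. v n \<in> Lp_torus p T) \<and> v0 \<in> Lp_torus p T \<and>
     (\<forall>\<phi>. bdd_lin_functional p T \<phi> \<longrightarrow> (\<lambda>n. \<phi> (v n)) \<longlonglongrightarrow> \<phi> v0)"

definition avg :: "real \<Rightarrow> ('a::euclidean_space \<Rightarrow> real) \<Rightarrow> real" where
  "avg T u = (\<integral>x\<in>cube T. u x \<partial>lebesgue) / T ^ DIM('a)"

definition Fs :: "real \<Rightarrow> real \<Rightarrow> real \<Rightarrow> ('a::euclidean_space \<Rightarrow> real) \<Rightarrow> ennreal" where
  "Fs p s T u = (\<integral>\<^sup>+ x\<in>cube T. (\<integral>\<^sup>+ y.
      ennreal (\<bar>u x - u y\<bar> powr p / norm (x - y) powr (real DIM('a) + s * p)) \<partial>lebesgue) \<partial>lebesgue)"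

definition F0 :: "real \<Rightarrow> real \<Rightarrow> ('a::euclidean_space \<Rightarrow> real) \<Rightarrow> ennreal" where
  "F0 p T u = (\<integral>\<^sup>+ x\<in>cube T. (\<integral>\<^sup>+ y\<in>cube T. ennreal (\<bar>u x - u y\<bar> powr p) \<partial>lebesgue) \<partial>lebesgue)"

definition omega :: "'a::euclidean_space itself \<Rightarrow> real" where
  "omega _ = measure lebesgue (ball (0::'a) 1)"

end

theory Submission
  imports Defs "HOL-Real_Asymp.Real_Asymp" "HOL-Complex_Analysis.Great_Picard"
begin

text \<open>As \<open>s\<close> tends to \<open>0\<close> only interactions between very distant points survive, because \<open>s\<close> times the
  kernel loses all its mass on bounded sets. Tile the space by the lattice translates of one period.
  For \<open>x\<close> and \<open>y\<close> in the period the sum over the lattice of \<open>s |x - y - T k| powr (- d - s p)\<close> is, up to a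
  bounded shift of the argument, \<open>T ^ (- d)\<close> times a radial integral over the whole space, which tends to
  \<open>d omega / p\<close>. Therefore \<open>s Fs u \<ge> c s * F0 u\<close> holds for every \<open>u\<close> with an explicit \<open>c s\<close> tending to \<open>K\<close>.

  The lower bound follows from the weak lower semicontinuity of the convex functional \<open>F0\<close>, and the
  compactness from Jensen's inequality (\<open>F0\<close> controls the distance to the average) and the reflexivity
  of \<open>Lp\<close>. For Lipschitz functions the inequality can be reversed, since the interactions at short
  range vanish in the limit; a diagonal argument over Lipschitz approximations then gives recovery
  sequences.\<close>

section \<open>Inequalities for powers\<close>

text \<open>Two radii carry the quantitative part. The lower comparison discards interactions below
  \<open>1 / s\<close>: there a shift by at most \<open>2 * D\<close>, with \<open>D\<close> the
  diagonal of the period, is a relative error \<open>1 + 2 * D * s\<close>, and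
  \<open>(1 / s) powr (- (s * p))\<close> still tends to \<open>1\<close>. The upper comparison cuts
  near \<open>s powr (- 1 / (2 * p))\<close>: large enough for the shift to be negligible, small
  enough for \<open>s\<close> times its \<open>p\<close>-th power to vanish. A general function of
  \<open>Lp\<close> may have infinite energy, so the constant sequence need not be a recovery
  sequence; this forces the Lipschitz approximation. Weak convergence is tested by arbitrary bounded
  linear functionals on functions, not on classes. The lower bound only uses that bounded densities
  define such functionals, and recovery sequences converge strongly, so \<open>p = 1\<close>
  requires no dual space there. Compactness needs all functionals; the duality and the weak
  compactness behind it both rest on one Radon-Nikodym theorem for finitely additive, absolutely
  continuous set functions.\<close>

lemma powr_tangent_pos:
  fixes t c p :: real
  assumes "p \<ge> 1" "c > 0" "t \<ge> 0"
  shows "c powr p + p * c powr (p - 1) * (t - c) \<le> t powr p"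
proof (cases "t = 0")
  case True
  have "c powr p = c powr (p - 1) * c"
    using assms by (simp add: powr_mult_base mult.commute)
  then have "c powr p + p * c powr (p - 1) * (t - c) = (1 - p) * c powr p"
    using True by (simp add: algebra_simps)
  also have "\<dots> \<le> 0" using assms by (simp add: mult_nonpos_nonneg)
  finally show ?thesis using True by simp
next
  case False
  have c1: "c powr (p-1) * c = c powr p"
    using assms by (simp add: powr_mult_base mult.commute)
  \<comment> \<open>Young's inequality with weights \<open>1/p\<close> and \<open>1 - 1/p\<close>
    for \<open>t powr p\<close> and \<open>c powr p\<close>; the factor
    \<open>c powr (1 - p)\<close> restores homogeneity of degree one. The case \<open>p = 1\<close>
    is included.\<close>
  have "t \<le> (t powr p) powr (1/p) * (c powr p) powr (1 - 1/p) * c powr (1 - p)"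
    using assms False by (simp add: powr_powr flip: powr_add) (simp add: algebra_simps)
  also have "\<dots> \<le> ((1/p) * t powr p + (1 - 1/p) * c powr p) * c powr (1 - p)"
    using assms False by (intro mult_right_mono Youngs_inequality_0) auto
  finally have "t * c powr (p-1) \<le> ((1/p) * t powr p + (1 - 1/p) * c powr p) * (c powr (1 - p) * c powr (p-1))"
    by (smt (verit) mult.assoc mult_right_mono powr_ge_zero)
  also have "c powr (1 - p) * c powr (p-1) = 1"
    using assms by (simp flip: powr_add)
  finally have "p * (t * c powr (p-1)) \<le> p * ((1/p) * t powr p + (1 - 1/p) * c powr p)"
    using assms by simp
  also have "\<dots> = t powr p + (p - 1) * c powr p"
    using assms by (simp add: field_simps)
  finally show ?thesis using c1 by (simp add: algebra_simps)
qed

text \<open>The factor of \<open>a - b\<close> is a subgradient of the \<open>p\<close>-th power of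
  the absolute value at \<open>b\<close>. The inequality supplies both the affine minorants behind
  lower semicontinuity and Jensen's inequality for the mean.\<close>

lemma powr_tangent:
  fixes a b p :: real
  assumes "p \<ge> 1"
  shows "\<bar>b\<bar> powr p + p * \<bar>b\<bar> powr (p - 1) * sgn b * (a - b) \<le> \<bar>a\<bar> powr p"
proof (cases "b = 0")
  case False
  have "sgn b * (a - b) \<le> \<bar>a\<bar> - \<bar>b\<bar>"
    by (auto simp: sgn_if)
  then have "p * \<bar>b\<bar> powr (p - 1) * (sgn b * (a - b)) \<le> p * \<bar>b\<bar> powr (p - 1) * (\<bar>a\<bar> - \<bar>b\<bar>)"
    using assms by (intro mult_left_mono) auto
  then show ?thesis
    using powr_tangent_pos[OF assms, of "\<bar>b\<bar>" "\<bar>a\<bar>"] False by (simp add: mult.assoc)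
qed (use assms in simp)

text \<open>Convexity along \<open>a + b = (1 - l) * (a / (1 - l)) + l * (b / l)\<close>, obtained
  by averaging the tangents at \<open>a + b\<close>. The point is the coefficient of the first term:
  it tends to \<open>1\<close> as \<open>l\<close> tends to \<open>0\<close>, so a sufficiently
  small perturbation \<open>b\<close> changes the energy of \<open>a\<close> by little.\<close>

lemma powr_add_split:
  fixes a b l p :: real
  assumes "p \<ge> 1" "0 < l" "l < 1"
  shows "\<bar>a + b\<bar> powr p \<le> (1 - l) powr (1 - p) * \<bar>a\<bar> powr p + l powr (1 - p) * \<bar>b\<bar> powr p"
proof -
  define c where "c = a + b"
  define D where "D = p * \<bar>c\<bar> powr (p - 1) * sgn c"
  define x where "x = a / (1 - l)"
  define y where "y = b / l"
  have c: "c = (1 - l) * x + l * y" using assms by (simp add: c_def x_def y_def)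
  have X: "(1 - l) * (\<bar>c\<bar> powr p + D * (x - c)) \<le> (1 - l) * \<bar>x\<bar> powr p"
    using powr_tangent[OF assms(1), of c x] assms by (intro mult_left_mono) (auto simp: D_def)
  have Y: "l * (\<bar>c\<bar> powr p + D * (y - c)) \<le> l * \<bar>y\<bar> powr p"
    using powr_tangent[OF assms(1), of c y] assms by (intro mult_left_mono) (auto simp: D_def)
  have "\<bar>c\<bar> powr p = (1 - l) * (\<bar>c\<bar> powr p + D * (x - c)) + l * (\<bar>c\<bar> powr p + D * (y - c))"
    unfolding c by (simp add: algebra_simps)
  also have "\<dots> \<le> (1 - l) * \<bar>x\<bar> powr p + l * \<bar>y\<bar> powr p" using X Y by simp
  also have "(1 - l) * \<bar>x\<bar> powr p = (1 - l) powr (1 - p) * \<bar>a\<bar> powr p"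
    using assms by (simp add: x_def abs_divide powr_divide powr_diff)
  also have "l * \<bar>y\<bar> powr p = l powr (1 - p) * \<bar>b\<bar> powr p"
    using assms by (simp add: y_def abs_divide powr_divide powr_diff)
  finally show ?thesis by (simp add: c_def)
qed

lemma powr_add_le:
  fixes a b p :: real
  assumes "p \<ge> 1"
  shows "\<bar>a + b\<bar> powr p \<le> 2 powr p * (\<bar>a\<bar> powr p + \<bar>b\<bar> powr p)"
proof -
  have *: "(1/2::real) powr (1 - p) \<le> 2 powr p"
    using powr_divide[of 1 2 "1-p"] by (simp add: powr_minus_divide[symmetric])
  have "\<bar>a + b\<bar> powr p \<le> (1/2) powr (1 - p) * (\<bar>a\<bar> powr p + \<bar>b\<bar> powr p)"
    using powr_add_split[OF assms, of "1/2" a b] by (simp add: algebra_simps)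
  also have "\<dots> \<le> 2 powr p * (\<bar>a\<bar> powr p + \<bar>b\<bar> powr p)"
    by (intro mult_right_mono *) auto
  finally show ?thesis .
qed

section \<open>Lattice tiling of the space\<close>

definition lat :: "'a::euclidean_space set" where
  "lat = {k. \<forall>b\<in>Basis. k \<bullet> b \<in> \<int>}"

text \<open>Half open, unlike \<open>cube\<close>, so that its lattice translates partition the
  space without overlap; the two sets differ by a null set.\<close>

definition hcube :: "real \<Rightarrow> 'a::euclidean_space set" where
  "hcube T = {x. \<forall>b\<in>Basis. 0 \<le> x \<bullet> b \<and> x \<bullet> b < T}"

definition cell :: "real \<Rightarrow> 'a::euclidean_space \<Rightarrow> 'a" where
  "cell T x = (\<Sum>b\<in>Basis. of_int \<lfloor>x \<bullet> b / T\<rfloor> *\<^sub>R b)"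

definition red :: "real \<Rightarrow> 'a::euclidean_space \<Rightarrow> 'a" where
  "red T x = x - T *\<^sub>R cell T x"

lemma cell_inner: "b \<in> Basis \<Longrightarrow> cell T x \<bullet> b = of_int \<lfloor>x \<bullet> b / T\<rfloor>"
  by (simp add: cell_def inner_sum_left inner_Basis if_distrib sum.delta cong: if_cong)

lemma cell_in_lat: "cell T x \<in> lat"
  by (simp add: lat_def cell_inner)

lemma countable_lat: "countable (lat :: 'a::euclidean_space set)"
proof -
  have "(lat :: 'a set) \<subseteq> (\<lambda>f. \<Sum>b\<in>Basis. of_int (f b) *\<^sub>R b) ` (PiE Basis (\<lambda>_. UNIV :: int set))"
  proof
    fix k :: 'a assume k: "k \<in> lat"
    define f where "f = (\<lambda>b\<in>Basis. \<lfloor>k \<bullet> b\<rfloor>)"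
    have "k = (\<Sum>b\<in>Basis. (k \<bullet> b) *\<^sub>R b)" by (simp add: euclidean_representation)
    also have "\<dots> = (\<Sum>b\<in>Basis. of_int (f b) *\<^sub>R b)"
      using k by (intro sum.cong refl) (auto simp: f_def lat_def elim!: Ints_cases)
    finally show "k \<in> (\<lambda>f. \<Sum>b\<in>Basis. of_int (f b) *\<^sub>R b) ` (PiE Basis (\<lambda>_. UNIV :: int set))"
      by (intro image_eqI[where x=f]) (auto simp: f_def)
  qed
  then show ?thesis
    by (rule countable_subset) (intro countable_image countable_PiE, auto)
qed

lemma red_in_hcube: "T > 0 \<Longrightarrow> red T x \<in> hcube T"
proof -
  assume T: "T > 0"
  { fix b :: 'a assume b: "b \<in> Basis"
    have "of_int \<lfloor>x \<bullet> b / T\<rfloor> \<le> x \<bullet> b / T" "x \<bullet> b / T < of_int \<lfloor>x \<bullet> b / T\<rfloor> + 1"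
      by linarith+
    then have "of_int \<lfloor>x \<bullet> b / T\<rfloor> * T \<le> x \<bullet> b" "x \<bullet> b < (of_int \<lfloor>x \<bullet> b / T\<rfloor> + 1) * T"
      using T by (simp_all only: pos_le_divide_eq pos_divide_less_eq)
    then have "0 \<le> red T x \<bullet> b \<and> red T x \<bullet> b < T"
      using T b by (simp add: red_def inner_diff_left cell_inner algebra_simps) }
  then show ?thesis by (simp add: hcube_def)
qed

lemma cell_unique:
  assumes "T > 0" "k \<in> lat" "x - T *\<^sub>R k \<in> hcube T"
  shows "k = cell T x"
proof (rule euclidean_eqI)
  fix b :: 'a assume b: "b \<in> Basis"
  obtain n where n: "k \<bullet> b = of_int n" using assms(2) b by (auto simp: lat_def elim!: Ints_cases)
  have "0 \<le> x \<bullet> b - T * of_int n" "x \<bullet> b - T * of_int n < T"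
    using assms(3) b n by (auto simp: hcube_def inner_diff_left)
  then have "of_int n \<le> x \<bullet> b / T" "x \<bullet> b / T < of_int n + 1"
    using assms(1) by (auto simp: field_simps)
  then have "\<lfloor>x \<bullet> b / T\<rfloor> = n" by linarith
  then show "k \<bullet> b = cell T x \<bullet> b" using b n by (simp add: cell_inner)
qed

lemma cell_add_lat:
  assumes "T > 0" "k \<in> lat"
  shows "cell T (x + T *\<^sub>R k) = cell T x + k"
proof (rule cell_unique[OF assms(1), symmetric])
  show "cell T x + k \<in> lat"
    using assms(2) cell_in_lat[of T x] by (auto simp: lat_def inner_add_left)
  show "x + T *\<^sub>R k - T *\<^sub>R (cell T x + k) \<in> hcube T"
    using red_in_hcube[OF assms(1), of x] by (simp add: red_def algebra_simps)
qed

lemma red_add_lat: "T > 0 \<Longrightarrow> k \<in> lat \<Longrightarrow> red T (x + T *\<^sub>R k) = red T x"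
  by (simp add: red_def cell_add_lat algebra_simps)

lemma Basis_in_lat: "b \<in> Basis \<Longrightarrow> b \<in> lat"
  by (auto simp: lat_def inner_Basis)

lemma red_hcube: "T > 0 \<Longrightarrow> x \<in> hcube T \<Longrightarrow> red T x = x"
  using cell_unique[of T 0 x] by (simp add: red_def lat_def)

lemma hcube_borel[measurable]: "hcube T \<in> sets borel"
  unfolding hcube_def by measurable

lemma hcube_lebesgue[measurable]: "hcube T \<in> sets lebesgue"
  by simp

lemma hcube_subset_cube: "hcube T \<subseteq> cube T"
  unfolding hcube_def cube_def subset_iff mem_box by (auto simp: order_le_less)

lemma box_subset_hcube: "box 0 (T *\<^sub>R One) \<subseteq> hcube T"
  by (auto simp: hcube_def mem_box intro: less_imp_le)

lemma AE_hcube_cube: "AE x in lebesgue. x \<in> hcube T \<longleftrightarrow> x \<in> cube T"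
proof -
  have "negligible (cbox 0 (T *\<^sub>R One) - box (0::'a) (T *\<^sub>R One))"
    by (rule negligible_frontier_interval)
  then have "cbox 0 (T *\<^sub>R One) - box (0::'a) (T *\<^sub>R One) \<in> null_sets lebesgue"
    by (simp add: negligible_iff_null_sets)
  then show ?thesis
    by (rule AE_I') (use hcube_subset_cube[of T] box_subset_hcube[of T] in \<open>auto simp: cube_def\<close>)
qed

lemma emeasure_cube: "T \<ge> 0 \<Longrightarrow> emeasure lebesgue (cube T :: 'a::euclidean_space set) = ennreal (T ^ DIM('a))"
  by (simp add: cube_def emeasure_lborel_cbox_eq inner_sum_left inner_Basis)

lemma emeasure_hcube: 
  assumes "T \<ge> 0"
  shows "emeasure lebesgue (hcube T :: 'a::euclidean_space set) = ennreal (T ^ DIM('a))"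
proof -
  have "emeasure lebesgue (hcube T :: 'a set) = emeasure lebesgue (cube T :: 'a set)"
    by (rule emeasure_eq_AE) (use AE_hcube_cube in \<open>auto simp: cube_def\<close>)
  then show ?thesis by (simp add: emeasure_cube assms)
qed

lemma nn_integral_hcube_cube:
  "(\<integral>\<^sup>+x\<in>hcube T. f x \<partial>lebesgue) = (\<integral>\<^sup>+x\<in>cube T. f x \<partial>lebesgue)"
  by (rule nn_integral_cong_AE) (use AE_hcube_cube[of T] in \<open>auto elim!: eventually_mono simp: indicator_def\<close>)

section \<open>Translation invariance, almost everywhere periods and tiling formulas\<close>

lemma lebesgue_distr_translation:
  "lebesgue = distr lebesgue lebesgue (\<lambda>x::'a::euclidean_space. x + a)"
  and lebesgue_measurable_translation: "(\<lambda>x::'a. x + a) \<in> lebesgue \<rightarrow>\<^sub>M lebesgue"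
proof -
  have *: "(\<lambda>x::'a. a + (\<Sum>j\<in>Basis. (1 * (x \<bullet> j)) *\<^sub>R j)) = (\<lambda>x. x + a)"
    by (simp add: euclidean_representation add.commute)
  show "lebesgue = distr lebesgue lebesgue (\<lambda>x::'a. x + a)"
    using lebesgue_affine_euclidean[of "\<lambda>_. 1" a] unfolding * by (simp add: density_1)
  show "(\<lambda>x::'a. x + a) \<in> lebesgue \<rightarrow>\<^sub>M lebesgue"
    using lebesgue_affine_measurable[of "\<lambda>_. 1" a] unfolding * by simp
qed

lemma nn_integral_lebesgue_translation:
  assumes [measurable]: "f \<in> borel_measurable lebesgue"
  shows "(\<integral>\<^sup>+x. f (x + a) \<partial>lebesgue) = (\<integral>\<^sup>+x. f x \<partial>lebesgue)"
  by (subst (2) lebesgue_distr_translation[of a]) (simp add: nn_integral_distr lebesgue_measurable_translation)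

lemma AE_lebesgue_translation:
  "(AE x in lebesgue. P x) \<Longrightarrow> (AE x in lebesgue. P (x + a))"
  by (subst (asm) lebesgue_distr_translation[of a], drule AE_distrD[rotated]) (auto intro: lebesgue_measurable_translation)

text \<open>The definition of \<open>periodic_ae\<close> only provides the periods
  \<open>T *\<^sub>R b\<close> along the basis. The set \<open>G\<close> of almost everywhere
  periods is a group, because translations preserve null sets, and so contains all integer
  combinations.\<close>

lemma periodic_ae_lat:
  fixes u :: "'a::euclidean_space \<Rightarrow> real"
  assumes "periodic_ae T u" "k \<in> lat"
  shows "AE x in lebesgue. u (x + T *\<^sub>R k) = u x"
proof -
  define G where "G = {a. AE x in lebesgue. u (x + a) = u x}"
  have add: "a + b \<in> G" if "a \<in> G" "b \<in> G" for a b
  proof -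
    have "AE x in lebesgue. u (x + b + a) = u (x + b)"
      using that(1) AE_lebesgue_translation[of "\<lambda>x. u (x + a) = u x" b] by (simp add: G_def)
    moreover have "AE x in lebesgue. u (x + b) = u x" using that(2) by (simp add: G_def)
    ultimately have "AE x in lebesgue. u (x + (a + b)) = u x"
      by eventually_elim (simp add: algebra_simps)
    then show ?thesis by (simp add: G_def)
  qed
  have neg: "- a \<in> G" if "a \<in> G" for a
  proof -
    have "AE x in lebesgue. u (x + (-a) + a) = u (x + (-a))"
      using that AE_lebesgue_translation[of "\<lambda>x. u (x + a) = u x" "-a"] by (simp add: G_def)
    then show ?thesis by (auto simp: G_def elim!: eventually_mono)
  qed
  have zero: "0 \<in> G" by (simp add: G_def)
  have nat: "of_nat n *\<^sub>R a \<in> G" if "a \<in> G" for a n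
    by (induction n) (use that zero add in \<open>auto simp: algebra_simps\<close>)
  have int: "of_int n *\<^sub>R a \<in> G" if "a \<in> G" for a n
    by (cases n rule: int_cases2) (use that nat neg[OF nat[OF that]] in auto)
  have basis: "T *\<^sub>R b \<in> G" if "b \<in> Basis" for b
    using assms(1) that by (simp add: G_def periodic_ae_def)
  have sum: "(\<Sum>b\<in>B. (k \<bullet> b) *\<^sub>R (T *\<^sub>R b)) \<in> G" if "B \<subseteq> Basis" for B
  proof -
    have "finite B" using that finite_Basis finite_subset by blast
    then show ?thesis using that
    proof (induction B)
      case (insert b B)
      have "k \<bullet> b \<in> \<int>" using assms(2) insert.prems by (auto simp: lat_def)
      then have "(k \<bullet> b) *\<^sub>R (T *\<^sub>R b) \<in> G"
        using int[OF basis, of b] insert.prems by (auto elim!: Ints_cases)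
      then show ?case using insert add by simp
    qed (simp add: zero)
  qed
  have "(\<Sum>b\<in>Basis. (k \<bullet> b) *\<^sub>R (T *\<^sub>R b)) = T *\<^sub>R k"
    by (subst (2) euclidean_representation[of k, symmetric]) (simp add: scaleR_sum_right mult.commute)
  then show ?thesis using sum[of Basis] by (simp add: G_def)
qed

text \<open>Each point lies in exactly one translate of \<open>hcube T\<close>, so the indicators of
  the translates sum to one. The lattice is countable, hence sum and integral may be exchanged, and
  translation invariance moves every piece back to the period.\<close>

lemma nn_integral_tiling:
  fixes f :: "'a::euclidean_space \<Rightarrow> ennreal"
  assumes [measurable]: "f \<in> borel_measurable lebesgue" and T: "T > 0"
  shows "(\<integral>\<^sup>+x. f x \<partial>lebesgue) = (\<integral>\<^sup>+k. (\<integral>\<^sup>+x\<in>hcube T. f (x + T *\<^sub>R k) \<partial>lebesgue) \<partial>count_space lat)"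
proof -
  have 1: "f x = (\<integral>\<^sup>+k. f x * indicator (hcube T) (x + (- T *\<^sub>R k)) \<partial>count_space lat)" for x
  proof -
    have "(\<integral>\<^sup>+k. f x * indicator (hcube T) (x + (- T *\<^sub>R k)) \<partial>count_space lat)
        = (\<integral>\<^sup>+k. f x * indicator {cell T x} k \<partial>count_space lat)"
    proof (rule nn_integral_cong)
      fix k :: 'a assume "k \<in> space (count_space lat)"
      then have "x + (- T *\<^sub>R k) \<in> hcube T \<longleftrightarrow> k = cell T x"
        using cell_unique[OF T, of k x] red_in_hcube[OF T, of x] by (auto simp: red_def)
      then show "f x * indicator (hcube T) (x + (- T *\<^sub>R k)) = f x * indicator {cell T x} k"
        by (simp add: indicator_def)
    qed
    also have "\<dots> = f x"
      using cell_in_lat[of T x] by (simp add: nn_integral_cmult)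
    finally show ?thesis ..
  qed
  have [measurable]: "(\<lambda>x. indicator (hcube T) (x + a) :: ennreal) \<in> borel_measurable lebesgue" for a :: 'a
    by (rule measurable_compose[OF lebesgue_measurable_translation]) measurable
  note [measurable] = this[of "- a" for a, unfolded add_uminus_conv_diff]
  have [measurable]: "(\<lambda>x. f (x + a)) \<in> borel_measurable lebesgue" for a :: 'a
    by (rule measurable_compose[OF lebesgue_measurable_translation]) measurable
  have "(\<integral>\<^sup>+x. f x \<partial>lebesgue) = (\<integral>\<^sup>+x. (\<integral>\<^sup>+k. f x * indicator (hcube T) (x + (- T *\<^sub>R k)) \<partial>count_space lat) \<partial>lebesgue)"
    by (subst 1) (rule refl)
  also have "\<dots> = (\<integral>\<^sup>+k. (\<integral>\<^sup>+x. f x * indicator (hcube T) (x + (- T *\<^sub>R k)) \<partial>lebesgue) \<partial>count_space lat)"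
    by (rule nn_integral_count_space_nn_integral[OF countable_lat]) (intro borel_measurable_times_ennreal, measurable)
  also have "\<dots> = (\<integral>\<^sup>+k. (\<integral>\<^sup>+x\<in>hcube T. f (x + T *\<^sub>R k) \<partial>lebesgue) \<partial>count_space lat)"
  proof (rule nn_integral_cong)
    fix k :: 'a
    show "(\<integral>\<^sup>+x. f x * indicator (hcube T) (x + (- T *\<^sub>R k)) \<partial>lebesgue) = (\<integral>\<^sup>+x\<in>hcube T. f (x + T *\<^sub>R k) \<partial>lebesgue)"
      by (subst nn_integral_lebesgue_translation[of _ "T *\<^sub>R k", symmetric]) auto
  qed
  finally show ?thesis .
qed

text \<open>For each lattice point separately \<open>g (x + T *\<^sub>R k)\<close> may be replaced
  by \<open>g x\<close> outside a null set. After exchanging sum and integral all the dependence on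
  distance is collected in the periodised weight.\<close>

lemma nn_integral_periodic_tiling:
  fixes g w :: "'a::euclidean_space \<Rightarrow> ennreal"
  assumes [measurable]: "g \<in> borel_measurable lebesgue" "w \<in> borel_measurable borel" and T: "T > 0"
    and per: "\<And>k. k \<in> lat \<Longrightarrow> AE x in lebesgue. g (x + T *\<^sub>R k) = g x"
  shows "(\<integral>\<^sup>+y. g y * w y \<partial>lebesgue) = (\<integral>\<^sup>+y\<in>hcube T. g y * (\<integral>\<^sup>+k. w (y + T *\<^sub>R k) \<partial>count_space lat) \<partial>lebesgue)"
proof -
  have [measurable]: "(\<lambda>x. w (x + a)) \<in> borel_measurable lebesgue" for a :: 'a
    by (rule measurable_completion) auto
  have "w \<in> borel_measurable lebesgue" by (rule measurable_completion) auto
  then have "(\<integral>\<^sup>+y. g y * w y \<partial>lebesgue)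
      = (\<integral>\<^sup>+k. (\<integral>\<^sup>+x\<in>hcube T. g (x + T *\<^sub>R k) * w (x + T *\<^sub>R k) \<partial>lebesgue) \<partial>count_space lat)"
    by (intro nn_integral_tiling T) auto
  also have "\<dots> = (\<integral>\<^sup>+k. (\<integral>\<^sup>+x\<in>hcube T. g x * w (x + T *\<^sub>R k) \<partial>lebesgue) \<partial>count_space lat)"
  proof (rule nn_integral_cong)
    fix k :: 'a assume "k \<in> space (count_space lat)"
    then have "AE x in lebesgue. g (x + T *\<^sub>R k) = g x" using per by simp
    then show "(\<integral>\<^sup>+x\<in>hcube T. g (x + T *\<^sub>R k) * w (x + T *\<^sub>R k) \<partial>lebesgue) = (\<integral>\<^sup>+x\<in>hcube T. g x * w (x + T *\<^sub>R k) \<partial>lebesgue)"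
      by (intro nn_integral_cong_AE) (auto elim!: eventually_mono)
  qed
  also have "\<dots> = (\<integral>\<^sup>+x. (\<integral>\<^sup>+k. (g x * w (x + T *\<^sub>R k)) * indicator (hcube T) x \<partial>count_space lat) \<partial>lebesgue)"
    by (rule nn_integral_count_space_nn_integral[symmetric]) (auto simp: countable_lat)
  also have "\<dots> = (\<integral>\<^sup>+y\<in>hcube T. g y * (\<integral>\<^sup>+k. w (y + T *\<^sub>R k) \<partial>count_space lat) \<partial>lebesgue)"
    by (simp add: nn_integral_cmult nn_integral_multc)
  finally show ?thesis .
qed

text \<open>The integral of \<open>W\<close> over the cell of \<open>k\<close> is at most
  \<open>c k\<close> times the volume of the cell. With the reverse estimate below, this trades
  lattice sums of the kernel for integrals over the whole space.\<close>

lemma lattice_sum_ge: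
  fixes W c :: "'a::euclidean_space \<Rightarrow> ennreal"
  assumes [measurable]: "W \<in> borel_measurable borel" and T: "T > 0"
    and le: "\<And>k z. k \<in> lat \<Longrightarrow> z \<in> hcube T \<Longrightarrow> W (z + T *\<^sub>R k) \<le> c k"
  shows "(\<integral>\<^sup>+x. W x \<partial>lebesgue) \<le> ennreal (T ^ DIM('a)) * (\<integral>\<^sup>+k. c k \<partial>count_space lat)"
proof -
  have "W \<in> borel_measurable lebesgue" by (rule measurable_completion) auto
  then have "(\<integral>\<^sup>+x. W x \<partial>lebesgue) = (\<integral>\<^sup>+k. (\<integral>\<^sup>+x\<in>hcube T. W (x + T *\<^sub>R k) \<partial>lebesgue) \<partial>count_space lat)"
    by (rule nn_integral_tiling[OF _ T])
  also have "\<dots> \<le> (\<integral>\<^sup>+k. (\<integral>\<^sup>+x\<in>hcube T. c k \<partial>(lebesgue::'a measure)) \<partial>count_space lat)"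
    using le by (intro nn_integral_mono) (auto simp: indicator_def)
  also have "\<dots> = ennreal (T ^ DIM('a)) * (\<integral>\<^sup>+k. c k \<partial>count_space lat)"
    using T emeasure_hcube[of T, where 'a='a] by (simp add: nn_integral_cmult_indicator nn_integral_multc mult.commute)
  finally show ?thesis .
qed

lemma lattice_sum_le:
  fixes W c :: "'a::euclidean_space \<Rightarrow> ennreal"
  assumes [measurable]: "W \<in> borel_measurable borel" and T: "T > 0"
    and le: "\<And>k z. k \<in> lat \<Longrightarrow> z \<in> hcube T \<Longrightarrow> c k \<le> W (z + T *\<^sub>R k)"
  shows "ennreal (T ^ DIM('a)) * (\<integral>\<^sup>+k. c k \<partial>count_space lat) \<le> (\<integral>\<^sup>+x. W x \<partial>lebesgue)"
proof -
  have "ennreal (T ^ DIM('a)) * (\<integral>\<^sup>+k. c k \<partial>count_space lat) = (\<integral>\<^sup>+k. (\<integral>\<^sup>+x\<in>hcube T. c k \<partial>(lebesgue::'a measure)) \<partial>count_space lat)"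
    using T emeasure_hcube[of T, where 'a='a] by (simp add: nn_integral_cmult_indicator nn_integral_multc mult.commute)
  also have "\<dots> \<le> (\<integral>\<^sup>+k. (\<integral>\<^sup>+x\<in>hcube T. W (x + T *\<^sub>R k) \<partial>lebesgue) \<partial>count_space lat)"
    using le by (intro nn_integral_mono) (auto simp: indicator_def)
  also have "\<dots> = (\<integral>\<^sup>+x. W x \<partial>lebesgue)"
    by (rule nn_integral_tiling[OF _ T, symmetric]) (rule measurable_completion, auto)
  finally show ?thesis .
qed

section \<open>Radial integrals\<close>

lemma omega_eq: "omega TYPE('a::euclidean_space) = unit_ball_vol (real DIM('a))"
  using content_ball[of 1 "0::'a"] by (simp add: omega_def)

lemma omega_pos: "omega TYPE('a::euclidean_space) > 0"
  by (simp add: omega_eq)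

definition radial_density :: "'a::euclidean_space itself \<Rightarrow> real \<Rightarrow> real" where
  "radial_density _ r = real DIM('a) * omega TYPE('a) * r ^ (DIM('a) - 1)"

text \<open>Both measures are determined by their values on the half lines \<open>{..R}\<close>, a
  generator stable under intersection. There the left side is the volume of a ball of radius
  \<open>R\<close>, and the right side integrates the derivative of that volume in the
  radius.\<close>

lemma distr_norm_lborel:
  "distr (lborel :: 'a::euclidean_space measure) borel norm
     = density lborel (\<lambda>r. ennreal (radial_density TYPE('a) r) * indicator {0..} r)"
proof (rule measure_eqI_generator_eq[where E="range atMost" and \<Omega>=UNIV and A="\<lambda>n. {..real n}"])
  let ?d = "DIM('a)" and ?w = "omega TYPE('a)"
  have d: "?d > 0" by simp
  fix X :: "real set" assume "X \<in> range atMost"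
  then obtain R where X: "X = {..R}" by auto
  have "emeasure (distr (lborel :: 'a measure) borel norm) X = emeasure lborel (cball (0::'a) R)"
    by (simp add: X emeasure_distr vimage_def cball_def)
  also have "\<dots> = (if R < 0 then 0 else ennreal (?w * R ^ ?d))"
    by (auto simp: emeasure_cball omega_eq)
  also have "\<dots> = (\<integral>\<^sup>+r. ennreal (radial_density TYPE('a) r) * indicator {0..R} r \<partial>lborel)"
  proof (cases "R < 0")
    case False
    have "(\<integral>\<^sup>+r. ennreal (radial_density TYPE('a) r) * indicator {0..R} r \<partial>lborel) = ennreal (?w * R ^ ?d - ?w * 0 ^ ?d)"
    proof (rule nn_integral_FTC_Icc)
      show "radial_density TYPE('a) \<in> borel_measurable borel"
        unfolding radial_density_def[abs_def] by measurable
      show "0 \<le> R" using False by simp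
      fix x :: real assume x: "x \<in> {0..R}"
      have "((\<lambda>r. ?w * r ^ ?d) has_real_derivative ?w * (real ?d * x ^ (?d - Suc 0))) (at x)"
        by (intro DERIV_cmult DERIV_pow)
      moreover have "?w * (real ?d * x ^ (?d - Suc 0)) = radial_density TYPE('a) x"
        by (simp add: radial_density_def)
      ultimately show "((\<lambda>r. ?w * r ^ ?d) has_real_derivative radial_density TYPE('a) x) (at x)"
        by simp
      show "0 \<le> radial_density TYPE('a) x"
        using x omega_pos[where 'a='a] by (simp add: radial_density_def)
    qed
    then show ?thesis using False d by (simp add: power_0_left)
  qed simp
  also have "\<dots> = emeasure (density lborel (\<lambda>r. ennreal (radial_density TYPE('a) r) * indicator {0..} r)) X"
  proof -
    have [measurable]: "radial_density TYPE('a) \<in> borel_measurable borel"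
      unfolding radial_density_def[abs_def] by measurable
    have "emeasure (density lborel (\<lambda>r. ennreal (radial_density TYPE('a) r) * indicator {0..} r)) X
      = (\<integral>\<^sup>+r. ennreal (radial_density TYPE('a) r) * indicator {0..} r * indicator {..R} r \<partial>lborel)"
      unfolding X by (rule emeasure_density) measurable
    also have "\<dots> = (\<integral>\<^sup>+r. ennreal (radial_density TYPE('a) r) * indicator {0..R} r \<partial>lborel)"
    proof (rule nn_integral_cong)
      fix r :: real
      show "ennreal (radial_density TYPE('a) r) * indicator {0..} r * indicator {..R} r
        = ennreal (radial_density TYPE('a) r) * indicator {0..R} r"
        by (cases "0 \<le> r"; cases "r \<le> R"; simp)
    qed
    finally show ?thesis ..
  qed
  finally show "emeasure (distr (lborel :: 'a measure) borel norm) X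
    = emeasure (density lborel (\<lambda>r. ennreal (radial_density TYPE('a) r) * indicator {0..} r)) X" .
next
  show "Int_stable (range (atMost :: real \<Rightarrow> _))"
    by (auto simp: Int_stable_def)
  show "(\<Union>i. {..real i}) = UNIV" by (auto simp: real_arch_simple)
  show "emeasure (distr (lborel::'a measure) borel norm) {..real i} \<noteq> \<infinity>" for i
  proof -
    have "emeasure (distr (lborel::'a measure) borel norm) {..real i} = emeasure lborel (cball (0::'a) (real i))"
      by (simp add: emeasure_distr vimage_def cball_def)
    then show ?thesis by (simp add: emeasure_cball)
  qed
  show "sets (distr (lborel::'a measure) borel norm) = sigma_sets UNIV (range atMost)"
    by (subst sets_distr) (simp add: borel_eq_atMost)
  show "sets (density lborel (\<lambda>r. ennreal (radial_density TYPE('a) r) * indicator {0..} r)) = sigma_sets UNIV (range atMost)"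
    by (subst sets_density) (simp add: borel_eq_atMost)
qed auto

lemma nn_integral_radial:
  fixes f :: "real \<Rightarrow> ennreal"
  assumes [measurable]: "f \<in> borel_measurable borel"
  shows "(\<integral>\<^sup>+x. f (norm x) \<partial>(lebesgue :: 'a::euclidean_space measure))
    = (\<integral>\<^sup>+r. ennreal (radial_density TYPE('a) r) * indicator {0..} r * f r \<partial>lborel)"
proof -
  have "(\<integral>\<^sup>+x. f (norm x) \<partial>(lebesgue :: 'a measure)) = (\<integral>\<^sup>+r. f r \<partial>distr (lborel :: 'a measure) borel norm)"
    by (simp add: nn_integral_completion nn_integral_distr)
  also have "\<dots> = (\<integral>\<^sup>+r. ennreal (radial_density TYPE('a) r) * indicator {0..} r * f r \<partial>lborel)"
    unfolding distr_norm_lborel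
    by (rule nn_integral_density) (auto simp: radial_density_def[abs_def])
  finally show ?thesis .
qed

lemma radial_density_mult_powr:
  assumes "r > 0"
  shows "radial_density TYPE('a::euclidean_space) r * r powr (e - real DIM('a))
    = real DIM('a) * omega TYPE('a) * r powr (e - 1)"
proof -
  have "r ^ (DIM('a) - 1) = r powr (real DIM('a) - 1)"
    using assms by (simp add: powr_realpow[symmetric] of_nat_diff DIM_positive Suc_leI)
  then show ?thesis
    using assms by (simp add: radial_density_def flip: powr_add)
qed

text \<open>The radial density turns the integrand into a multiple of
  \<open>r powr (- a - 1)\<close>. With \<open>a = s * p\<close>, multiplication by \<open>s\<close>
  leaves \<open>p\<close> in the denominator: this is the origin of \<open>d * omega / p\<close> in
  the limit.\<close>

lemma nn_integral_norm_powr_outside: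
  assumes R: "R > 0" and a: "a > 0"
  shows "(\<integral>\<^sup>+x. ennreal (norm x powr (- (real DIM('a) + a))) * indicator {R..} (norm x) \<partial>(lebesgue :: 'a::euclidean_space measure))
    = ennreal (real DIM('a) * omega TYPE('a) * R powr (- a) / a)"
proof -
  let ?c = "real DIM('a) * omega TYPE('a)"
  have "(\<integral>\<^sup>+x. ennreal (norm x powr (- (real DIM('a) + a))) * indicator {R..} (norm x) \<partial>(lebesgue :: 'a measure))
    = (\<integral>\<^sup>+r. ennreal (radial_density TYPE('a) r) * indicator {0..} r * (ennreal (r powr (- (real DIM('a) + a))) * indicator {R..} r) \<partial>lborel)"
    by (rule nn_integral_radial) measurable
  also have "\<dots> = (\<integral>\<^sup>+r. ennreal (?c * r powr (- a - 1)) * indicator {R..} r \<partial>lborel)"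
  proof (rule nn_integral_cong)
    fix r :: real
    show "ennreal (radial_density TYPE('a) r) * indicator {0..} r * (ennreal (r powr (- (real DIM('a) + a))) * indicator {R..} r)
      = ennreal (?c * r powr (- a - 1)) * indicator {R..} r"
      using radial_density_mult_powr[where 'a='a, of r "-a"] R omega_pos[where 'a='a]
      by (auto split: split_indicator simp: ennreal_mult'[symmetric] radial_density_def minus_diff_commute)
  qed
  also have "\<dots> = ennreal (0 - (- ?c * R powr (- a) / a))"
  proof (rule nn_integral_FTC_atLeast)
    show "((\<lambda>r. - ?c * r powr (- a) / a) \<longlongrightarrow> 0) at_top"
      using tendsto_mult[OF tendsto_const tendsto_neg_powr[of "-a" "\<lambda>x. x" at_top], of "- ?c / a"] a
      by (simp add: filterlim_ident)
    fix x assume "R \<le> x"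
    then have x: "x > 0" using R by simp
    show "DERIV (\<lambda>r. - ?c * r powr (- a) / a) x :> ?c * x powr (- a - 1)"
      using x a by (auto intro!: derivative_eq_intros simp: field_simps)
    show "0 \<le> ?c * x powr (- a - 1)" using omega_pos[where 'a='a] by simp
  qed simp
  finally show ?thesis by simp
qed

text \<open>Used with \<open>b = p * (1 - s)\<close>, the exponent that remains when a Lipschitz
  bound absorbs the singularity of the kernel.\<close>

lemma nn_integral_norm_powr_inside:
  assumes R: "R > 0" and b: "b > 0"
  shows "(\<integral>\<^sup>+x. ennreal (norm x powr (b - real DIM('a))) * indicator {..R} (norm x) \<partial>(lebesgue :: 'a::euclidean_space measure))
    = ennreal (real DIM('a) * omega TYPE('a) * R powr b / b)"
proof -
  let ?c = "real DIM('a) * omega TYPE('a)"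
  have c: "?c > 0" using omega_pos[where 'a='a] by simp
  have "(\<integral>\<^sup>+x. ennreal (norm x powr (b - real DIM('a))) * indicator {..R} (norm x) \<partial>(lebesgue :: 'a measure))
    = (\<integral>\<^sup>+r. ennreal (radial_density TYPE('a) r) * indicator {0..} r * (ennreal (r powr (b - real DIM('a))) * indicator {..R} r) \<partial>lborel)"
    by (rule nn_integral_radial) measurable
  also have "\<dots> = (\<integral>\<^sup>+r. ennreal (?c * r powr (b - 1)) * indicator {0..R} r \<partial>lborel)"
  proof (rule nn_integral_cong)
    fix r :: real
    show "ennreal (radial_density TYPE('a) r) * indicator {0..} r * (ennreal (r powr (b - real DIM('a))) * indicator {..R} r)
      = ennreal (?c * r powr (b - 1)) * indicator {0..R} r"
      using radial_density_mult_powr[where 'a='a, of r b] R c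
      by (cases "r = 0") (auto split: split_indicator simp: ennreal_mult'[symmetric] radial_density_def)
  qed
  also have "\<dots> = (\<integral>\<^sup>+r. ennreal (?c * r powr (b - 1) * indicator {0..R} r) \<partial>lborel)"
    by (intro nn_integral_cong) (auto split: split_indicator)
  also have "\<dots> = ennreal (?c * R powr b / b)"
  proof -
    have "((\<lambda>r. r powr (b - 1)) has_integral (R powr (b - 1 + 1) / (b - 1 + 1))) {0..R}"
      by (rule has_integral_powr_from_0) (use b R in auto)
    from has_integral_mult_right[OF this, of ?c]
    have "((\<lambda>r. ?c * r powr (b - 1)) has_integral (?c * (R powr b / b))) {0..R}"
      by simp
    then have "((\<lambda>r. if r \<in> {0..R} then ?c * r powr (b - 1) else 0) has_integral (?c * (R powr b / b))) UNIV"
      by (simp only: has_integral_restrict_UNIV)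
    moreover have "(\<lambda>r. if r \<in> {0..R} then ?c * r powr (b - 1) else 0) = (\<lambda>r. ?c * r powr (b - 1) * indicator {0..R} r)"
      by (simp add: fun_eq_iff indicator_def)
    ultimately have *: "((\<lambda>r. ?c * r powr (b - 1) * indicator {0..R} r) has_integral (?c * (R powr b / b))) UNIV"
      by simp
    have "(\<integral>\<^sup>+r. ennreal (?c * r powr (b - 1) * indicator {0..R} r) \<partial>lborel) = ennreal (?c * (R powr b / b))"
      by (rule nn_integral_has_integral_lborel[OF _ _ *]) (use c in auto)
    then show ?thesis by simp
  qed
  finally show ?thesis .
qed

section \<open>The nonlocal energy compared with the double integral over one period\<close>

lemma ennreal_inverse_antimono: "(a::ennreal) \<le> b \<Longrightarrow> inverse b \<le> inverse a"
proof (cases "a = 0 \<or> b = top")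
  case False
  assume "a \<le> b"
  with False obtain r q where "a = ennreal r" "b = ennreal q" "0 < r" "r \<le> q"
    by (cases a; cases b) (auto simp: less_le top_unique)
  then show ?thesis by (simp add: inverse_ennreal)
qed auto

lemma sigma_finite_lebesgue: "sigma_finite_measure (lebesgue :: 'a::euclidean_space measure)"
proof -
  from lborel.sigma_finite_countable obtain A :: "'a set set" where
   "countable A" "A \<subseteq> sets lborel" "\<Union>A = space lborel" "\<forall>a\<in>A. emeasure lborel a \<noteq> \<infinity>" by auto
  then show ?thesis by (intro sigma_finite_measure.intro exI[of _ A]) auto
qed

interpretation lebesgue: sigma_finite_measure lebesgue
  by (rule sigma_finite_lebesgue)

lemma measurable_ident_lebesgue_borel[measurable]: "(\<lambda>x. x) \<in> lebesgue \<rightarrow>\<^sub>M borel"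
  by (rule measurable_completion) simp

lemma borel_measurable_nn_integral_countable: assumes "countable I" "\<And>i. i \<in> I \<Longrightarrow> f i \<in> borel_measurable M"
 shows "(\<lambda>x. \<integral>\<^sup>+i. f i x \<partial>count_space I) \<in> borel_measurable M"
proof (cases "finite I")
  case True then show ?thesis using assms by (simp add: nn_integral_count_space_finite)
next
  case False
  have "(\<integral>\<^sup>+i. f i x \<partial>count_space I) = (\<Sum>n. f (from_nat_into I n) x)" for x
    using nn_integral_bij_count_space[OF bij_betw_from_nat_into[OF assms(1) False], of "\<lambda>i. f i x"]
    by (simp add: nn_integral_count_space_nat)
  then show ?thesis using assms(2) False by (simp add: from_nat_into infinite_imp_nonempty)
qed

text \<open>In \<open>ennreal\<close> the kernel is infinite at the origin, whereas \<open>0 powr -a = 0\<close> in the reals.\<close>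
definition ker :: "real \<Rightarrow> real \<Rightarrow> ennreal" where
  "ker a r = inverse (ennreal (r powr a))"

lemma ker_measurable[measurable]: "ker a \<in> borel_measurable borel"
  unfolding ker_def[abs_def] by measurable

lemma ker_antimono:
  assumes "0 \<le> r" "r \<le> r'" "0 \<le> a"
  shows "ker a r' \<le> ker a r"
proof -
  have "r powr a \<le> r' powr a" using assms by (intro powr_mono2) auto
  then show ?thesis
    by (simp add: ker_def ennreal_inverse_antimono)
qed

lemma ker_pos: "r > 0 \<Longrightarrow> ker a r = ennreal (r powr (- a))"
  by (simp add: ker_def inverse_ennreal powr_minus)

text \<open>The kernels differ only on the diagonal. There the difference of the values of
  \<open>u\<close> vanishes, and zero times infinity is zero in \<open>ennreal\<close>.\<close>

lemma Fs_ker: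
  fixes u :: "'a::euclidean_space \<Rightarrow> real"
  shows "Fs p s T u = (\<integral>\<^sup>+x\<in>cube T. (\<integral>\<^sup>+y. ennreal (\<bar>u x - u y\<bar> powr p) * ker (real DIM('a) + s * p) (norm (x - y)) \<partial>lebesgue) \<partial>lebesgue)"
proof -
  have "ennreal (\<bar>u x - u y\<bar> powr p / norm (x - y) powr (real DIM('a) + s * p))
    = ennreal (\<bar>u x - u y\<bar> powr p) * ker (real DIM('a) + s * p) (norm (x - y))" for x y
  proof (cases "x = y")
    case False
    then show ?thesis
      by (simp add: ker_def divide_ennreal[symmetric] divide_ennreal_def)
  qed simp
  then show ?thesis by (simp add: Fs_def)
qed

lemma norm_cube:
  fixes x :: "'a::euclidean_space"
  assumes "x \<in> cube T"
  shows "norm x \<le> norm (T *\<^sub>R One :: 'a)"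
  by (rule norm_le_componentwise) (use assms in \<open>force simp: cube_def mem_box\<close>)

lemma norm_diff_cube:
  fixes x :: "'a::euclidean_space"
  assumes "x \<in> cube T" "y \<in> cube T"
  shows "norm (x - y) \<le> norm (T *\<^sub>R One :: 'a)"
proof (rule norm_le_componentwise)
  fix b :: 'a assume b: "b \<in> Basis"
  then have "0 \<le> x \<bullet> b" "x \<bullet> b \<le> T" "0 \<le> y \<bullet> b" "y \<bullet> b \<le> T"
    using assms by (auto simp: cube_def mem_box)
  then show "\<bar>(x - y) \<bullet> b\<bar> \<le> \<bar>(T *\<^sub>R One) \<bullet> b\<bar>"
    using b by (simp add: inner_diff_left)
qed

text \<open>The vectors \<open>x - (y + T *\<^sub>R k)\<close> and \<open>z + T *\<^sub>R k\<close>
  add up to \<open>x + (z - y)\<close>, whose norm is at most twice the diagonal of the period,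
  uniformly in \<open>k\<close>. Distances may thus be read off at any point \<open>z\<close> of the
  cell.\<close>

lemma lattice_shift_norm_le:
  fixes x y z :: "'a::euclidean_space"
  assumes x: "x \<in> cube T" and y: "y \<in> hcube T" and z: "z \<in> hcube T"
  shows "norm (x - (y + T *\<^sub>R k)) \<le> norm (z + T *\<^sub>R k) + 2 * norm (T *\<^sub>R One :: 'a)"
    and "norm (z + T *\<^sub>R k) \<le> norm (x - (y + T *\<^sub>R k)) + 2 * norm (T *\<^sub>R One :: 'a)"
proof -
  have "norm (x + (z - y)) \<le> 2 * norm (T *\<^sub>R One :: 'a)"
    using norm_triangle_ineq[of x "z - y"] norm_cube[OF x] norm_diff_cube[of z T y]
      subsetD[OF hcube_subset_cube y] subsetD[OF hcube_subset_cube z] by linarith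
  then show "norm (x - (y + T *\<^sub>R k)) \<le> norm (z + T *\<^sub>R k) + 2 * norm (T *\<^sub>R One :: 'a)"
    "norm (z + T *\<^sub>R k) \<le> norm (x - (y + T *\<^sub>R k)) + 2 * norm (T *\<^sub>R One :: 'a)"
    using norm_triangle_ineq4[of "x + (z - y)" "z + T *\<^sub>R k"] norm_triangle_ineq4[of "x + (z - y)" "x - (y + T *\<^sub>R k)"]
    by (simp_all add: algebra_simps)
qed

lemma periodic_ae_diff:
  fixes u :: "'a::euclidean_space \<Rightarrow> real"
  assumes "periodic_ae T u" "k \<in> lat"
  shows "AE y in lebesgue. ennreal (\<bar>c - u (y + T *\<^sub>R k)\<bar> powr p) = ennreal (\<bar>c - u y\<bar> powr p)"
  using periodic_ae_lat[OF assms] by eventually_elim simp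

text \<open>For fixed \<open>x\<close> the inner integral unfolds into a lattice sum of kernels. The
  kernel decreases, so each term dominates the kernel at \<open>norm w + 2 * D\<close> throughout a
  cell, and the sum dominates the integral of \<open>?W\<close> divided by the volume of the period.
  This bound depends on neither \<open>x\<close> nor \<open>y\<close>; what remains is
  \<open>F0\<close>.\<close>

lemma Fs_ge_kernel:
  fixes u :: "'a::euclidean_space \<Rightarrow> real"
  assumes u[measurable]: "u \<in> borel_measurable lebesgue" and per: "periodic_ae T u"
    and T: "T > 0" and a: "real DIM('a) + s * p \<ge> 0"
  defines "D \<equiv> norm (T *\<^sub>R One :: 'a)"
  shows "(\<integral>\<^sup>+w. ker (real DIM('a) + s * p) (norm w + 2 * D) \<partial>(lebesgue :: 'a measure)) * F0 p T u
     \<le> ennreal (T ^ DIM('a)) * Fs p s T u"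
proof -
  let ?g = "\<lambda>x y. ennreal (\<bar>u x - u y\<bar> powr p)"
  let ?a = "real DIM('a) + s * p"
  let ?W = "\<lambda>w::'a. ker ?a (norm w + 2 * D)"
  define J where "J = (\<integral>\<^sup>+w. ?W w \<partial>lebesgue)"
  have [measurable]: "(\<lambda>x. ennreal (\<bar>c - u x\<bar> powr p)) \<in> borel_measurable lebesgue" for c by measurable
  have inner: "J * (\<integral>\<^sup>+y\<in>cube T. ?g x y \<partial>lebesgue)
      \<le> ennreal (T ^ DIM('a)) * (\<integral>\<^sup>+y. ?g x y * ker ?a (norm (x - y)) \<partial>lebesgue)"
    if x: "x \<in> cube T" for x
  proof -
    let ?w = "\<lambda>y. ker ?a (norm (x - y))"
    have [measurable]: "?w \<in> borel_measurable borel" by measurable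
    have [measurable]: "(\<lambda>y. ?w (y + c)) \<in> borel_measurable lebesgue" for c
      by (rule measurable_completion, rule measurable_compose[of _ _ borel, OF _ \<open>?w \<in> borel_measurable borel\<close>]) simp
    have S: "J \<le> ennreal (T ^ DIM('a)) * (\<integral>\<^sup>+k. ?w (y + T *\<^sub>R k) \<partial>count_space lat)" if y: "y \<in> hcube T" for y
      unfolding J_def
    proof (rule lattice_sum_ge[OF _ T])
      fix k z :: 'a assume z: "z \<in> hcube T"
      show "?W (z + T *\<^sub>R k) \<le> ?w (y + T *\<^sub>R k)"
        using lattice_shift_norm_le(1)[OF x y z, of k] a unfolding D_def by (intro ker_antimono) auto
    qed measurable
    have "J * (\<integral>\<^sup>+y\<in>cube T. ?g x y \<partial>lebesgue)
        = (\<integral>\<^sup>+y\<in>hcube T. ?g x y * J \<partial>lebesgue)"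
      by (subst nn_integral_hcube_cube[symmetric], subst nn_integral_cmult[symmetric]) (auto simp: mult_ac)
    also have "\<dots> \<le> (\<integral>\<^sup>+y\<in>hcube T. ?g x y *
        (ennreal (T ^ DIM('a)) * (\<integral>\<^sup>+k. ?w (y + T *\<^sub>R k) \<partial>count_space lat)) \<partial>lebesgue)"
      using S by (intro nn_integral_mono) (auto simp: indicator_def intro: mult_left_mono)
    also have "\<dots> = (\<integral>\<^sup>+y. ennreal (T ^ DIM('a)) * (?g x y *
        (\<integral>\<^sup>+k. ?w (y + T *\<^sub>R k) \<partial>count_space lat) * indicator (hcube T) y) \<partial>lebesgue)"
      by (simp add: mult_ac)
    also have "\<dots> = ennreal (T ^ DIM('a)) * (\<integral>\<^sup>+y\<in>hcube T. ?g x y *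
        (\<integral>\<^sup>+k. ?w (y + T *\<^sub>R k) \<partial>count_space lat) \<partial>lebesgue)"
    proof (rule nn_integral_cmult)
      have "(\<lambda>y. \<integral>\<^sup>+k. ?w (y + T *\<^sub>R k) \<partial>count_space lat) \<in> borel_measurable lebesgue"
        by (intro borel_measurable_nn_integral_countable countable_lat) auto
      then show "(\<lambda>y. ?g x y * (\<integral>\<^sup>+k. ?w (y + T *\<^sub>R k) \<partial>count_space lat) * indicator (hcube T) y) \<in> borel_measurable lebesgue"
        by measurable
    qed
    also have "(\<integral>\<^sup>+y\<in>hcube T. ?g x y *
        (\<integral>\<^sup>+k. ?w (y + T *\<^sub>R k) \<partial>count_space lat) \<partial>lebesgue)
        = (\<integral>\<^sup>+y. ?g x y * ?w y \<partial>lebesgue)"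
      by (rule nn_integral_periodic_tiling[OF _ _ T periodic_ae_diff[OF per], symmetric]) auto
    finally show ?thesis .
  qed
  have "J * F0 p T u = (\<integral>\<^sup>+x\<in>cube T. J * (\<integral>\<^sup>+y\<in>cube T. ?g x y \<partial>lebesgue) \<partial>lebesgue)"
    unfolding F0_def mult.assoc[of J]
    by (rule nn_integral_cmult[symmetric]) (unfold cube_def, measurable)
  also have "\<dots> \<le> (\<integral>\<^sup>+x. ennreal (T ^ DIM('a)) * ((\<integral>\<^sup>+y. ?g x y * ker ?a (norm (x - y)) \<partial>lebesgue) * indicator (cube T) x) \<partial>lebesgue)"
    using inner by (intro nn_integral_mono) (auto simp: indicator_def)
  also have "\<dots> = ennreal (T ^ DIM('a)) * Fs p s T u"
    unfolding Fs_ker by (rule nn_integral_cmult) (unfold cube_def, measurable)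
  finally show ?thesis by (simp add: J_def)
qed

text \<open>Lower bound for \<open>s / T ^ DIM('a)\<close> times the integral of the shifted kernel
  when only \<open>norm w \<ge> 1 / s\<close> is kept. There
  \<open>norm w + 2 * D \<le> (1 + 2 * D * s) * norm w\<close>, whence the first power; the second
  comes from integrating from radius \<open>1 / s\<close>. Both tend to \<open>1\<close>, and the
  last factor is the constant of the limit.\<close>

definition low_const :: "'a::euclidean_space itself \<Rightarrow> real \<Rightarrow> real \<Rightarrow> real \<Rightarrow> real" where
  "low_const _ p T s = (1 + 2 * norm (T *\<^sub>R One :: 'a) * s) powr (- (real DIM('a) + s * p)) * (1 / s) powr (- (s * p))
     * (real DIM('a) * omega TYPE('a) / (p * T ^ DIM('a)))"

lemma Fs_ge_F0:
  fixes u :: "'a::euclidean_space \<Rightarrow> real"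
  assumes "u \<in> borel_measurable lebesgue" "periodic_ae T u" and T: "T > 0" and p: "p \<ge> 1" and s: "s > 0"
  shows "ennreal (low_const TYPE('a) p T s) * F0 p T u \<le> ennreal s * Fs p s T u"
proof -
  define D where "D = norm (T *\<^sub>R One :: 'a)"
  define a where "a = real DIM('a) + s * p"
  define q where "q = (1 + 2 * D * s) powr (- a)"
  define c where "c = real DIM('a) * omega TYPE('a) * (1 / s) powr (- (s * p)) / (s * p)"
  have c: "c \<ge> 0" using omega_pos[where 'a='a] s p by (simp add: c_def)
  have D: "D \<ge> 0" by (simp add: D_def)
  have a: "a \<ge> 0" using s p by (simp add: a_def)
  have "ennreal (q * c) = ennreal q * (\<integral>\<^sup>+x. ennreal (norm x powr (- a)) * indicator {1/s..} (norm x) \<partial>(lebesgue :: 'a measure))"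
  proof -
    have "(\<integral>\<^sup>+x. ennreal (norm x powr (- a)) * indicator {1/s..} (norm x) \<partial>(lebesgue :: 'a measure)) = ennreal c"
      unfolding a_def c_def by (rule nn_integral_norm_powr_outside) (use s p in auto)
    then show ?thesis by (simp add: ennreal_mult' q_def)
  qed
  also have "\<dots> = (\<integral>\<^sup>+x. ennreal q * (ennreal (norm x powr (- a)) * indicator {1/s..} (norm x)) \<partial>(lebesgue :: 'a measure))"
    by (rule nn_integral_cmult[symmetric]) measurable
  also have "\<dots> \<le> (\<integral>\<^sup>+x. ker a (norm x + 2 * D) \<partial>(lebesgue :: 'a measure))"
  proof (rule nn_integral_mono)
    fix x :: 'a
    show "ennreal q * (ennreal (norm x powr (- a)) * indicator {1/s..} (norm x)) \<le> ker a (norm x + 2 * D)"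
    proof (cases "1/s \<le> norm x")
      case True
      then have x: "norm x > 0" using s by (smt (verit) divide_pos_pos)
      have "1 \<le> norm x * s" using True s by (simp add: field_simps)
      then have "D * 1 \<le> D * (norm x * s)" using D by (rule mult_left_mono)
      then have le: "norm x + 2 * D \<le> (1 + 2 * D * s) * norm x" by (simp add: algebra_simps)
      have pos: "(1 + 2 * D * s) * norm x > 0"
        using x D s by (intro mult_pos_pos) (auto intro: add_pos_nonneg)
      have "ennreal q * ennreal (norm x powr (- a)) = ker a ((1 + 2 * D * s) * norm x)"
        using D s x pos by (simp add: ker_pos q_def powr_mult ennreal_mult')
      also have "\<dots> \<le> ker a (norm x + 2 * D)"
        using le D a by (intro ker_antimono) auto
      finally show ?thesis using True by simp
    qed simp
  qed
  finally have 1: "ennreal (q * c) * F0 p T u \<le> ennreal (T ^ DIM('a)) * Fs p s T u"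
    using Fs_ge_kernel[OF assms(1,2) T, where s=s and p=p] a unfolding a_def D_def
    by (meson mult_right_mono order_trans zero_le)
  have "low_const TYPE('a) p T s = (s / T ^ DIM('a)) * (q * c)"
    using s p T by (simp add: low_const_def q_def c_def a_def D_def field_simps)
  then have "ennreal (low_const TYPE('a) p T s) * F0 p T u = ennreal (s / T ^ DIM('a)) * (ennreal (q * c) * F0 p T u)"
    using s T by (simp only: ennreal_mult' mult.assoc divide_nonneg_nonneg less_imp_le zero_le_power)
  also have "\<dots> \<le> ennreal (s / T ^ DIM('a)) * (ennreal (T ^ DIM('a)) * Fs p s T u)"
    by (rule mult_left_mono[OF 1]) simp
  also have "\<dots> = ennreal s * Fs p s T u"
    using s T by (simp add: mult.assoc[symmetric] ennreal_mult'[symmetric])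
  finally show ?thesis .
qed

lemma norm_scaleR_One_pos: "T > 0 \<Longrightarrow> norm (T *\<^sub>R One :: 'a::euclidean_space) > 0"
  by simp

lemma at_right_sequence:
  fixes s :: "nat \<Rightarrow> real"
  assumes "\<forall>n. 0 < s n" "s \<longlonglongrightarrow> 0"
  shows "filterlim s (at_right 0) sequentially"
proof -
  have "\<forall>n. s n \<noteq> 0 \<and> s n \<in> {0<..}" using assms(1) by (metis greaterThan_iff less_irrefl)
  then show ?thesis by (simp add: filterlim_at assms(2))
qed

lemma low_const_tendsto:
  assumes "p \<ge> 1" "T > 0" "\<forall>n. 0 < s n" "s \<longlonglongrightarrow> 0"
  shows "(\<lambda>n. low_const TYPE('a::euclidean_space) p T (s n)) \<longlonglongrightarrow> real DIM('a) * omega TYPE('a) / (p * T ^ DIM('a))"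
proof -
  have *: "((\<lambda>s. (1 + 2 * D * s) powr (-(d + s * p)) * (1/s) powr (-(s * p))) \<longlongrightarrow> 1) (at_right 0)"
    if "D > 0" "d > 0" for D d :: real
    using that assms(1) by real_asymp
  have "(\<lambda>n. low_const TYPE('a) p T (s n)) \<longlonglongrightarrow> 1 * (real DIM('a) * omega TYPE('a) / (p * T ^ DIM('a)))"
    unfolding low_const_def
    by (intro tendsto_mult tendsto_const filterlim_compose[OF * at_right_sequence] norm_scaleR_One_pos assms) auto
  then show ?thesis by simp
qed

text \<open>Counterpart of \<open>low_const\<close> for the cutoff radius
  \<open>R = s powr (- 1 / (2 * p))\<close>. As \<open>R\<close> tends to infinity,
  \<open>1 - 2 * D / R\<close> tends to \<open>1\<close>, while
  \<open>R powr (- (s * p)) = s powr (s / 2)\<close> tends to \<open>1\<close> as well.\<close>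

definition up_const :: "'a::euclidean_space itself \<Rightarrow> real \<Rightarrow> real \<Rightarrow> real \<Rightarrow> real" where
  "up_const _ p T s = (1 - 2 * norm (T *\<^sub>R One :: 'a) / s powr (- 1 / (2 * p))) powr (- (real DIM('a) + s * p))
     * (s powr (- 1 / (2 * p))) powr (- (s * p)) * (real DIM('a) * omega TYPE('a) / (p * T ^ DIM('a)))"

text \<open>Bound for \<open>s\<close> times the energy carried by distances up to
  \<open>R + 2 * D\<close>, for Lipschitz constant \<open>1\<close> and the same \<open>R\<close>.
  Since \<open>R powr p = s powr (- 1 / 2)\<close>, it is of order
  \<open>s powr (1 / 2)\<close>.\<close>

definition err_const :: "'a::euclidean_space itself \<Rightarrow> real \<Rightarrow> real \<Rightarrow> real \<Rightarrow> real" where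
  "err_const _ p T s = s * (s powr (- 1 / (2 * p)) + 2 * norm (T *\<^sub>R One :: 'a)) powr (p * (1 - s)) / (p * (1 - s))
     * (real DIM('a) * omega TYPE('a) * T ^ DIM('a))"

lemma up_const_tendsto:
  assumes "p \<ge> 1" "T > 0" "\<forall>n. 0 < s n" "s \<longlonglongrightarrow> 0"
  shows "(\<lambda>n. up_const TYPE('a::euclidean_space) p T (s n)) \<longlonglongrightarrow> real DIM('a) * omega TYPE('a) / (p * T ^ DIM('a))"
proof -
  have *: "((\<lambda>s. (1 - 2 * D / s powr (- 1 / (2 * p))) powr (-(d + s * p)) * (s powr (- 1 / (2 * p))) powr (-(s * p))) \<longlongrightarrow> 1) (at_right 0)"
    if "D > 0" "d > 0" for D d :: real
    using that assms(1) by real_asymp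
  have "(\<lambda>n. up_const TYPE('a) p T (s n)) \<longlonglongrightarrow> 1 * (real DIM('a) * omega TYPE('a) / (p * T ^ DIM('a)))"
    unfolding up_const_def
    by (intro tendsto_mult tendsto_const filterlim_compose[OF * at_right_sequence] norm_scaleR_One_pos assms) auto
  then show ?thesis by simp
qed

lemma err_const_tendsto:
  assumes "p \<ge> 1" "T > 0" "\<forall>n. 0 < s n" "s \<longlonglongrightarrow> 0"
  shows "(\<lambda>n. err_const TYPE('a::euclidean_space) p T (s n)) \<longlonglongrightarrow> 0"
proof -
  have *: "((\<lambda>s. s * (s powr (- 1 / (2 * p)) + 2 * D) powr (p * (1 - s)) / (p * (1 - s))) \<longlongrightarrow> 0) (at_right 0)"
    if "D > 0" for D :: real
    using that assms(1) by real_asymp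
  have "(\<lambda>n. err_const TYPE('a) p T (s n)) \<longlonglongrightarrow> 0 * (real DIM('a) * omega TYPE('a) * T ^ DIM('a))"
    unfolding err_const_def
    by (intro tendsto_mult tendsto_const filterlim_compose[OF * at_right_sequence] norm_scaleR_One_pos assms)
  then show ?thesis by simp
qed

section \<open>Upper comparison for Lipschitz functions\<close>

lemma far_kernel_integral_le:
  fixes D R a p s :: real
  assumes "D \<ge> 0" "R > 2 * D" "p > 0" "s > 0"
  shows "(\<integral>\<^sup>+v. ker (real DIM('a) + s * p) (norm v - 2 * D) * indicator {R..} (norm v) \<partial>(lebesgue :: 'a::euclidean_space measure))
    \<le> ennreal ((1 - 2 * D / R) powr (- (real DIM('a) + s * p)) * (real DIM('a) * omega TYPE('a) * R powr (- (s * p)) / (s * p)))"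
proof -
  define a where "a = real DIM('a) + s * p"
  define q where "q = (1 - 2 * D / R) powr (- a)"
  have R: "R > 0" using assms by linarith
  have a: "a \<ge> 0" using assms by (simp add: a_def)
  have f: "1 - 2 * D / R > 0" using R assms by (simp add: field_simps)
  have "(\<integral>\<^sup>+v. ker a (norm v - 2 * D) * indicator {R..} (norm v) \<partial>(lebesgue :: 'a measure))
    \<le> (\<integral>\<^sup>+x. ennreal q * (ennreal (norm x powr (- a)) * indicator {R..} (norm x)) \<partial>(lebesgue :: 'a measure))"
  proof (rule nn_integral_mono)
    fix x :: 'a
    show "ker a (norm x - 2 * D) * indicator {R..} (norm x) \<le> ennreal q * (ennreal (norm x powr (- a)) * indicator {R..} (norm x))"
    proof (cases "R \<le> norm x")
      case True
      then have x: "norm x > 0" using R by linarith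
      \<comment> \<open>Since \<open>R \<le> norm x\<close>, the subtracted \<open>2 * D\<close> is
        at most the fraction \<open>2 * D / R\<close> of \<open>norm x\<close>; the shifted kernel
        is therefore at most a constant multiple of the unshifted one.\<close>
      have "D * R \<le> D * norm x" using True assms by (intro mult_left_mono)
      then have le: "(1 - 2 * D / R) * norm x \<le> norm x - 2 * D" using R by (simp add: field_simps)
      have pos: "(1 - 2 * D / R) * norm x > 0" using f x by (rule mult_pos_pos)
      have "ker a (norm x - 2 * D) \<le> ker a ((1 - 2 * D / R) * norm x)"
        using le pos a by (intro ker_antimono) auto
      also have "\<dots> = ennreal q * ennreal (norm x powr (- a))"
        using f x pos by (simp add: ker_pos q_def powr_mult ennreal_mult')
      finally show ?thesis using True by simp
    qed simp
  qed
  also have "\<dots> = ennreal q * (\<integral>\<^sup>+x. ennreal (norm x powr (- a)) * indicator {R..} (norm x) \<partial>(lebesgue :: 'a measure))"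
    by (rule nn_integral_cmult) measurable
  also have "(\<integral>\<^sup>+x. ennreal (norm x powr (- a)) * indicator {R..} (norm x) \<partial>(lebesgue :: 'a measure))
    = ennreal (real DIM('a) * omega TYPE('a) * R powr (- (s * p)) / (s * p))"
    unfolding a_def by (rule nn_integral_norm_powr_outside) (use assms R in auto)
  also have "ennreal q * \<dots> = ennreal (q * (real DIM('a) * omega TYPE('a) * R powr (- (s * p)) / (s * p)))"
    by (rule ennreal_mult'[symmetric]) (simp add: q_def)
  finally show ?thesis by (simp add: a_def q_def)
qed

text \<open>The Lipschitz bound contributes \<open>r powr p\<close> against the kernel
  \<open>r powr (- (d + s * p))\<close>. The product has exponent \<open>p * (1 - s) - d\<close>,
  which is integrable at the origin because \<open>s < 1\<close>.\<close>

lemma near_kernel_integral_le: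
  fixes g :: "'a::euclidean_space \<Rightarrow> real"
  assumes lip: "\<And>y. \<bar>g x - g y\<bar> \<le> L * norm (x - y)" and L: "L \<ge> 0" and p: "p > 0" and s: "0 < s" "s < 1" and R: "R > 0"
  shows "(\<integral>\<^sup>+y. ennreal (\<bar>g x - g y\<bar> powr p) * (ker (real DIM('a) + s * p) (norm (x - y)) * indicator {..R} (norm (x - y))) \<partial>lebesgue)
    \<le> ennreal (L powr p * (real DIM('a) * omega TYPE('a) * R powr (p * (1 - s)) / (p * (1 - s))))"
proof -
  let ?h = "\<lambda>r. ennreal (r powr (p * (1 - s) - real DIM('a))) * indicator {..R} r"
  have hm[measurable]: "(\<lambda>x::'a. ?h (norm x)) \<in> borel_measurable borel" by measurable
  have "(\<integral>\<^sup>+y. ennreal (\<bar>g x - g y\<bar> powr p) * (ker (real DIM('a) + s * p) (norm (x - y)) * indicator {..R} (norm (x - y))) \<partial>lebesgue)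
    \<le> (\<integral>\<^sup>+y. ennreal (L powr p) * ?h (norm (y + - x)) \<partial>lebesgue)"
  proof (rule nn_integral_mono)
    fix y
    show "ennreal (\<bar>g x - g y\<bar> powr p) * (ker (real DIM('a) + s * p) (norm (x - y)) * indicator {..R} (norm (x - y)))
      \<le> ennreal (L powr p) * ?h (norm (y + - x))"
    proof (cases "x = y \<or> norm (x - y) > R")
      case False
      define r where "r = norm (x - y)"
      have r: "r > 0" "norm (y + - x) = r" using False by (auto simp: r_def norm_minus_commute)
      have "\<bar>g x - g y\<bar> powr p \<le> L powr p * r powr p"
        using powr_mono2[OF _ _ lip, of p y] p r L by (simp add: r_def powr_mult)
      then have "ennreal (\<bar>g x - g y\<bar> powr p) * ker (real DIM('a) + s * p) r \<le> ennreal (L powr p * r powr p) * ker (real DIM('a) + s * p) r"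
        by (intro mult_right_mono ennreal_leI) auto
      also have "\<dots> = ennreal (L powr p) * ennreal (r powr p * r powr (- (real DIM('a) + s * p)))"
        using r by (simp add: ker_pos ennreal_mult' mult.assoc)
      also have "r powr p * r powr (- (real DIM('a) + s * p)) = r powr (p * (1 - s) - real DIM('a))"
        by (simp add: powr_add[symmetric] algebra_simps)
      finally show ?thesis using False r by (simp add: r_def[symmetric])
    qed auto
  qed
  also have "\<dots> = ennreal (L powr p) * (\<integral>\<^sup>+y. ?h (norm (y + - x)) \<partial>lebesgue)"
    by (rule nn_integral_cmult, rule measurable_completion, rule measurable_compose[OF _ hm]) simp
  also have "(\<integral>\<^sup>+y. ?h (norm (y + - x)) \<partial>lebesgue) = (\<integral>\<^sup>+y. ?h (norm y) \<partial>(lebesgue :: 'a measure))"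
    by (rule nn_integral_lebesgue_translation) (rule measurable_completion, simp)
  also have "\<dots> = ennreal (real DIM('a) * omega TYPE('a) * R powr (p * (1 - s)) / (p * (1 - s)))"
    by (rule nn_integral_norm_powr_inside) (use R p s in auto)
  finally show ?thesis by (simp only: ennreal_mult'[OF powr_ge_zero])
qed

text \<open>The unfolding of the lower comparison with the inequality reversed. The cutoff lies at
  \<open>R + 2 * D\<close> so that, whenever it lets a lattice term through, every point of that
  cell has norm at least \<open>R\<close>; then \<open>R > 2 * D\<close> keeps the argument of the
  shifted kernel positive.\<close>

lemma far_integral_le:
  fixes g :: "'a::euclidean_space \<Rightarrow> real"
  assumes g[measurable]: "g \<in> borel_measurable lebesgue" and per: "periodic_ae T g"
    and T: "T > 0" and a: "a \<ge> 0" and x: "x \<in> cube T" and R: "R > 2 * norm (T *\<^sub>R One :: 'a)"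
  defines "D \<equiv> norm (T *\<^sub>R One :: 'a)"
  defines "J \<equiv> (\<integral>\<^sup>+v. ker a (norm v - 2 * D) * indicator {R..} (norm v) \<partial>(lebesgue :: 'a measure))"
  shows "ennreal (T ^ DIM('a)) * (\<integral>\<^sup>+y. ennreal (\<bar>g x - g y\<bar> powr p) * (ker a (norm (x - y)) * indicator {R + 2 * D..} (norm (x - y))) \<partial>lebesgue)
     \<le> J * (\<integral>\<^sup>+y\<in>cube T. ennreal (\<bar>g x - g y\<bar> powr p) \<partial>lebesgue)"
proof -
  let ?g = "\<lambda>x y. ennreal (\<bar>g x - g y\<bar> powr p)"
  let ?w = "\<lambda>y. ker a (norm (x - y)) * indicator {R + 2 * D..} (norm (x - y))"
  let ?W = "\<lambda>v::'a. ker a (norm v - 2 * D) * indicator {R..} (norm v)"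
  have [measurable]: "?w \<in> borel_measurable borel" by measurable
  have [measurable]: "(\<lambda>y. ?w (y + c)) \<in> borel_measurable lebesgue" for c
    by (rule measurable_completion, rule measurable_compose[of _ _ borel, OF _ \<open>?w \<in> borel_measurable borel\<close>]) simp
  have [measurable]: "(\<lambda>x. ennreal (\<bar>c - g x\<bar> powr p)) \<in> borel_measurable lebesgue" for c by measurable
  have S: "ennreal (T ^ DIM('a)) * (\<integral>\<^sup>+k. ?w (y + T *\<^sub>R k) \<partial>count_space lat) \<le> J" if y: "y \<in> hcube T" for y
    unfolding J_def
  proof (rule lattice_sum_le[OF _ T])
    fix k z :: 'a assume z: "z \<in> hcube T"
    have le: "norm (x - (y + T *\<^sub>R k)) \<le> norm (z + T *\<^sub>R k) + 2 * D"
      unfolding D_def by (rule lattice_shift_norm_le(1)[OF x y z])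
    show "?w (y + T *\<^sub>R k) \<le> ?W (z + T *\<^sub>R k)"
    proof (cases "R + 2 * D \<le> norm (x - (y + T *\<^sub>R k))")
      case True
      then have "R \<le> norm (z + T *\<^sub>R k)" using le by linarith
      moreover have "ker a (norm (x - (y + T *\<^sub>R k))) \<le> ker a (norm (z + T *\<^sub>R k) - 2 * D)"
      proof (rule ker_antimono)
        show "norm (z + T *\<^sub>R k) - 2 * D \<le> norm (x - (y + T *\<^sub>R k))"
          using lattice_shift_norm_le(2)[OF x y z, of k] unfolding D_def by linarith
        show "0 \<le> norm (z + T *\<^sub>R k) - 2 * D"
          using \<open>R \<le> norm (z + T *\<^sub>R k)\<close> R unfolding D_def by linarith
      qed (rule a)
      ultimately show ?thesis by (auto simp: indicator_def)
    qed simp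
  qed measurable
  have "(\<lambda>y. \<integral>\<^sup>+k. ?w (y + T *\<^sub>R k) \<partial>count_space lat) \<in> borel_measurable lebesgue"
    by (intro borel_measurable_nn_integral_countable countable_lat) auto
  note [measurable] = this
  have "ennreal (T ^ DIM('a)) * (\<integral>\<^sup>+y. ?g x y * ?w y \<partial>lebesgue)
    = ennreal (T ^ DIM('a)) * (\<integral>\<^sup>+y\<in>hcube T. ?g x y * (\<integral>\<^sup>+k. ?w (y + T *\<^sub>R k) \<partial>count_space lat) \<partial>lebesgue)"
    by (subst nn_integral_periodic_tiling[OF _ _ T periodic_ae_diff[OF per]]) auto
  also have "\<dots> = (\<integral>\<^sup>+y. ennreal (T ^ DIM('a)) * (?g x y *
        (\<integral>\<^sup>+k. ?w (y + T *\<^sub>R k) \<partial>count_space lat) * indicator (hcube T) y) \<partial>lebesgue)"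
    by (rule nn_integral_cmult[symmetric]) measurable
  also have "\<dots> \<le> (\<integral>\<^sup>+y. J * (?g x y * indicator (hcube T) y) \<partial>lebesgue)"
  proof (rule nn_integral_mono)
    fix y
    have "?g x y * (ennreal (T ^ DIM('a)) * (\<integral>\<^sup>+k. ?w (y + T *\<^sub>R k) \<partial>count_space lat)) * indicator (hcube T) y
      \<le> ?g x y * J * indicator (hcube T) y"
    proof (cases "y \<in> hcube T")
      case True
      then show ?thesis using S[OF True] by (simp add: mult_left_mono)
    qed simp
    then show "ennreal (T ^ DIM('a)) * (?g x y *
        (\<integral>\<^sup>+k. ?w (y + T *\<^sub>R k) \<partial>count_space lat) * indicator (hcube T) y)
        \<le> J * (?g x y * indicator (hcube T) y)"
      by (simp only: mult_ac)
  qed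
  also have "\<dots> = J * (\<integral>\<^sup>+y\<in>hcube T. ?g x y \<partial>lebesgue)"
    by (rule nn_integral_cmult) measurable
  finally show ?thesis by (simp only: nn_integral_hcube_cube)
qed

text \<open>Distances up to \<open>R + 2 * D\<close> are controlled by the Lipschitz constant,
  larger ones by \<open>F0\<close>. The hypothesis \<open>small\<close> says
  \<open>R > 2 * D\<close>, as the shifted kernel requires; it holds for all small
  \<open>s\<close>.\<close>

lemma Fs_le_F0:
  fixes g :: "'a::euclidean_space \<Rightarrow> real"
  assumes g[measurable]: "g \<in> borel_measurable lebesgue" and per: "periodic_ae T g"
    and T: "T > 0" and p: "p \<ge> 1" and s: "0 < s" "s < 1"
    and lip: "\<And>x y. \<bar>g x - g y\<bar> \<le> L * norm (x - y)" and L: "L \<ge> 0"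
    and small: "2 * norm (T *\<^sub>R One :: 'a) < s powr (- 1 / (2 * p))"
  shows "ennreal s * Fs p s T g \<le> ennreal (up_const TYPE('a) p T s) * F0 p T g + ennreal (L powr p * err_const TYPE('a) p T s)"
proof -
  let ?g = "\<lambda>x y. ennreal (\<bar>g x - g y\<bar> powr p)"
  define D where "D = norm (T *\<^sub>R One :: 'a)"
  define R where "R = s powr (- 1 / (2 * p))"
  define a where "a = real DIM('a) + s * p"
  define N where "N = L powr p * (real DIM('a) * omega TYPE('a) * (R + 2 * D) powr (p * (1 - s)) / (p * (1 - s)))"
  define J where "J = (1 - 2 * D / R) powr (- a) * (real DIM('a) * omega TYPE('a) * R powr (- (s * p)) / (s * p))"
  have D: "D \<ge> 0" "R > 2 * D" using small by (auto simp: D_def R_def)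
  have a: "a \<ge> 0" using s p by (simp add: a_def)
  have J0: "J \<ge> 0" "N \<ge> 0" using omega_pos[where 'a='a] s p by (auto simp: J_def N_def)
  have [measurable]: "(\<lambda>x. ennreal (\<bar>c - g x\<bar> powr p)) \<in> borel_measurable lebesgue" for c by measurable
  let ?I = "\<lambda>x. (\<integral>\<^sup>+y\<in>cube T. ?g x y \<partial>lebesgue)"
  have I: "?I \<in> borel_measurable lebesgue"
    unfolding cube_def by measurable
  have far: "(\<integral>\<^sup>+v. ker a (norm v - 2 * D) * indicator {R..} (norm v) \<partial>(lebesgue :: 'a measure)) \<le> ennreal J"
    unfolding J_def a_def by (rule far_kernel_integral_le[OF D _ s(1)]) (use p in linarith)
  have inner: "(\<integral>\<^sup>+y. ?g x y * ker a (norm (x - y)) \<partial>lebesgue)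
      \<le> ennreal N + ennreal (J / T ^ DIM('a)) * ?I x" if x: "x \<in> cube T" for x
  proof -
    \<comment> \<open>The two supports overlap in the sphere of radius \<open>R + 2 * D\<close>,
      which is harmless for an upper bound.\<close>
    let ?w1 = "\<lambda>y. ker a (norm (x - y)) * indicator {..R + 2 * D} (norm (x - y))"
    let ?w2 = "\<lambda>y. ker a (norm (x - y)) * indicator {R + 2 * D..} (norm (x - y))"
    have w: "?w1 \<in> borel_measurable borel" "?w2 \<in> borel_measurable borel" by measurable
    have [measurable]: "?w1 \<in> borel_measurable lebesgue" "?w2 \<in> borel_measurable lebesgue"
      by (rule measurable_completion, use w in simp)+
    have "(\<integral>\<^sup>+y. ?g x y * ker a (norm (x - y)) \<partial>lebesgue)
      \<le> (\<integral>\<^sup>+y. ?g x y * ?w1 y + ?g x y * ?w2 y \<partial>lebesgue)"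
      by (rule nn_integral_mono) (auto simp: indicator_def not_le)
    also have "\<dots> = (\<integral>\<^sup>+y. ?g x y * ?w1 y \<partial>lebesgue) + (\<integral>\<^sup>+y. ?g x y * ?w2 y \<partial>lebesgue)"
      by (rule nn_integral_add) measurable
    also have "\<dots> \<le> ennreal N + ennreal (J / T ^ DIM('a)) * ?I x"
    proof (rule add_mono)
      show "(\<integral>\<^sup>+y. ?g x y * ?w1 y \<partial>lebesgue) \<le> ennreal N"
        unfolding N_def a_def by (rule near_kernel_integral_le) (use lip L p s D in auto)
      let ?F = "\<integral>\<^sup>+y. ?g x y * ?w2 y \<partial>lebesgue"
      have "ennreal (T ^ DIM('a)) * ?F \<le> (\<integral>\<^sup>+v. ker a (norm v - 2 * D) * indicator {R..} (norm v) \<partial>(lebesgue :: 'a measure)) * ?I x"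
        unfolding D_def by (rule far_integral_le[OF g per T a x]) (use D in \<open>simp add: D_def\<close>)
      also have "\<dots> \<le> ennreal J * ?I x"
        by (rule mult_right_mono[OF far]) simp
      finally have A: "ennreal (T ^ DIM('a)) * ?F \<le> ennreal J * ?I x" .
      have "?F = ennreal (1 / T ^ DIM('a)) * (ennreal (T ^ DIM('a)) * ?F)"
        using T by (simp add: mult.assoc[symmetric] ennreal_mult'[symmetric])
      also have "\<dots> \<le> ennreal (1 / T ^ DIM('a)) * (ennreal J * ?I x)"
        by (rule mult_left_mono[OF A]) simp
      also have "\<dots> = ennreal (J / T ^ DIM('a)) * ?I x"
        using T J0 by (simp add: mult.assoc[symmetric] ennreal_mult'[symmetric])
      finally show "?F \<le> ennreal (J / T ^ DIM('a)) * ?I x" .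
    qed
    finally show ?thesis .
  qed
  have "Fs p s T g \<le> (\<integral>\<^sup>+x\<in>cube T. ennreal N + ennreal (J / T ^ DIM('a)) * ?I x \<partial>lebesgue)"
    unfolding Fs_ker a_def[symmetric] using inner by (intro nn_integral_mono) (auto simp: indicator_def)
  also have "\<dots> = (\<integral>\<^sup>+x. ennreal N * indicator (cube T) x + ennreal (J / T ^ DIM('a)) * (?I x * indicator (cube T) x) \<partial>(lebesgue :: 'a measure))"
    by (rule nn_integral_cong) (auto simp: indicator_def)
  also have "\<dots> = (\<integral>\<^sup>+x. ennreal N * indicator (cube T) x \<partial>(lebesgue :: 'a measure)) + (\<integral>\<^sup>+x. ennreal (J / T ^ DIM('a)) * (?I x * indicator (cube T) x) \<partial>(lebesgue :: 'a measure))"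
    by (rule nn_integral_add) (use I in \<open>simp_all add: cube_def\<close>)
  also have "(\<integral>\<^sup>+x. ennreal N * indicator (cube T) x \<partial>(lebesgue :: 'a measure)) = ennreal (N * T ^ DIM('a))"
    using T J0 emeasure_cube[of T, where 'a='a] by (simp add: nn_integral_cmult_indicator cube_def ennreal_mult')
  also have "(\<integral>\<^sup>+x. ennreal (J / T ^ DIM('a)) * (?I x * indicator (cube T) x) \<partial>(lebesgue :: 'a measure)) = ennreal (J / T ^ DIM('a)) * F0 p T g"
    unfolding F0_def by (rule nn_integral_cmult) (use I in \<open>simp add: cube_def\<close>)
  finally have "ennreal s * Fs p s T g \<le> ennreal s * (ennreal (N * T ^ DIM('a)) + ennreal (J / T ^ DIM('a)) * F0 p T g)"
    by (rule mult_left_mono) simp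
  also have "\<dots> = ennreal (s * (J / T ^ DIM('a))) * F0 p T g + ennreal (s * (N * T ^ DIM('a)))"
    using s by (simp only: distrib_left ennreal_mult' less_imp_le mult.assoc add.commute)
  also have "s * (J / T ^ DIM('a)) = up_const TYPE('a) p T s"
    using s p T by (simp add: up_const_def J_def D_def R_def a_def field_simps)
  also have "s * (N * T ^ DIM('a)) = L powr p * err_const TYPE('a) p T s"
    using s p T by (simp add: err_const_def N_def D_def R_def)
  finally show ?thesis .
qed

section \<open>Weak lower semicontinuity of the double integral\<close>

text \<open>Affine minorants of the energy may be negative, and \<open>ennreal\<close> cuts them at
  zero; the cut can only increase the integral.\<close>

lemma ennreal_integral_le_nn_integral:
  fixes f :: "'b \<Rightarrow> real"
  assumes "integrable M f"
  shows "ennreal (integral\<^sup>L M f) \<le> (\<integral>\<^sup>+x. ennreal (f x) \<partial>M)"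
proof -
  have "ennreal (integral\<^sup>L M f) \<le> ennreal (\<integral>x. max 0 (f x) \<partial>M)"
    using assms by (intro ennreal_leI integral_mono) auto
  also have "\<dots> = (\<integral>\<^sup>+x. ennreal (max 0 (f x)) \<partial>M)"
    using assms by (intro nn_integral_eq_integral[symmetric]) auto
  finally show ?thesis by (simp add: max_def ennreal_neg cong: if_cong)
    (smt (verit, best) ennreal_0 ennreal_neg nn_integral_cong)
qed

text \<open>Cutting along the level sets of \<open>h\<close> leaves the integrand unchanged where it
  survives, and the bounded pieces increase to the full power. This permits bounded subgradients and
  test functions before any integrability is known.\<close>

lemma nn_integral_powr_truncation:
  fixes h :: "'b \<Rightarrow> real"
  assumes [measurable]: "h \<in> borel_measurable M"
  shows "(\<integral>\<^sup>+x. ennreal (\<bar>h x\<bar> powr q) \<partial>M)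
    = (SUP k. \<integral>\<^sup>+x. ennreal (if \<bar>h x\<bar> \<le> real k then \<bar>h x\<bar> powr q else 0) \<partial>M)"
proof -
  let ?f = "\<lambda>k::nat. \<lambda>x. if \<bar>h x\<bar> \<le> real k then \<bar>h x\<bar> powr q else 0"
  have "(\<integral>\<^sup>+x. ennreal (\<bar>h x\<bar> powr q) \<partial>M) = (\<integral>\<^sup>+x. (SUP k. ennreal (?f k x)) \<partial>M)"
  proof (rule nn_integral_cong)
    fix x
    show "ennreal (\<bar>h x\<bar> powr q) = (SUP k. ennreal (?f k x))"
    proof (rule antisym)
      obtain m where "\<bar>h x\<bar> \<le> real m" using real_arch_simple by blast
      then show "ennreal (\<bar>h x\<bar> powr q) \<le> (SUP k. ennreal (?f k x))"
        by (intro SUP_upper2[of m]) auto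
    qed (auto intro!: SUP_least ennreal_leI)
  qed
  also have "\<dots> = (SUP k. \<integral>\<^sup>+x. ennreal (?f k x) \<partial>M)"
    by (rule nn_integral_monotone_convergence_SUP) (auto simp: incseq_def le_fun_def intro!: ennreal_leI)
  finally show ?thesis .
qed

lemma integrable_mult_bounded:
  fixes f g :: "'b \<Rightarrow> real"
  assumes [measurable]: "g \<in> borel_measurable M" and g: "\<And>x. x \<in> space M \<Longrightarrow> \<bar>g x\<bar> \<le> B" and f: "integrable M f"
  shows "integrable M (\<lambda>x. g x * f x)"
proof (rule Bochner_Integration.integrable_bound[of _ "\<lambda>x. B * f x"])
  show "AE x in M. norm (g x * f x) \<le> norm (B * f x)"
  proof (rule AE_I2)
    fix x assume "x \<in> space M"
    then have "\<bar>g x\<bar> \<le> \<bar>B\<bar>" using g by (meson abs_ge_self order_trans)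
    then show "norm (g x * f x) \<le> norm (B * f x)" by (simp add: abs_mult mult_right_mono)
  qed
qed (use f in auto)

text \<open>A convex functional is the supremum of its affine minorants, and a minorant with bounded
  slope on the product reduces, by Fubini, to integration against a bounded function of one
  variable. Hence bounded test functions suffice for every \<open>p \<ge> 1\<close>, and the energy
  of \<open>v\<close> may even be infinite.\<close>

lemma weak_lsc_double_integral:
  fixes u :: "nat \<Rightarrow> 'b \<Rightarrow> real" and v :: "'b \<Rightarrow> real" and p :: real
  assumes fin: "finite_measure M" and p: "p \<ge> 1"
    and u: "\<And>n. integrable M (u n)" and v: "integrable M v"
    and conv: "\<And>G B. G \<in> borel_measurable M \<Longrightarrow> (\<And>x. x \<in> space M \<Longrightarrow> \<bar>G x\<bar> \<le> B) \<Longrightarrow>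
        (\<lambda>n. \<integral>x. G x * u n x \<partial>M) \<longlonglongrightarrow> (\<integral>x. G x * v x \<partial>M)"
    and c: "c \<longlonglongrightarrow> K" "\<And>n. c n \<ge> 0"
  shows "ennreal K * (\<integral>\<^sup>+x. \<integral>\<^sup>+y. ennreal (\<bar>v x - v y\<bar> powr p) \<partial>M \<partial>M)
    \<le> liminf (\<lambda>n. ennreal (c n) * (\<integral>\<^sup>+x. \<integral>\<^sup>+y. ennreal (\<bar>u n x - u n y\<bar> powr p) \<partial>M \<partial>M))"
proof -
  interpret finite_measure M by fact
  interpret MM: pair_sigma_finite M M ..
  let ?N = "M \<Otimes>\<^sub>M M"
  interpret N: finite_measure ?N by (rule finite_measure_pair_measure) unfold_locales
  have [measurable]: "v \<in> borel_measurable M" "\<And>n. u n \<in> borel_measurable M" using u v by auto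
  define V where "V = (\<lambda>z. v (fst z) - v (snd z))"
  define U where "U = (\<lambda>n z. u n (fst z) - u n (snd z))"
  have [measurable]: "V \<in> borel_measurable ?N" "\<And>n. U n \<in> borel_measurable ?N"
    unfolding V_def U_def by measurable
  have K: "K \<ge> 0" using c by (intro LIMSEQ_le_const) auto
  have I1: "integrable ?N (\<lambda>z. f (fst z))" and I2: "integrable ?N (\<lambda>z. f (snd z))" if f: "integrable M f" for f :: "'b \<Rightarrow> real"
  proof -
    have [measurable]: "f \<in> borel_measurable M" using f by auto
    show 1: "integrable ?N (\<lambda>z. f (fst z))"
      by (rule MM.Fubini_integrable) (use f in auto)
    show "integrable ?N (\<lambda>z. f (snd z))"
      by (rule MM.Fubini_integrable) (use f in auto)
  qed
  have IV: "integrable ?N V" "\<And>n. integrable ?N (U n)"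
    unfolding V_def U_def using I1 I2 u v by auto
  define F where "F = (\<lambda>n. \<integral>\<^sup>+x. \<integral>\<^sup>+y. ennreal (\<bar>u n x - u n y\<bar> powr p) \<partial>M \<partial>M)"
  have F: "F n = (\<integral>\<^sup>+z. ennreal (\<bar>U n z\<bar> powr p) \<partial>?N)" for n
    unfolding F_def U_def by (subst nn_integral_fst[symmetric]) auto
  have FV: "(\<integral>\<^sup>+x. \<integral>\<^sup>+y. ennreal (\<bar>v x - v y\<bar> powr p) \<partial>M \<partial>M) = (\<integral>\<^sup>+z. ennreal (\<bar>V z\<bar> powr p) \<partial>?N)"
    unfolding V_def by (subst nn_integral_fst[symmetric]) auto
  define A where "A = (\<lambda>m::nat. \<lambda>z. if \<bar>V z\<bar> \<le> real m then \<bar>V z\<bar> powr p else 0)"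
  have step: "ennreal K * (\<integral>\<^sup>+z. ennreal (A m z) \<partial>?N) \<le> liminf (\<lambda>n. ennreal (c n) * F n)" for m
  proof -
    \<comment> \<open>The subgradient at \<open>V\<close>, set to zero where
      \<open>\<bar>V z\<bar>\<close> exceeds \<open>m\<close>. This makes it bounded, and outside
      the level set the tangent inequality degenerates to nonnegativity of the power.\<close>
    define g where "g = (\<lambda>z. if \<bar>V z\<bar> \<le> real m then p * \<bar>V z\<bar> powr (p - 1) * sgn (V z) else 0)"
    have [measurable]: "g \<in> borel_measurable ?N" "A m \<in> borel_measurable ?N"
      unfolding g_def A_def by measurable
    define b where "b = p * real m powr (p - 1)"
    have gb: "\<bar>g z\<bar> \<le> b" for z
      using p by (auto simp: g_def b_def abs_mult sgn_if intro!: mult_left_mono powr_mono2)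
    have b: "b \<ge> 0" using p by (simp add: b_def)
    have Ab: "\<bar>A m z\<bar> \<le> real m powr p" for z
      using p by (auto simp: A_def intro!: powr_mono2)
    have IA: "integrable ?N (A m)"
      by (rule N.integrable_const_bound[of _ "real m powr p"]) (use Ab in auto)
    have Ig: "integrable ?N (\<lambda>z. g z * h z)" if "integrable ?N h" for h :: "_ \<Rightarrow> real"
      by (rule integrable_mult_bounded[OF _ gb that]) measurable
    \<comment> \<open>Pairing \<open>g\<close> with \<open>f (fst z) - f (snd z)\<close> equals
      pairing this one-variable function with \<open>f\<close>: the first integral comes from
      \<open>fst\<close>, the subtracted one from \<open>snd\<close>.\<close>
    define G where "G = (\<lambda>x. (\<integral>y. g (x, y) \<partial>M) - (\<integral>y. g (y, x) \<partial>M))"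
    have [measurable]: "G \<in> borel_measurable M"
      unfolding G_def by measurable
    have Iu: "(\<integral>z. g z * (f (fst z) - f (snd z)) \<partial>?N) = (\<integral>x. G x * f x \<partial>M)" if f: "integrable M f" for f
    proof -
      have [measurable]: "f \<in> borel_measurable M" using f by auto
      have i1: "integrable ?N (\<lambda>(x,y). g (x, y) * f x)" and i2: "integrable ?N (\<lambda>(x,y). g (x, y) * f y)"
        using Ig[OF I1[OF f]] Ig[OF I2[OF f]] by (simp_all add: split_beta')
      have j1: "integrable M (\<lambda>x. (\<integral>y. g (x, y) \<partial>M) * f x)"
        using MM.integrable_fst[OF i1] by simp
      have j2: "integrable M (\<lambda>y. (\<integral>x. g (x, y) \<partial>M) * f y)"
        using MM.integrable_snd[OF i2] by simp
      have "(\<integral>z. g z * (f (fst z) - f (snd z)) \<partial>?N) = (\<integral>z. (\<lambda>(x,y). g (x, y) * f x) z - (\<lambda>(x,y). g (x, y) * f y) z \<partial>?N)"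
        by (rule Bochner_Integration.integral_cong) (auto simp: algebra_simps)
      also have "\<dots> = (\<integral>z. (\<lambda>(x,y). g (x, y) * f x) z \<partial>?N) - (\<integral>z. (\<lambda>(x,y). g (x, y) * f y) z \<partial>?N)"
        by (rule Bochner_Integration.integral_diff[OF i1 i2])
      also have "(\<integral>z. (\<lambda>(x,y). g (x, y) * f x) z \<partial>?N) = (\<integral>x. (\<integral>y. g (x, y) \<partial>M) * f x \<partial>M)"
        using MM.integral_fst[OF i1] by simp
      also have "(\<integral>z. (\<lambda>(x,y). g (x, y) * f y) z \<partial>?N) = (\<integral>y. (\<integral>x. g (x, y) \<partial>M) * f y \<partial>M)"
        using MM.integral_snd[OF i2] by simp
      also have "(\<integral>x. (\<integral>y. g (x, y) \<partial>M) * f x \<partial>M) - (\<integral>y. (\<integral>x. g (x, y) \<partial>M) * f y \<partial>M) = (\<integral>x. G x * f x \<partial>M)"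
        unfolding Bochner_Integration.integral_diff[OF j1 j2, symmetric] by (simp add: G_def left_diff_distrib)
      finally show ?thesis .
    qed
    have Gb: "\<bar>G x\<bar> \<le> 2 * (b * measure M (space M))" if x: "x \<in> space M" for x
    proof -
      have m1: "(\<lambda>y. g (x, y)) \<in> borel_measurable M" and m2: "(\<lambda>y. g (y, x)) \<in> borel_measurable M"
        using x by measurable
      have *: "\<bar>\<integral>y. h y \<partial>M\<bar> \<le> b * measure M (space M)" if "h \<in> borel_measurable M" "\<And>y. \<bar>h y\<bar> \<le> b" for h
      proof -
        have "\<bar>\<integral>y. h y \<partial>M\<bar> \<le> (\<integral>y. \<bar>h y\<bar> \<partial>M)" by (rule integral_abs_bound)
        also have "\<dots> \<le> (\<integral>y. b \<partial>M)"
          by (rule integral_mono) (use that in \<open>auto intro!: integrable_const_bound[of _ b]\<close>)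
        finally show ?thesis by (simp add: mult.commute)
      qed
      show ?thesis unfolding G_def using *[OF m1] *[OF m2] gb by (smt (verit))
    qed
    have lim: "(\<lambda>n. \<integral>z. g z * U n z \<partial>?N) \<longlonglongrightarrow> (\<integral>z. g z * V z \<partial>?N)"
      unfolding U_def V_def using conv[of G "2 * (b * measure M (space M))"] Gb by (simp add: Iu u v)
    \<comment> \<open>The value at \<open>U n\<close> of the affine minorant touching at
      \<open>V\<close>. The bracket tends to zero by \<open>lim\<close>, so \<open>r\<close> tends
      to the truncated energy of \<open>V\<close>.\<close>
    define r where "r = (\<lambda>n. (\<integral>z. A m z \<partial>?N) + ((\<integral>z. g z * U n z \<partial>?N) - (\<integral>z. g z * V z \<partial>?N)))"
    have r_le: "ennreal (r n) \<le> F n" for n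
    proof -
      have "r n = (\<integral>z. A m z + (g z * U n z - g z * V z) \<partial>?N)"
        unfolding r_def using IA Ig IV by simp
      then have "ennreal (r n) \<le> (\<integral>\<^sup>+z. ennreal (A m z + (g z * U n z - g z * V z)) \<partial>?N)"
        using ennreal_integral_le_nn_integral[of ?N "\<lambda>z. A m z + (g z * U n z - g z * V z)"] IA Ig IV by auto
      also have "\<dots> \<le> F n"
        unfolding F
      proof (intro nn_integral_mono ennreal_leI)
        fix z
        show "A m z + (g z * U n z - g z * V z) \<le> \<bar>U n z\<bar> powr p"
          using powr_tangent[OF p, of "V z" "U n z"] by (auto simp: A_def g_def algebra_simps)
      qed
      finally show ?thesis .
    qed
    have "(\<lambda>n. c n * r n) \<longlonglongrightarrow> K * ((\<integral>z. A m z \<partial>?N) + ((\<integral>z. g z * V z \<partial>?N) - (\<integral>z. g z * V z \<partial>?N)))"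
      unfolding r_def by (intro tendsto_intros c lim)
    then have "(\<lambda>n. ennreal (c n * r n)) \<longlonglongrightarrow> ennreal (K * (\<integral>z. A m z \<partial>?N))"
      by (intro tendsto_ennrealI) simp
    then have "ennreal (K * (\<integral>z. A m z \<partial>?N)) = liminf (\<lambda>n. ennreal (c n * r n))"
      by (simp add: lim_imp_Liminf)
    also have "\<dots> \<le> liminf (\<lambda>n. ennreal (c n) * F n)"
      using r_le c by (intro Liminf_mono always_eventually) (auto simp: ennreal_mult' intro: mult_left_mono)
    also have "ennreal (K * (\<integral>z. A m z \<partial>?N)) = ennreal K * (\<integral>\<^sup>+z. ennreal (A m z) \<partial>?N)"
      using K by (subst nn_integral_eq_integral[OF IA]) (auto simp: ennreal_mult' A_def)
    finally show ?thesis .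
  qed
  have "(\<integral>\<^sup>+z. ennreal (\<bar>V z\<bar> powr p) \<partial>?N) = (SUP m. \<integral>\<^sup>+z. ennreal (A m z) \<partial>?N)"
    unfolding A_def by (rule nn_integral_powr_truncation) measurable
  then have "ennreal K * (\<integral>\<^sup>+z. ennreal (\<bar>V z\<bar> powr p) \<partial>?N) = (SUP m. ennreal K * (\<integral>\<^sup>+z. ennreal (A m z) \<partial>?N))"
    by (simp add: SUP_mult_left_ennreal)
  also have "\<dots> \<le> liminf (\<lambda>n. ennreal (c n) * F n)"
    by (rule SUP_least) (rule step)
  finally show ?thesis by (simp add: FV F_def)
qed

section \<open>Test functionals on the torus and the lower bound\<close>

lemma cube_sets_lebesgue[measurable, simp]: "cube T \<in> sets lebesgue"
  by (simp add: cube_def)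

lemma nn_integral_cube: "(\<integral>\<^sup>+x\<in>cube T. f x \<partial>lebesgue) = (\<integral>\<^sup>+x. f x \<partial>lebesgue_on (cube T))"
  by (rule nn_integral_restrict_space[symmetric]) simp

lemma F0_lebesgue_on: 
  "F0 p T u = (\<integral>\<^sup>+x. \<integral>\<^sup>+y. ennreal (\<bar>u x - u y\<bar> powr p) \<partial>lebesgue_on (cube T) \<partial>lebesgue_on (cube T))"
  unfolding F0_def nn_integral_cube ..

lemma finite_measure_cube: "finite_measure (lebesgue_on (cube T))"
  unfolding cube_def by (intro finite_measure_lebesgue_on lmeasurable_cbox)

lemma measure_cube: "T \<ge> 0 \<Longrightarrow> measure (lebesgue_on (cube T)) (cube T :: 'a::euclidean_space set) = T ^ DIM('a)"
  using emeasure_cube[of T, where 'a='a]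
  by (simp add: measure_def emeasure_restrict_space cube_def)

lemma Lp_torus_measurable:
  assumes "u \<in> Lp_torus p T"
  shows "u \<in> borel_measurable lebesgue" "u \<in> borel_measurable (lebesgue_on (cube T))" "periodic_ae T u"
  using assms by (auto simp: Lp_torus_def intro: measurable_restrict_space1)

lemma Lp_torus_integrable_powr:
  assumes "u \<in> Lp_torus p T"
  shows "integrable (lebesgue_on (cube T)) (\<lambda>x. \<bar>u x\<bar> powr p)"
proof (rule integrableI_nonneg)
  show "(\<integral>\<^sup>+x. ennreal (\<bar>u x\<bar> powr p) \<partial>lebesgue_on (cube T)) < \<infinity>"
    using assms unfolding Lp_torus_def nn_integral_cube by simp
qed (use Lp_torus_measurable(2)[OF assms] in auto)

lemma Lp_norm_eq:
  assumes "u \<in> Lp_torus p T"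
  shows "Lp_norm p T u = (\<integral>x. \<bar>u x\<bar> powr p \<partial>lebesgue_on (cube T)) powr (1 / p)"
  unfolding Lp_norm_def nn_integral_cube
  by (subst nn_integral_eq_integral[OF Lp_torus_integrable_powr[OF assms]]) auto

lemma abs_le_one_plus_powr:
  fixes a p :: real
  assumes "p \<ge> 1" shows "\<bar>a\<bar> \<le> 1 + \<bar>a\<bar> powr p"
proof (cases "\<bar>a\<bar> \<le> 1")
  case False
  then have "\<bar>a\<bar> powr 1 \<le> \<bar>a\<bar> powr p" using assms by (intro powr_mono) auto
  then show ?thesis using False by simp
qed (smt (verit) powr_ge_zero)

lemma Lp_torus_integrable:
  assumes "u \<in> Lp_torus p T" "p \<ge> 1"
  shows "integrable (lebesgue_on (cube T)) u"
proof (rule Bochner_Integration.integrable_bound)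
  interpret finite_measure "lebesgue_on (cube T)" by (rule finite_measure_cube)
  show "integrable (lebesgue_on (cube T)) (\<lambda>x. 1 + \<bar>u x\<bar> powr p)"
    using Lp_torus_integrable_powr[OF assms(1)] by auto
  show "AE x in lebesgue_on (cube T). norm (u x) \<le> norm (1 + \<bar>u x\<bar> powr p)"
    using abs_le_one_plus_powr[OF assms(2)] by (auto intro: order_trans)
qed (rule Lp_torus_measurable(2)[OF assms(1)])

lemma Lp_norm_nonneg: "Lp_norm p T u \<ge> 0"
  by (simp add: Lp_norm_def)

text \<open>Integrating \<open>t \<le> 1 + t powr p\<close> for \<open>t\<close> equal to \<open>\<bar>u\<bar>\<close> divided by its norm makes Hoelder's inequality unnecessary.\<close>
lemma integral_abs_le_Lp_norm:
  fixes u :: "'a::euclidean_space \<Rightarrow> real"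
  assumes u: "u \<in> Lp_torus p T" and p: "p \<ge> 1" and T: "T \<ge> 0"
  shows "(\<integral>x. \<bar>u x\<bar> \<partial>lebesgue_on (cube T)) \<le> (T ^ DIM('a) + 1) * Lp_norm p T u"
proof (cases "Lp_norm p T u = 0")
  case True
  let ?M = "lebesgue_on (cube T :: 'a set)"
  have "(\<integral>x. \<bar>u x\<bar> powr p \<partial>?M) = 0"
    using True by (simp add: Lp_norm_eq[OF u])
  then have "AE x in ?M. \<bar>u x\<bar> powr p = 0"
    using integral_nonneg_eq_0_iff_AE[OF Lp_torus_integrable_powr[OF u]] by simp
  then have "AE x in ?M. \<bar>u x\<bar> = 0" by (rule AE_mp) auto
  then have "(\<integral>x. \<bar>u x\<bar> \<partial>?M) = (\<integral>x. 0 \<partial>?M)"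
    by (intro integral_cong_AE) (use Lp_torus_measurable(2)[OF u] in auto)
  then show ?thesis using True by simp
next
  case False
  let ?M = "lebesgue_on (cube T :: 'a set)"
  interpret finite_measure ?M by (rule finite_measure_cube)
  define N where "N = Lp_norm p T u"
  have N: "N > 0" using False Lp_norm_nonneg[of p T u] by (simp add: N_def)
  have P: "N powr p = (\<integral>x. \<bar>u x\<bar> powr p \<partial>?M)"
    using p by (simp add: N_def Lp_norm_eq[OF u] powr_powr)
  have "(\<integral>x. \<bar>u x / N\<bar> \<partial>?M) \<le> (\<integral>x. 1 + \<bar>u x / N\<bar> powr p \<partial>?M)"
  proof (rule integral_mono)
    show "integrable ?M (\<lambda>x. 1 + \<bar>u x / N\<bar> powr p)"
      using Lp_torus_integrable_powr[OF u] N by (auto simp: abs_divide powr_divide)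
  qed (use Lp_torus_integrable[OF u p] in simp, rule abs_le_one_plus_powr[OF p])
  also have "\<dots> = (\<integral>x. 1 + \<bar>u x\<bar> powr p / N powr p \<partial>?M)"
    using N by (simp add: abs_divide powr_divide)
  also have "\<dots> = T ^ DIM('a) + 1"
    using Lp_torus_integrable_powr[OF u] N T by (simp add: P[symmetric] measure_cube)
  finally have "(\<integral>x. \<bar>u x / N\<bar> \<partial>?M) \<le> T ^ DIM('a) + 1" .
  then show ?thesis using N by (simp add: abs_divide N_def[symmetric] field_simps)
qed

lemma Lp_torus_add:
  assumes "f \<in> Lp_torus p T" "g \<in> Lp_torus p T" "p \<ge> 1"
  shows "(\<lambda>x. f x + g x) \<in> Lp_torus p T"
  unfolding Lp_torus_def
proof (intro CollectI conjI)
  note [measurable] = Lp_torus_measurable(2)[OF assms(1)] Lp_torus_measurable(2)[OF assms(2)]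
  show "(\<lambda>x. f x + g x) \<in> borel_measurable lebesgue"
    using Lp_torus_measurable(1)[OF assms(1)] Lp_torus_measurable(1)[OF assms(2)] by simp
  show "periodic_ae T (\<lambda>x. f x + g x)"
    unfolding periodic_ae_def
  proof
    fix b :: 'a assume b: "b \<in> Basis"
    have "AE x in lebesgue. f (x + T *\<^sub>R b) = f x" "AE x in lebesgue. g (x + T *\<^sub>R b) = g x"
      using assms b by (auto simp: Lp_torus_def periodic_ae_def)
    then show "AE x in lebesgue. f (x + T *\<^sub>R b) + g (x + T *\<^sub>R b) = f x + g x"
      by eventually_elim simp
  qed
  have "(\<integral>\<^sup>+x. ennreal (\<bar>f x + g x\<bar> powr p) \<partial>lebesgue_on (cube T))
    \<le> (\<integral>\<^sup>+x. ennreal (2 powr p * (\<bar>f x\<bar> powr p + \<bar>g x\<bar> powr p)) \<partial>lebesgue_on (cube T))"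
    by (intro nn_integral_mono ennreal_leI powr_add_le assms)
  also have "\<dots> < \<infinity>"
    using Lp_torus_integrable_powr[OF assms(1)] Lp_torus_integrable_powr[OF assms(2)]
    by (subst nn_integral_eq_integral) auto
  finally show "(\<integral>\<^sup>+x\<in>cube T. ennreal (\<bar>f x + g x\<bar> powr p) \<partial>lebesgue) < \<infinity>"
    unfolding nn_integral_cube .
qed

lemma Lp_torus_cmult:
  assumes "f \<in> Lp_torus p T" "p \<ge> 1"
  shows "(\<lambda>x. c * f x) \<in> Lp_torus p T"
  unfolding Lp_torus_def
proof (intro CollectI conjI)
  show "(\<lambda>x. c * f x) \<in> borel_measurable lebesgue"
    using Lp_torus_measurable(1)[OF assms(1)] by simp
  show "periodic_ae T (\<lambda>x. c * f x)"
    using assms(1) unfolding Lp_torus_def periodic_ae_def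
    by (auto elim!: eventually_mono)
  have "(\<integral>\<^sup>+x. ennreal (\<bar>c * f x\<bar> powr p) \<partial>lebesgue_on (cube T)) < \<infinity>"
    using Lp_torus_integrable_powr[OF assms(1)]
    by (subst nn_integral_eq_integral) (auto simp: abs_mult powr_mult)
  then show "(\<integral>\<^sup>+x\<in>cube T. ennreal (\<bar>c * f x\<bar> powr p) \<partial>lebesgue) < \<infinity>"
    unfolding nn_integral_cube .
qed

text \<open>On the cube the integral of \<open>\<bar>f\<bar>\<close> is controlled by the norm of
  \<open>f\<close>, so a bounded density is admissible for every \<open>p \<ge> 1\<close>. These
  functionals are all that the lower bound asks of weak convergence.\<close>

lemma bdd_lin_functional_integral:
  fixes G :: "'a::euclidean_space \<Rightarrow> real"
  assumes p: "p \<ge> 1" and T: "T \<ge> 0" and G[measurable]: "G \<in> borel_measurable (lebesgue_on (cube T))"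
    and B: "\<And>x. x \<in> cube T \<Longrightarrow> \<bar>G x\<bar> \<le> B"
  shows "bdd_lin_functional p T (\<lambda>f. \<integral>x. G x * f x \<partial>lebesgue_on (cube T))"
proof -
  let ?M = "lebesgue_on (cube T :: 'a set)"
  have B0: "B \<ge> 0" using B[of 0] T by (force simp: cube_def mem_box)
  have I: "integrable ?M (\<lambda>x. G x * f x)" if f: "f \<in> Lp_torus p T" for f
    by (rule integrable_mult_bounded[OF G _ Lp_torus_integrable[OF f p], of B]) (simp add: B)
  have "\<bar>\<integral>x. G x * f x \<partial>?M\<bar> \<le> (B * (T ^ DIM('a) + 1)) * Lp_norm p T f" if f: "f \<in> Lp_torus p T" for f
  proof -
    have "\<bar>\<integral>x. G x * f x \<partial>?M\<bar> \<le> (\<integral>x. \<bar>G x * f x\<bar> \<partial>?M)" by (rule integral_abs_bound)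
    also have "\<dots> \<le> (\<integral>x. B * \<bar>f x\<bar> \<partial>?M)"
    proof (rule integral_mono)
      show "integrable ?M (\<lambda>x. \<bar>G x * f x\<bar>)" using I[OF f] by (rule integrable_abs)
    qed (use Lp_torus_integrable[OF f p] B in \<open>auto simp: abs_mult intro!: mult_right_mono\<close>)
    also have "\<dots> \<le> B * ((T ^ DIM('a) + 1) * Lp_norm p T f)"
      using integral_abs_le_Lp_norm[OF f p T] B0 by (simp add: mult_left_mono)
    finally show ?thesis by (simp add: mult_ac)
  qed
  moreover have "(\<integral>x. G x * (f x + g x) \<partial>?M) = (\<integral>x. G x * f x \<partial>?M) + (\<integral>x. G x * g x \<partial>?M)"
    if "f \<in> Lp_torus p T" "g \<in> Lp_torus p T" for f g
    using I[OF that(1)] I[OF that(2)] by (simp add: distrib_left)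
  moreover have "(\<integral>x. G x * (c * f x) \<partial>?M) = c * (\<integral>x. G x * f x \<partial>?M)" for c f
    by (subst integral_mult_right_zero[symmetric]) (simp add: mult_ac)
  ultimately show ?thesis unfolding bdd_lin_functional_def by blast
qed

lemma weak_conv_integral:
  fixes G :: "'a::euclidean_space \<Rightarrow> real"
  assumes "weak_conv p T u v" "p \<ge> 1" "T \<ge> 0" "G \<in> borel_measurable (lebesgue_on (cube T))"
    and "\<And>x. x \<in> cube T \<Longrightarrow> \<bar>G x\<bar> \<le> B"
  shows "(\<lambda>n. \<integral>x. G x * u n x \<partial>lebesgue_on (cube T)) \<longlonglongrightarrow> (\<integral>x. G x * v x \<partial>lebesgue_on (cube T))"
  using assms(1) bdd_lin_functional_integral[OF assms(2-5)] by (auto simp: weak_conv_def)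

text \<open>The comparison constant varies with \<open>n\<close>; for this reason the semicontinuity
  lemma carries a convergent sequence of factors in front of the double integral.\<close>

lemma Gamma_liminf:
  fixes u :: "nat \<Rightarrow> 'a::euclidean_space \<Rightarrow> real"
  assumes p: "p \<ge> 1" and T: "T > 0" and s: "\<forall>n. 0 < s n" "s \<longlonglongrightarrow> 0" and wk: "weak_conv p T u v"
  shows "ennreal (real DIM('a) * omega TYPE('a) / (p * T ^ DIM('a))) * F0 p T v
    \<le> liminf (\<lambda>n. ennreal (s n) * Fs p (s n) T (u n))"
proof -
  let ?M = "lebesgue_on (cube T :: 'a set)"
  have u: "u n \<in> Lp_torus p T" for n using wk by (auto simp: weak_conv_def)
  have v: "v \<in> Lp_torus p T" using wk by (auto simp: weak_conv_def)
  have "ennreal (real DIM('a) * omega TYPE('a) / (p * T ^ DIM('a))) * F0 p T v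
    \<le> liminf (\<lambda>n. ennreal (low_const TYPE('a) p T (s n)) * F0 p T (u n))"
    unfolding F0_lebesgue_on
  proof (rule weak_lsc_double_integral[OF finite_measure_cube p])
    show "low_const TYPE('a) p T (s n) \<ge> 0" for n
      using p T omega_pos[where 'a='a] by (simp add: low_const_def)
    show "(\<lambda>n. low_const TYPE('a) p T (s n)) \<longlonglongrightarrow> real DIM('a) * omega TYPE('a) / (p * T ^ DIM('a))"
      by (rule low_const_tendsto[OF p T s])
    show "(\<lambda>n. \<integral>x. G x * u n x \<partial>?M) \<longlonglongrightarrow> (\<integral>x. G x * v x \<partial>?M)"
      if "G \<in> borel_measurable ?M" "\<And>x. x \<in> space ?M \<Longrightarrow> \<bar>G x\<bar> \<le> B" for G B
      using T that by (intro weak_conv_integral[OF wk p, where B=B]) auto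
  qed (use u v p Lp_torus_integrable in auto)
  also have "\<dots> \<le> liminf (\<lambda>n. ennreal (s n) * Fs p (s n) T (u n))"
    using s(1) by (intro Liminf_mono always_eventually allI Fs_ge_F0[OF _ _ T p] Lp_torus_measurable[OF u]) auto
  finally show ?thesis .
qed

section \<open>Density of periodic Lipschitz functions\<close>

text \<open>Infimal convolution of \<open>h\<close> with \<open>m\<close> times the norm: for
  bounded \<open>h\<close> and \<open>m \<ge> 0\<close> it is the largest \<open>m\<close>-Lipschitz
  function below \<open>h\<close>. It is chosen because it preserves bounds and exact
  periods.\<close>

definition inf_conv :: "real \<Rightarrow> ('a::real_normed_vector \<Rightarrow> real) \<Rightarrow> 'a \<Rightarrow> real" where
  "inf_conv m h x = (INF z. h z + m * norm (x - z))"

lemma inf_conv_bdd_below: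
  assumes "\<And>z. \<bar>h z\<bar> \<le> B" "m \<ge> 0"
  shows "bdd_below (range (\<lambda>z. h z + m * norm (x - z)))"
proof (rule bdd_belowI2)
  fix z
  have "- B \<le> h z" "0 \<le> m * norm (x - z)" using assms(1)[of z] assms(2) by auto
  then show "- B \<le> h z + m * norm (x - z)" by linarith
qed

lemma inf_conv_le:
  assumes "\<And>z. \<bar>h z\<bar> \<le> B" "m \<ge> 0"
  shows "inf_conv m h x \<le> h z + m * norm (x - z)"
  unfolding inf_conv_def by (rule cINF_lower[OF inf_conv_bdd_below[OF assms]]) simp

lemma inf_conv_ge:
  assumes "\<And>z. c \<le> h z + m * norm (x - z)"
  shows "c \<le> inf_conv m h x"
  unfolding inf_conv_def by (rule cINF_greatest) (use assms in auto)

lemma inf_conv_abs_le: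
  assumes "\<And>z. \<bar>h z\<bar> \<le> B" "m \<ge> 0"
  shows "\<bar>inf_conv m h x\<bar> \<le> B"
proof -
  have "inf_conv m h x \<le> B"
    using inf_conv_le[where h=h and x=x and z=x, OF assms] assms(1)[of x] by simp
  moreover have "- B \<le> inf_conv m h x"
  proof (rule inf_conv_ge)
    fix z
    have "- B \<le> h z" "0 \<le> m * norm (x - z)" using assms(1)[of z] assms(2) by auto
    then show "- B \<le> h z + m * norm (x - z)" by linarith
  qed
  ultimately show ?thesis by linarith
qed

lemma inf_conv_lipschitz:
  assumes "\<And>z. \<bar>h z\<bar> \<le> B" "m \<ge> 0"
  shows "\<bar>inf_conv m h x - inf_conv m h y\<bar> \<le> m * norm (x - y)"
proof -
  have *: "inf_conv m h x - m * norm (x - y) \<le> inf_conv m h y" for x y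
  proof (rule inf_conv_ge)
    fix z
    have "norm (x - z) \<le> norm (x - y) + norm (y - z)"
      using norm_triangle_ineq[of "x - y" "y - z"] by simp
    then have "m * norm (x - z) \<le> m * norm (x - y) + m * norm (y - z)"
      using assms(2) by (metis distrib_left mult_left_mono)
    then show "inf_conv m h x - m * norm (x - y) \<le> h z + m * norm (y - z)"
      using inf_conv_le[where h=h and x=x and z=z, OF assms] by linarith
  qed
  show ?thesis using *[of x y] *[of y x] by (auto simp: norm_minus_commute abs_le_iff)
qed

lemma inf_conv_periodic:
  assumes "\<And>z. h (z + a) = h z"
  shows "inf_conv m h (x + a) = inf_conv m h x"
proof -
  have "range (\<lambda>z. h z + m * norm (x + a - z)) = range ((\<lambda>z. h z + m * norm (x + a - z)) \<circ> (\<lambda>z. z + a))"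
    by (simp only: image_comp[symmetric] surj_plus_right)
  also have "\<dots> = range (\<lambda>z. h z + m * norm (x - z))"
    by (simp add: comp_def assms)
  finally show ?thesis by (simp add: inf_conv_def)
qed

text \<open>Points at distance at least \<open>d\<close> from \<open>x\<close> pay
  \<open>m * d \<ge> 2 * B\<close> and cannot undercut \<open>h x\<close>; closer points have almost
  the same value. Continuity enters only at \<open>x\<close> itself, so \<open>h\<close> may jump
  elsewhere.\<close>

lemma inf_conv_tendsto:
  assumes B: "\<And>z. \<bar>h z\<bar> \<le> B" and cont: "isCont h x"
  shows "(\<lambda>m::nat. inf_conv (real m) h x) \<longlonglongrightarrow> h x"
proof (rule LIMSEQ_I)
  fix e :: real assume e: "e > 0"
  obtain d where d: "d > 0" "\<And>z. norm (z - x) < d \<Longrightarrow> \<bar>h z - h x\<bar> < e / 2"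
    using cont e unfolding continuous_at_eps_delta dist_norm real_norm_def by (meson half_gt_zero)
  obtain N :: nat where N: "2 * B / d \<le> real N" using real_arch_simple by blast
  have B0: "B \<ge> 0" using B[of x] by linarith
  have "norm (inf_conv (real m) h x - h x) < e" if m: "m \<ge> N" for m
  proof -
    have "2 * B / d \<le> real m" using N m by linarith
    then have "2 * B \<le> real m * d" using d(1) by (simp add: pos_divide_le_eq)
    have "h x - e / 2 \<le> inf_conv (real m) h x"
    proof (rule inf_conv_ge)
      fix z
      show "h x - e / 2 \<le> h z + real m * norm (x - z)"
      proof (cases "norm (z - x) < d")
        case True
        have "0 \<le> real m * norm (x - z)" by simp
        then show ?thesis using d(2)[OF True] by linarith
      next
        case False
        then have "real m * d \<le> real m * norm (x - z)" by (intro mult_left_mono) (auto simp: norm_minus_commute)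
        then show ?thesis using \<open>2 * B \<le> real m * d\<close> B[of x] B[of z] e by linarith
      qed
    qed
    moreover have "inf_conv (real m) h x \<le> h x"
      using inf_conv_le[where h=h and x=x and z=x and m="real m", OF B] by simp
    ultimately show ?thesis using e by simp
  qed
  then show "\<exists>N. \<forall>m\<ge>N. norm (inf_conv (real m) h x - h x) < e" by blast
qed

lemma integral_powr_diff_tendsto_0:
  fixes f :: "'b \<Rightarrow> real" and F :: "nat \<Rightarrow> 'b \<Rightarrow> real"
  assumes p: "p > 0" and [measurable]: "f \<in> borel_measurable M" "\<And>n. F n \<in> borel_measurable M"
    and lim: "AE x in M. (\<lambda>n. F n x) \<longlonglongrightarrow> f x"
    and w: "integrable M w" "\<And>n x. x \<in> space M \<Longrightarrow> \<bar>f x - F n x\<bar> powr p \<le> w x"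
  shows "(\<lambda>n. \<integral>x. \<bar>f x - F n x\<bar> powr p \<partial>M) \<longlonglongrightarrow> 0"
proof -
  have "(\<lambda>n. \<integral>x. \<bar>f x - F n x\<bar> powr p \<partial>M) \<longlonglongrightarrow> (\<integral>x. 0 \<partial>M)"
  proof (rule integral_dominated_convergence[where w=w])
    show "AE x in M. (\<lambda>n. \<bar>f x - F n x\<bar> powr p) \<longlonglongrightarrow> 0"
      using lim
    proof eventually_elim
      case (elim x)
      have "(\<lambda>n. \<bar>f x - F n x\<bar>) \<longlonglongrightarrow> \<bar>f x - f x\<bar>" by (intro tendsto_intros elim)
      then have "(\<lambda>n. \<bar>f x - F n x\<bar>) \<longlonglongrightarrow> 0" by simp
      from tendsto_powr'[OF this tendsto_const[of p]] show ?case using p by simp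
    qed
  qed (use w in auto)
  then show ?thesis by simp
qed

section \<open>Truncation and density in \<open>Lp\<close>\<close>

definition clip :: "real \<Rightarrow> real \<Rightarrow> real" where
  "clip k t = max (- k) (min k t)"

lemma clip_bound: "k \<ge> 0 \<Longrightarrow> \<bar>clip k t\<bar> \<le> k"
  by (auto simp: clip_def)

lemma clip_diff: "k \<ge> 0 \<Longrightarrow> \<bar>t - clip k t\<bar> \<le> \<bar>t\<bar>"
  by (auto simp: clip_def)

lemma clip_id: "\<bar>t\<bar> \<le> k \<Longrightarrow> clip k t = t"
  by (auto simp: clip_def)

lemma continuous_on_clip[continuous_intros]: "continuous_on S f \<Longrightarrow> continuous_on S (\<lambda>x. clip k (f x))"
  unfolding clip_def by (intro continuous_intros)

lemma clip_measurable[measurable]: "clip k \<in> borel_measurable borel"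
  unfolding clip_def[abs_def] by measurable

lemma tendsto_clip: "(f \<longlongrightarrow> l) F \<Longrightarrow> ((\<lambda>x. clip k (f x)) \<longlongrightarrow> clip k l) F"
  unfolding clip_def by (intro tendsto_intros)

text \<open>Truncation gives boundedness, measurability gives a continuous approximation, and
  infimal convolution of its periodic copy gives a Lipschitz function with exact periods. After the
  truncation all differences are dominated by the constant \<open>(2 * real k) powr p\<close>,
  integrable on the cube.\<close>

lemma Lp_dense_lipschitz:
  fixes v :: "'a::euclidean_space \<Rightarrow> real"
  assumes v: "v \<in> Lp_torus p T" and p: "p \<ge> 1" and T: "T > 0" and e: "e > 0"
  obtains g L B where "L \<ge> 0" "\<And>x y. \<bar>g x - g y\<bar> \<le> L * norm (x - y)" "\<And>x b. b \<in> Basis \<Longrightarrow> g (x + T *\<^sub>R b) = g x"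
    "\<And>x. \<bar>g x\<bar> \<le> B" "(\<integral>x. \<bar>v x - g x\<bar> powr p \<partial>lebesgue_on (cube T)) < e"
proof -
  let ?M = "lebesgue_on (cube T :: 'a set)"
  interpret finite_measure ?M by (rule finite_measure_cube)
  note vm[measurable] = Lp_torus_measurable(2)[OF v]
  have vl[measurable]: "v \<in> borel_measurable lebesgue" by (rule Lp_torus_measurable(1)[OF v])
  \<comment> \<open>The denominator is the cost of two nested uses of \<open>powr_add_le\<close> on
    three errors of size \<open>e'\<close>.\<close>
  define e' where "e' = e / (2 powr p * (1 + 2 powr p + 2 powr p))"
  have pos: "2 powr p * (1 + 2 powr p + 2 powr p) > 0" by (intro mult_pos_pos add_pos_pos) auto
  have e': "e' > 0" unfolding e'_def using e pos by (rule divide_pos_pos)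
  have small: "\<exists>n. (\<integral>x. \<bar>f x - F n x\<bar> powr p \<partial>?M) < e'" if "(\<lambda>n::nat. \<integral>x. \<bar>f x - F n x\<bar> powr p \<partial>?M) \<longlonglongrightarrow> 0"
    for f :: "'a \<Rightarrow> real" and F
  proof -
    from that e' have "\<forall>\<^sub>F n in sequentially. (\<integral>x. \<bar>f x - F n x\<bar> powr p \<partial>?M) < e'"
      by (simp add: order_tendsto_iff)
    then show ?thesis by (auto simp: eventually_sequentially)
  qed

  have "(\<lambda>n. \<integral>x. \<bar>v x - clip (real n) (v x)\<bar> powr p \<partial>?M) \<longlonglongrightarrow> 0"
  proof (rule integral_powr_diff_tendsto_0)
    show "AE x in ?M. (\<lambda>n. clip (real n) (v x)) \<longlonglongrightarrow> v x"
    proof (rule AE_I2)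
      fix x
      obtain N where "\<bar>v x\<bar> \<le> real N" using real_arch_simple by blast
      then have "\<forall>\<^sub>F n in sequentially. clip (real n) (v x) = v x"
        by (intro eventually_sequentiallyI[of N] clip_id) (auto intro: order_trans)
      then show "(\<lambda>n. clip (real n) (v x)) \<longlonglongrightarrow> v x" by (rule tendsto_eventually)
    qed
    show "integrable ?M (\<lambda>x. \<bar>v x\<bar> powr p)" by (rule Lp_torus_integrable_powr[OF v])
    show "\<bar>v x - clip (real n) (v x)\<bar> powr p \<le> \<bar>v x\<bar> powr p" for n x
      using p by (intro powr_mono2 clip_diff) auto
  qed (use p in auto)
  from small[OF this] obtain k :: nat where k: "(\<integral>x. \<bar>v x - clip (real k) (v x)\<bar> powr p \<partial>?M) < e'" by blast

  have const: "integrable ?M (\<lambda>x. (2 * real k) powr p)" by simp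
  have two: "\<bar>a - b\<bar> powr p \<le> (2 * real k) powr p" if "\<bar>a\<bar> \<le> real k" "\<bar>b\<bar> \<le> real k" for a b
    using that p by (intro powr_mono2) auto

  \<comment> \<open>This notion of measurability provides continuous functions converging off a
    negligible set. Clipping them preserves the limit, whose values are already clipped, and makes
    them uniformly bounded.\<close>
  have "(\<lambda>x. clip (real k) (v x)) measurable_on UNIV"
    by (subst measurable_on_iff_borel_measurable) (auto simp: lebesgue_on_UNIV_eq)
  then obtain N h where N: "negligible N" and h: "\<And>n::nat. continuous_on UNIV (h n)"
    and hlim: "\<And>x. x \<notin> N \<Longrightarrow> (\<lambda>n. h n x) \<longlonglongrightarrow> clip (real k) (v x)"
    by (auto simp: measurable_on_def)
  have "AE x in lebesgue. x \<notin> N" using N by (simp add: negligible_iff_null_sets AE_not_in)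
  then have NM: "AE x in ?M. x \<notin> N" by (auto simp: AE_restrict_space_iff elim!: eventually_mono)
  have cm: "(\<lambda>x. clip (real k) (h n x)) \<in> borel_measurable borel" for n
    by (intro borel_measurable_continuous_onI continuous_intros h)
  have cM: "f \<in> borel_measurable ?M" if "f \<in> borel_measurable borel" for f :: "'a \<Rightarrow> real"
    using that by (intro measurable_restrict_space1 measurable_completion) simp
  have "(\<lambda>n. \<integral>x. \<bar>clip (real k) (v x) - clip (real k) (h n x)\<bar> powr p \<partial>?M) \<longlonglongrightarrow> 0"
  proof (rule integral_powr_diff_tendsto_0[OF _ _ _ _ const])
    show "AE x in ?M. (\<lambda>n. clip (real k) (h n x)) \<longlonglongrightarrow> clip (real k) (v x)"
      using NM
    proof eventually_elim
      case (elim x)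
      have "(\<lambda>n. clip (real k) (h n x)) \<longlonglongrightarrow> clip (real k) (clip (real k) (v x))"
        by (intro tendsto_clip hlim elim)
      then show ?case by (simp add: clip_id clip_bound)
    qed
    show "(\<lambda>x. clip (real k) (h n x)) \<in> borel_measurable ?M" for n by (rule cM[OF cm])
  qed (use p two clip_bound in auto)
  from small[OF this] obtain n where n: "(\<integral>x. \<bar>clip (real k) (v x) - clip (real k) (h n x)\<bar> powr p \<partial>?M) < e'" by blast

  define w where "w = (\<lambda>x. clip (real k) (h n x))"
  have n': "(\<integral>x. \<bar>clip (real k) (v x) - w x\<bar> powr p \<partial>?M) < e'" using n unfolding w_def .
  \<comment> \<open>The periodic copy of \<open>w\<close> may jump across the faces of the cells. In
    the open box it agrees with the continuous \<open>w\<close>, hence it is continuous at almost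
    every point of the cube, where the infimal convolutions then converge to
    \<open>w\<close>.\<close>
  define P where "P = (\<lambda>x. w (red T x))"
  have Pb: "\<bar>P x\<bar> \<le> real k" for x by (simp add: P_def w_def clip_bound)
  have wm: "w \<in> borel_measurable borel" unfolding w_def by (rule cm)
  have lip: "\<bar>inf_conv (real m) P x - inf_conv (real m) P y\<bar> \<le> real m * norm (x - y)" for m x y
    by (rule inf_conv_lipschitz[where h=P, OF Pb]) simp
  have cont: "continuous_on UNIV (inf_conv (real m) P)" for m
  proof (rule lipschitz_on_continuous_on[of "real m"])
    show "(real m)-lipschitz_on UNIV (inf_conv (real m) P)"
      by (rule lipschitz_onI) (use lip in \<open>auto simp: dist_norm\<close>)
  qed
  have box: "AE x in ?M. x \<in> box 0 (T *\<^sub>R One)"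
  proof -
    have "negligible (cbox 0 (T *\<^sub>R One) - box (0::'a) (T *\<^sub>R One))"
      by (rule negligible_frontier_interval)
    then have "AE x in lebesgue. x \<notin> cbox 0 (T *\<^sub>R One) - box (0::'a) (T *\<^sub>R One)"
      unfolding negligible_iff_null_sets by (rule AE_not_in)
    then show ?thesis by (auto simp: AE_restrict_space_iff cube_def elim!: eventually_mono)
  qed
  have "(\<lambda>m. \<integral>x. \<bar>w x - inf_conv (real m) P x\<bar> powr p \<partial>?M) \<longlonglongrightarrow> 0"
  proof (rule integral_powr_diff_tendsto_0[OF _ _ _ _ const])
    show "AE x in ?M. (\<lambda>m. inf_conv (real m) P x) \<longlonglongrightarrow> w x"
      using box
    proof eventually_elim
      case (elim x)
      have eq: "P z = w z" if "z \<in> box 0 (T *\<^sub>R One)" for z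
        using red_hcube[OF T subsetD[OF box_subset_hcube that]] by (simp add: P_def)
      have "isCont w x"
        using h[of n] unfolding w_def by (intro continuous_on_interior[of UNIV] continuous_intros) auto
      moreover have "\<forall>\<^sub>F z in nhds x. P z = w z"
        using elim eq by (intro eventually_nhds_in_open[THEN eventually_mono, of "box 0 (T *\<^sub>R One)"]) auto
      ultimately have "isCont P x" by (simp add: isCont_cong)
      from inf_conv_tendsto[where h=P and x=x, OF Pb this] eq[OF elim] show ?case by simp
    qed
    show "inf_conv (real m) P \<in> borel_measurable ?M" for m
      by (intro cM borel_measurable_continuous_onI cont)
    show "\<bar>w x - inf_conv (real m) P x\<bar> powr p \<le> (2 * real k) powr p" for m x
      by (intro two inf_conv_abs_le[where h=P] Pb) (auto simp: w_def clip_bound)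
  qed (use p cM[OF wm] in auto)
  from small[OF this] obtain m where m: "(\<integral>x. \<bar>w x - inf_conv (real m) P x\<bar> powr p \<partial>?M) < e'" by blast
  define g where "g = inf_conv (real m) P"
  have gm: "g \<in> borel_measurable ?M" unfolding g_def by (intro cM borel_measurable_continuous_onI cont)
  have [measurable]: "g \<in> borel_measurable ?M" "w \<in> borel_measurable ?M" using gm cM[OF wm] by auto
  have wb: "\<bar>w x\<bar> \<le> real k" for x by (simp add: w_def clip_bound)
  have gb: "\<bar>g x\<bar> \<le> real k" for x unfolding g_def by (rule inf_conv_abs_le[where h=P, OF Pb]) simp
  have cb: "\<bar>clip (real k) t\<bar> \<le> real k" for t by (rule clip_bound) simp
  have i1: "integrable ?M (\<lambda>x. \<bar>v x - clip (real k) (v x)\<bar> powr p)"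
    by (rule Bochner_Integration.integrable_bound[OF Lp_torus_integrable_powr[OF v]])
       (use p clip_diff in \<open>auto intro!: AE_I2 powr_mono2\<close>)
  have i2: "integrable ?M (\<lambda>x. \<bar>clip (real k) (v x) - w x\<bar> powr p)"
    by (rule integrable_const_bound[of _ "(2 * real k) powr p"]) (use two[OF cb wb] in auto)
  have i3: "integrable ?M (\<lambda>x. \<bar>w x - g x\<bar> powr p)"
    by (rule integrable_const_bound[of _ "(2 * real k) powr p"]) (use two[OF wb gb] in auto)
  have "(\<integral>x. \<bar>v x - g x\<bar> powr p \<partial>?M) \<le> (\<integral>x. 2 powr p * (\<bar>v x - clip (real k) (v x)\<bar> powr p
      + 2 powr p * (\<bar>clip (real k) (v x) - w x\<bar> powr p + \<bar>w x - g x\<bar> powr p)) \<partial>?M)" (is "_ \<le> ?R")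
  proof (rule integral_mono')
    show "integrable ?M (\<lambda>x. 2 powr p * (\<bar>v x - clip (real k) (v x)\<bar> powr p
      + 2 powr p * (\<bar>clip (real k) (v x) - w x\<bar> powr p + \<bar>w x - g x\<bar> powr p)))"
      using i1 i2 i3 by auto
    fix x
    have "\<bar>v x - g x\<bar> powr p \<le> 2 powr p * (\<bar>v x - clip (real k) (v x)\<bar> powr p + \<bar>clip (real k) (v x) - g x\<bar> powr p)"
      using powr_add_le[OF p, of "v x - clip (real k) (v x)" "clip (real k) (v x) - g x"] by simp
    also have "\<bar>clip (real k) (v x) - g x\<bar> powr p \<le> 2 powr p * (\<bar>clip (real k) (v x) - w x\<bar> powr p + \<bar>w x - g x\<bar> powr p)"
      using powr_add_le[OF p, of "clip (real k) (v x) - w x" "w x - g x"] by simp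
    finally show "\<bar>v x - g x\<bar> powr p \<le> 2 powr p * (\<bar>v x - clip (real k) (v x)\<bar> powr p
      + 2 powr p * (\<bar>clip (real k) (v x) - w x\<bar> powr p + \<bar>w x - g x\<bar> powr p))" by simp
  qed auto
  moreover have "?R < e"
  proof -
    have "?R = 2 powr p * ((\<integral>x. \<bar>v x - clip (real k) (v x)\<bar> powr p \<partial>?M)
      + 2 powr p * ((\<integral>x. \<bar>clip (real k) (v x) - w x\<bar> powr p \<partial>?M) + (\<integral>x. \<bar>w x - g x\<bar> powr p \<partial>?M)))"
      using i1 i2 i3 by simp
    also have "\<dots> < 2 powr p * (e' + 2 powr p * (e' + e'))"
      using k n' m[folded g_def]
      by (intro mult_strict_left_mono add_strict_mono) auto
    also have "\<dots> = 2 powr p * (1 + 2 powr p + 2 powr p) * e'" by (simp add: algebra_simps)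
    also have "\<dots> = e" unfolding e'_def using pos by (metis less_irrefl nonzero_mult_div_cancel_left times_divide_eq_right)
    finally show ?thesis .
  qed
  ultimately have fin: "(\<integral>x. \<bar>v x - g x\<bar> powr p \<partial>?M) < e" by linarith
  show thesis
  proof (rule that[of "real m" g "real k"])
    show "g (x + T *\<^sub>R b) = g x" if "b \<in> Basis" for x b
      unfolding g_def by (rule inf_conv_periodic) (simp add: P_def red_add_lat[OF T Basis_in_lat[OF that]])
    show "\<bar>g x\<bar> \<le> real k" for x by (rule gb)
    show "\<bar>g x - g y\<bar> \<le> real m * norm (x - y)" for x y unfolding g_def by (rule lip)
  qed (use fin in auto)
qed

section \<open>Recovery sequences\<close>

text \<open>Besides estimating the cost of a small perturbation, this shows that \<open>F0\<close>
  is finite on all of \<open>Lp_torus p T\<close>.\<close>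

lemma F0_le_Lp:
  fixes d :: "'a::euclidean_space \<Rightarrow> real"
  assumes d: "d \<in> Lp_torus p T" and p: "p \<ge> 1" and T: "T \<ge> 0"
  shows "F0 p T d \<le> ennreal (2 powr p * (2 * T ^ DIM('a)) * (\<integral>x. \<bar>d x\<bar> powr p \<partial>lebesgue_on (cube T)))"
proof -
  let ?M = "lebesgue_on (cube T :: 'a set)"
  interpret finite_measure ?M by (rule finite_measure_cube)
  note [measurable] = Lp_torus_measurable(2)[OF d]
  define I where "I = (\<integral>x. \<bar>d x\<bar> powr p \<partial>?M)"
  note int = Lp_torus_integrable_powr[OF d]
  have I0: "I \<ge> 0" by (simp add: I_def)
  have "(\<integral>\<^sup>+y. ennreal (\<bar>d x - d y\<bar> powr p) \<partial>?M) \<le> ennreal (2 powr p * (T ^ DIM('a) * \<bar>d x\<bar> powr p + I))" for x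
  proof -
    have "(\<integral>\<^sup>+y. ennreal (\<bar>d x - d y\<bar> powr p) \<partial>?M) \<le> (\<integral>\<^sup>+y. ennreal (2 powr p * (\<bar>d x\<bar> powr p + \<bar>d y\<bar> powr p)) \<partial>?M)"
      using powr_add_le[OF p, of "d x" "- d y" for y] by (intro nn_integral_mono ennreal_leI) simp
    also have "\<dots> = ennreal (\<integral>y. 2 powr p * (\<bar>d x\<bar> powr p + \<bar>d y\<bar> powr p) \<partial>?M)"
      using int by (intro nn_integral_eq_integral) auto
    also have "(\<integral>y. 2 powr p * (\<bar>d x\<bar> powr p + \<bar>d y\<bar> powr p) \<partial>?M) = 2 powr p * (T ^ DIM('a) * \<bar>d x\<bar> powr p + I)"
      using int T measure_cube[of T, where 'a='a] by (simp add: I_def)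
    finally show ?thesis .
  qed
  then have "F0 p T d \<le> (\<integral>\<^sup>+x. ennreal (2 powr p * (T ^ DIM('a) * \<bar>d x\<bar> powr p + I)) \<partial>?M)"
    unfolding F0_lebesgue_on by (intro nn_integral_mono)
  also have "\<dots> = ennreal (\<integral>x. 2 powr p * (T ^ DIM('a) * \<bar>d x\<bar> powr p + I) \<partial>?M)"
    using int I0 T by (intro nn_integral_eq_integral) auto
  also have "(\<integral>x. 2 powr p * (T ^ DIM('a) * \<bar>d x\<bar> powr p + I) \<partial>?M) = 2 powr p * (2 * T ^ DIM('a)) * I"
    using int T measure_cube[of T, where 'a='a] by (simp add: I_def algebra_simps)
  finally show ?thesis by (simp add: I_def)
qed

lemma F0_add_split:
  fixes v d :: "'a::euclidean_space \<Rightarrow> real"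
  assumes v: "v \<in> Lp_torus p T" and d: "d \<in> Lp_torus p T" and p: "p \<ge> 1" and l: "0 < l" "l < 1"
  shows "F0 p T (\<lambda>x. v x + d x) \<le> ennreal ((1 - l) powr (1 - p)) * F0 p T v + ennreal (l powr (1 - p)) * F0 p T d"
proof -
  let ?M = "lebesgue_on (cube T :: 'a set)"
  interpret finite_measure ?M by (rule finite_measure_cube)
  note [measurable] = Lp_torus_measurable(2)[OF d] Lp_torus_measurable(2)[OF v]
  define a where "a = (1 - l) powr (1 - p)"
  define b where "b = l powr (1 - p)"
  have a: "a \<ge> 0" "b \<ge> 0" by (auto simp: a_def b_def)
  have "F0 p T (\<lambda>x. v x + d x) \<le> (\<integral>\<^sup>+x. \<integral>\<^sup>+y. ennreal a * ennreal (\<bar>v x - v y\<bar> powr p) + ennreal b * ennreal (\<bar>d x - d y\<bar> powr p) \<partial>?M \<partial>?M)"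
    unfolding F0_lebesgue_on
  proof (intro nn_integral_mono)
    fix x y
    have "\<bar>(v x + d x) - (v y + d y)\<bar> powr p \<le> a * \<bar>v x - v y\<bar> powr p + b * \<bar>d x - d y\<bar> powr p"
      using powr_add_split[OF p l, of "v x - v y" "d x - d y"] by (simp add: a_def b_def algebra_simps)
    then have "ennreal (\<bar>(v x + d x) - (v y + d y)\<bar> powr p) \<le> ennreal (a * \<bar>v x - v y\<bar> powr p + b * \<bar>d x - d y\<bar> powr p)"
      by (rule ennreal_leI)
    also have "\<dots> = ennreal a * ennreal (\<bar>v x - v y\<bar> powr p) + ennreal b * ennreal (\<bar>d x - d y\<bar> powr p)"
      using a by (simp add: ennreal_mult')
    finally show "ennreal (\<bar>(v x + d x) - (v y + d y)\<bar> powr p) \<le> ennreal a * ennreal (\<bar>v x - v y\<bar> powr p) + ennreal b * ennreal (\<bar>d x - d y\<bar> powr p)" .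
  qed
  also have "\<dots> = ennreal a * F0 p T v + ennreal b * F0 p T d"
    unfolding F0_lebesgue_on by (simp add: nn_integral_add nn_integral_cmult)
  finally show ?thesis by (simp add: a_def b_def)
qed

lemma Lp_torus_diff:
  assumes "f \<in> Lp_torus p T" "g \<in> Lp_torus p T" "p \<ge> 1"
  shows "(\<lambda>x. f x - g x) \<in> Lp_torus p T"
  using Lp_torus_add[OF assms(1) Lp_torus_cmult[OF assms(2,3), of "-1"] assms(3)] by simp

lemma bounded_periodic_in_Lp_torus:
  fixes g :: "'a::euclidean_space \<Rightarrow> real"
  assumes "g \<in> borel_measurable borel" "\<And>x b. b \<in> Basis \<Longrightarrow> g (x + T *\<^sub>R b) = g x" "\<And>x. \<bar>g x\<bar> \<le> B" "p \<ge> 1"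
  shows "g \<in> Lp_torus p T"
proof -
  let ?M = "lebesgue_on (cube T :: 'a set)"
  interpret finite_measure ?M by (rule finite_measure_cube)
  have m: "g \<in> borel_measurable lebesgue"
    using assms(1) by (intro measurable_completion) simp
  have "(\<integral>\<^sup>+x. ennreal (\<bar>g x\<bar> powr p) \<partial>?M) \<le> (\<integral>\<^sup>+x. ennreal (B powr p) \<partial>?M)"
    using assms by (intro nn_integral_mono ennreal_leI powr_mono2) auto
  also have "\<dots> < \<infinity>"
    by (simp add: less_top[symmetric] ennreal_mult_eq_top_iff)
  finally show ?thesis
    using m assms(2) by (simp add: Lp_torus_def periodic_ae_def nn_integral_cube)
qed

text \<open>One parameter \<open>l\<close> is both the approximation error and the weight of the
  convex splitting. The weight multiplies the perturbation by \<open>l powr (1 - p)\<close>, which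
  is compensated by a perturbation whose \<open>p\<close>-th power integral is of order
  \<open>l powr p\<close>.\<close>

lemma recovery_approximation:
  fixes v :: "'a::euclidean_space \<Rightarrow> real"
  assumes v: "v \<in> Lp_torus p T" and p: "p \<ge> 1" and T: "T > 0" and l: "0 < l" "l < 1"
  shows "\<exists>g L. g \<in> Lp_torus p T \<and> L \<ge> 0 \<and> (\<forall>x y. \<bar>g x - g y\<bar> \<le> L * norm (x - y)) \<and>
    (\<integral>x. \<bar>g x - v x\<bar> powr p \<partial>lebesgue_on (cube T)) \<le> l \<and>
    F0 p T g \<le> ennreal ((1 - l) powr (1 - p)) * F0 p T v + ennreal l"
proof -
  let ?M = "lebesgue_on (cube T :: 'a set)"
  define C where "C = 2 powr p * (2 * T ^ DIM('a))"
  have C: "C > 0" using T by (simp add: C_def)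
  \<comment> \<open>Chosen so that \<open>l powr (1 - p) * (C * (l powr p / C)) = l\<close>; the
    minimum with \<open>l\<close> also bounds the distance to \<open>v\<close>.\<close>
  define e where "e = min l (l powr p / C)"
  have e: "e > 0" using l C by (simp add: e_def)
  obtain L g B where g: "L \<ge> 0" "\<And>x y. \<bar>g x - g y\<bar> \<le> L * norm (x - y)" "\<And>x b. b \<in> Basis \<Longrightarrow> g (x + T *\<^sub>R b) = g x"
    "\<And>x. \<bar>g x\<bar> \<le> B" "(\<integral>x. \<bar>v x - g x\<bar> powr p \<partial>?M) < e"
    by (rule Lp_dense_lipschitz[OF v p T e]) (rule that; assumption)
  have "L-lipschitz_on UNIV g"
    by (rule lipschitz_onI) (use g in \<open>auto simp: dist_norm\<close>)
  then have "g \<in> borel_measurable borel"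
    by (intro borel_measurable_continuous_onI lipschitz_on_continuous_on)
  then have gL: "g \<in> Lp_torus p T"
    using g p by (intro bounded_periodic_in_Lp_torus) auto
  define d where "d = (\<lambda>x. g x - v x)"
  have d: "d \<in> Lp_torus p T" unfolding d_def by (rule Lp_torus_diff[OF gL v p])
  have dI: "(\<integral>x. \<bar>d x\<bar> powr p \<partial>?M) < e"
    using g(5) by (simp add: d_def abs_minus_commute)
  have "F0 p T g = F0 p T (\<lambda>x. v x + d x)" by (simp add: d_def)
  also have "\<dots> \<le> ennreal ((1 - l) powr (1 - p)) * F0 p T v + ennreal (l powr (1 - p)) * F0 p T d"
    by (rule F0_add_split[OF v d p l])
  also have "\<dots> \<le> ennreal ((1 - l) powr (1 - p)) * F0 p T v + ennreal l"
  proof (rule add_left_mono)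
    have "ennreal (l powr (1 - p)) * F0 p T d \<le> ennreal (l powr (1 - p)) * ennreal (C * (\<integral>x. \<bar>d x\<bar> powr p \<partial>?M))"
      unfolding C_def by (intro mult_left_mono F0_le_Lp d p) (use T in auto)
    also have "\<dots> \<le> ennreal (l powr (1 - p)) * ennreal (C * (l powr p / C))"
      using dI C by (intro mult_left_mono ennreal_leI) (auto simp: e_def)
    also have "\<dots> = ennreal l"
      using C l by (simp add: ennreal_mult'[symmetric] powr_add[symmetric])
    finally show "ennreal (l powr (1 - p)) * F0 p T d \<le> ennreal l" .
  qed
  finally show ?thesis
    using gL g dI by (intro exI[of _ g] exI[of _ L]) (auto simp: d_def e_def)
qed

text \<open>\<open>J n\<close> is the largest \<open>j \<le> n\<close> whose error at
  \<open>n\<close> is at most \<open>1 / real (Suc j)\<close>. Any fixed \<open>k\<close> satisfies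
  both conditions for all late \<open>n\<close>, so \<open>J\<close> tends to infinity and carries
  the error to zero. The convergence may be arbitrarily non-uniform in \<open>j\<close>; the cap
  \<open>j \<le> n\<close> keeps the maximum finite.\<close>

lemma diagonal_index:
  fixes a :: "nat \<Rightarrow> nat \<Rightarrow> real"
  assumes a: "\<And>j. a j \<longlonglongrightarrow> 0" and pos: "\<And>j n. a j n \<ge> 0"
  obtains J where "filterlim J at_top sequentially" "(\<lambda>n. a (J n) n) \<longlonglongrightarrow> 0"
proof -
  define S where "S = (\<lambda>n. {j. j \<le> n \<and> a j n \<le> 1 / real (Suc j)})"
  \<comment> \<open>The value \<open>0\<close> for an empty \<open>S n\<close> is arbitrary: for
    late \<open>n\<close> the set contains any prescribed \<open>k\<close>.\<close>
  define J where "J = (\<lambda>n. if S n = {} then 0 else Max (S n))"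
  have fin: "finite (S n)" for n
    by (rule finite_subset[of _ "{..n}"]) (auto simp: S_def)
  have ev: "\<forall>\<^sub>F n in sequentially. k \<le> J n \<and> J n \<in> S n" for k
  proof -
    have "\<forall>\<^sub>F n in sequentially. a k n < 1 / real (Suc k)"
      using a[of k] by (rule order_tendstoD) simp
    then show ?thesis using eventually_ge_at_top[of k]
    proof eventually_elim
      case (elim n)
      then have k: "k \<in> S n" by (simp add: S_def)
      then have "J n = Max (S n)" by (auto simp: J_def)
      then show ?case using k fin by (metis Max_ge Max_in empty_iff)
    qed
  qed
  show thesis
  proof (rule that)
    show "filterlim J at_top sequentially"
      unfolding filterlim_at_top
    proof
      fix Z show "\<forall>\<^sub>F n in sequentially. Z \<le> J n"
        using ev[of Z] by (rule eventually_mono) simp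
    qed
    show "(\<lambda>n. a (J n) n) \<longlonglongrightarrow> 0"
    proof (rule order_tendstoI)
      fix e :: real assume e: "0 < e"
      obtain k where k: "1 / real (Suc k) < e" using nat_approx_posE[OF e] by (metis of_nat_Suc)
      show "\<forall>\<^sub>F n in sequentially. a (J n) n < e"
        using ev[of k]
      proof eventually_elim
        case (elim n)
        then have "a (J n) n \<le> 1 / real (Suc (J n))" by (simp add: S_def)
        also have "\<dots> \<le> 1 / real (Suc k)" using elim by (simp add: frac_le)
        finally show ?case using k by simp
      qed
    next
      fix e :: real assume "e < 0"
      then show "\<forall>\<^sub>F n in sequentially. e < a (J n) n"
        using pos by (intro always_eventually) (auto intro: less_le_trans)
    qed
  qed
qed

text \<open>Only additivity and the bound by the norm enter, so the functionals are treated without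
  knowing their form, for \<open>p = 1\<close> as for larger \<open>p\<close>.\<close>

lemma strong_imp_weak_conv:
  fixes u :: "nat \<Rightarrow> 'a::euclidean_space \<Rightarrow> real"
  assumes u: "\<And>n. u n \<in> Lp_torus p T" and v: "v \<in> Lp_torus p T" and p: "p \<ge> 1"
    and lim: "(\<lambda>n. \<integral>x. \<bar>u n x - v x\<bar> powr p \<partial>lebesgue_on (cube T)) \<longlonglongrightarrow> 0"
  shows "weak_conv p T u v"
  unfolding weak_conv_def
proof (intro conjI allI impI u v)
  fix \<phi> :: "('a \<Rightarrow> real) \<Rightarrow> real" assume phi: "bdd_lin_functional p T \<phi>"
  then obtain C where C: "\<And>f. f \<in> Lp_torus p T \<Longrightarrow> \<bar>\<phi> f\<bar> \<le> C * Lp_norm p T f"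
    unfolding bdd_lin_functional_def by blast
  have add: "\<phi> (\<lambda>x. f x + g x) = \<phi> f + \<phi> g" if "f \<in> Lp_torus p T" "g \<in> Lp_torus p T" for f g
    using phi that by (simp add: bdd_lin_functional_def)
  have d: "(\<lambda>x. u n x - v x) \<in> Lp_torus p T" for n by (rule Lp_torus_diff[OF u v p])
  have eq: "\<phi> (u n) = \<phi> (\<lambda>x. u n x - v x) + \<phi> v" for n
  proof -
    have "\<phi> (\<lambda>x. (u n x - v x) + v x) = \<phi> (\<lambda>x. u n x - v x) + \<phi> v"
      by (rule add[OF d v])
    then show ?thesis by simp
  qed
  have "(\<lambda>n. (\<integral>x. \<bar>u n x - v x\<bar> powr p \<partial>lebesgue_on (cube T)) powr (1 / p)) \<longlonglongrightarrow> 0"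
    using tendsto_powr'[OF lim tendsto_const[of "1/p"]] p by simp
  then have "(\<lambda>n. Lp_norm p T (\<lambda>x. u n x - v x)) \<longlonglongrightarrow> 0"
    by (simp add: Lp_norm_eq[OF d])
  from tendsto_mult[OF tendsto_const[of C] this]
  have "(\<lambda>n. C * Lp_norm p T (\<lambda>x. u n x - v x)) \<longlonglongrightarrow> 0" by simp
  then have "(\<lambda>n. \<phi> (\<lambda>x. u n x - v x)) \<longlonglongrightarrow> 0"
    by (rule Lim_null_comparison[rotated]) (use C[OF d] in auto)
  from tendsto_add[OF this tendsto_const[of "\<phi> v"]] show "(\<lambda>n. \<phi> (u n)) \<longlonglongrightarrow> \<phi> v"
    by (simp add: eq)
qed

text \<open>The Lipschitz constants of the approximations \<open>g j\<close> may blow up with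
  \<open>j\<close>, so the short-range error \<open>a j n\<close> is only known to vanish for fixed
  \<open>j\<close>. The index \<open>J n\<close> therefore has to grow slowly enough.\<close>

lemma Gamma_limsup:
  fixes v :: "'a::euclidean_space \<Rightarrow> real"
  assumes p: "p \<ge> 1" and T: "T > 0" and s: "\<forall>n. 0 < s n \<and> s n < 1" "s \<longlonglongrightarrow> 0" and v: "v \<in> Lp_torus p T"
  shows "\<exists>u. weak_conv p T u v \<and> limsup (\<lambda>n. ennreal (s n) * Fs p (s n) T (u n))
    \<le> ennreal (real DIM('a) * omega TYPE('a) / (p * T ^ DIM('a))) * F0 p T v"
proof -
  let ?M = "lebesgue_on (cube T :: 'a set)"
  define K where "K = real DIM('a) * omega TYPE('a) / (p * T ^ DIM('a))"
  have s0: "\<forall>n. 0 < s n" using s(1) by simp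
  \<comment> \<open>The shift by two keeps \<open>l 0\<close> strictly below one, as the convex
    splitting requires.\<close>
  define l where "l = (\<lambda>j::nat. 1 / real (j + 2))"
  have l: "0 < l j" "l j < 1" for j by (auto simp: l_def)
  define R where "R = (\<lambda>j g L. g \<in> Lp_torus p T \<and> L \<ge> 0 \<and> (\<forall>x y. \<bar>g x - g y\<bar> \<le> L * norm (x - y)) \<and>
    (\<integral>x. \<bar>g x - v x\<bar> powr p \<partial>?M) \<le> l j \<and>
    F0 p T g \<le> ennreal ((1 - l j) powr (1 - p)) * F0 p T v + ennreal (l j))"
  have "\<exists>g L. R j g L" for j
    unfolding R_def by (rule recovery_approximation[OF v p T l])
  then obtain g L where R: "\<And>j. R j (g j) (L j)" by metis
  have gL: "\<And>j. g j \<in> Lp_torus p T" "\<And>j. L j \<ge> 0"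
    "\<And>j x y. \<bar>g j x - g j y\<bar> \<le> L j * norm (x - y)"
    "\<And>j. (\<integral>x. \<bar>g j x - v x\<bar> powr p \<partial>?M) \<le> l j"
    "\<And>j. F0 p T (g j) \<le> ennreal ((1 - l j) powr (1 - p)) * F0 p T v + ennreal (l j)"
    using R unfolding R_def by auto
  define a where "a = (\<lambda>j n. L j powr p * err_const TYPE('a) p T (s n))"
  have err0: "err_const TYPE('a) p T (s n) \<ge> 0" for n
    using s(1) p T omega_pos[where 'a='a] by (simp add: err_const_def less_imp_le)
  have a0: "a j n \<ge> 0" for j n using err0 by (simp add: a_def)
  have alim: "a j \<longlonglongrightarrow> 0" for j
    using tendsto_mult[OF tendsto_const err_const_tendsto[OF p T s0 s(2)], of "L j powr p"] by (simp add: a_def)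
  obtain J where J: "filterlim J at_top sequentially" "(\<lambda>n. a (J n) n) \<longlonglongrightarrow> 0"
    by (rule diagonal_index[OF alim a0])
  have "l \<longlonglongrightarrow> 0"
    unfolding l_def by real_asymp
  then have lJ: "(\<lambda>n. l (J n)) \<longlonglongrightarrow> 0" by (rule filterlim_compose[OF _ J(1)])
  define u where "u = (\<lambda>n. g (J n))"
  have conv: "weak_conv p T u v"
  proof (rule strong_imp_weak_conv[OF _ v p])
    show "u n \<in> Lp_torus p T" for n using gL by (simp add: u_def)
    show "(\<lambda>n. \<integral>x. \<bar>u n x - v x\<bar> powr p \<partial>?M) \<longlonglongrightarrow> 0"
      by (rule tendsto_sandwich[OF _ _ tendsto_const lJ]) (use gL(4) in \<open>auto simp: u_def\<close>)
  qed
  \<comment> \<open>Finiteness allows the limit of the upper bounds \<open>B n\<close> to be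
    computed in the reals.\<close>
  have "F0 p T v < \<infinity>"
    using le_less_trans[OF F0_le_Lp[OF v p less_imp_le[OF T]] ennreal_less_top] by simp
  then obtain r where r: "r \<ge> 0" "F0 p T v = ennreal r" by (cases "F0 p T v") auto
  define B where "B = (\<lambda>n. up_const TYPE('a) p T (s n) * ((1 - l (J n)) powr (1 - p) * r + l (J n)) + a (J n) n)"
  have "B \<longlonglongrightarrow> K * ((1 - 0) powr (1 - p) * r + 0) + 0"
    unfolding B_def K_def
    by (intro tendsto_add tendsto_mult tendsto_powr tendsto_diff tendsto_const lJ J(2) up_const_tendsto[OF p T s0 s(2)]) auto
  then have Blim: "(\<lambda>n. ennreal (B n)) \<longlonglongrightarrow> ennreal (K * r)"
    by (intro tendsto_ennrealI) simp
  have "filterlim (\<lambda>s. s powr (- 1 / (2 * p))) at_top (at_right 0)"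
    using p by real_asymp
  then have "filterlim (\<lambda>n. s n powr (- 1 / (2 * p))) at_top sequentially"
    by (rule filterlim_compose[OF _ at_right_sequence[OF s0 s(2)]])
  then have "\<forall>\<^sub>F n in sequentially. 2 * norm (T *\<^sub>R One :: 'a) < s n powr (- 1 / (2 * p))"
    by (simp add: filterlim_at_top_dense)
  then have ev: "\<forall>\<^sub>F n in sequentially. ennreal (s n) * Fs p (s n) T (u n) \<le> ennreal (B n)"
  proof eventually_elim
    case (elim n)
    have up0: "up_const TYPE('a) p T (s n) \<ge> 0"
      using p T omega_pos[where 'a='a] by (simp add: up_const_def)
    have "ennreal (s n) * Fs p (s n) T (u n) \<le> ennreal (up_const TYPE('a) p T (s n)) * F0 p T (u n) + ennreal (a (J n) n)"
      unfolding u_def a_def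
      by (rule Fs_le_F0[OF Lp_torus_measurable(1,3)[OF gL(1)] T p _ _ gL(3,2) elim]) (use s in auto)
    also have "\<dots> \<le> ennreal (up_const TYPE('a) p T (s n)) * (ennreal ((1 - l (J n)) powr (1 - p)) * ennreal r + ennreal (l (J n))) + ennreal (a (J n) n)"
      using gL(5)[of "J n"] unfolding u_def r by (intro add_right_mono mult_left_mono) auto
    also have "\<dots> = ennreal (B n)"
      using up0 l[of "J n"] r a0 by (simp add: B_def ennreal_mult'[symmetric] flip: ennreal_plus)
    finally show ?case .
  qed
  have "limsup (\<lambda>n. ennreal (s n) * Fs p (s n) T (u n)) \<le> limsup (\<lambda>n. ennreal (B n))"
    by (rule Limsup_mono[OF ev])
  also have "\<dots> = ennreal (K * r)" by (rule lim_imp_Limsup[OF _ Blim]) simp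
  also have "\<dots> = ennreal K * F0 p T v" using r by (simp add: ennreal_mult'' )
  finally show ?thesis using conv K_def by blast
qed

section \<open>Radon-Nikodym for additive set functions\<close>

text \<open>The epsilon-delta form is what uniform estimates on integrals deliver directly. Over a
  finite measure it upgrades finite additivity to countable additivity, so limits of integrals over
  sets qualify without a separate argument on countable unions.\<close>

definition abs_cont_setfun :: "'b measure \<Rightarrow> ('b set \<Rightarrow> real) \<Rightarrow> bool" where
  "abs_cont_setfun M \<nu> \<longleftrightarrow> (\<forall>e>0. \<exists>d>0. \<forall>A\<in>sets M. measure M A < d \<longrightarrow> \<bar>\<nu> A\<bar> < e)"

definition additive_setfun :: "'b measure \<Rightarrow> ('b set \<Rightarrow> real) \<Rightarrow> bool" where
  "additive_setfun M \<nu> \<longleftrightarrow> (\<forall>A\<in>sets M. \<forall>B\<in>sets M. A \<inter> B = {} \<longrightarrow> \<nu> (A \<union> B) = \<nu> A + \<nu> B)"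

lemma additive_setfun_empty: "additive_setfun M \<nu> \<Longrightarrow> \<nu> {} = 0"
  unfolding additive_setfun_def by (metis Int_empty_left Un_empty_left add_cancel_left_left sets.empty_sets)

lemma integrable_indicator_mult:
  fixes f :: "'b \<Rightarrow> real"
  shows "A \<in> sets M \<Longrightarrow> integrable M f \<Longrightarrow> integrable M (\<lambda>x. indicator A x * f x)"
  using integrable_mult_indicator[of A M f] by simp

text \<open>Absolute continuity gives continuity at the empty set: the measures of a sequence
  decreasing to the empty set tend to zero. Finite additivity then becomes countable additivity, and
  the classical theorem applies; its density is finite almost everywhere because the total mass
  is.\<close>

lemma Radon_Nikodym_additive_nonneg:
  assumes fin: "finite_measure M" and add: "additive_setfun M \<nu>" and ac: "abs_cont_setfun M \<nu>"
    and pos: "\<And>A. A \<in> sets M \<Longrightarrow> \<nu> A \<ge> 0"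
  shows "\<exists>h. integrable M h \<and> (\<forall>A\<in>sets M. \<nu> A = (\<integral>x. indicator A x * h x \<partial>M))"
proof -
  interpret finite_measure M by fact
  define N where "N = measure_of (space M) (sets M) (\<lambda>A. ennreal (\<nu> A))"
  have ca: "countably_additive (sets M) (\<lambda>A. ennreal (\<nu> A))"
  proof (rule sets.empty_continuous_imp_countably_additive)
    show "positive (sets M) (\<lambda>A. ennreal (\<nu> A))"
      by (simp add: positive_def additive_setfun_empty[OF add])
    show "additive (sets M) (\<lambda>A. ennreal (\<nu> A))"
      unfolding additive_def
    proof (intro ballI impI)
      fix A B assume AB: "A \<in> sets M" "B \<in> sets M" "A \<inter> B = {}"
      then have "\<nu> (A \<union> B) = \<nu> A + \<nu> B" using add by (simp add: additive_setfun_def)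
      then show "ennreal (\<nu> (A \<union> B)) = ennreal (\<nu> A) + ennreal (\<nu> B)"
        using pos AB by simp
    qed
    fix A :: "nat \<Rightarrow> 'a set" assume A: "range A \<subseteq> sets M" "decseq A" "(\<Inter>i. A i) = {}"
    have m: "(\<lambda>i. measure M (A i)) \<longlonglongrightarrow> 0"
      using finite_Lim_measure_decseq[OF A(1,2)] A(3) by simp
    have "(\<lambda>i. \<nu> (A i)) \<longlonglongrightarrow> 0"
    proof (rule LIMSEQ_I)
      fix e :: real assume "e > 0"
      then obtain d where d: "d > 0" "\<And>B. B \<in> sets M \<Longrightarrow> measure M B < d \<Longrightarrow> \<bar>\<nu> B\<bar> < e"
        using ac unfolding abs_cont_setfun_def by meson
      have "\<forall>\<^sub>F i in sequentially. measure M (A i) < d"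
        using m d(1) by (simp add: order_tendsto_iff)
      then show "\<exists>n. \<forall>i\<ge>n. norm (\<nu> (A i) - 0) < e"
        using d(2) A(1) unfolding eventually_sequentially by (metis diff_zero range_subsetD real_norm_def)
    qed
    then show "(\<lambda>i. ennreal (\<nu> (A i))) \<longlonglongrightarrow> 0"
      using tendsto_ennrealI by fastforce
  qed auto
  have sN: "sets N = sets M" "space N = space M" by (simp_all add: N_def sets.space_closed)
  have eN: "emeasure N A = ennreal (\<nu> A)" if "A \<in> sets M" for A
    unfolding N_def
    by (rule emeasure_measure_of_sigma[OF sets.sigma_algebra_axioms _ ca that])
       (simp add: positive_def additive_setfun_empty[OF add])
  have "absolutely_continuous M N"
    unfolding absolutely_continuous_def
  proof
    fix A assume A: "A \<in> null_sets M"
    then have "measure M A = 0" "A \<in> sets M" by (auto simp: null_sets_def measure_def)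
    then have "\<bar>\<nu> A\<bar> < e" if "e > 0" for e using ac that unfolding abs_cont_setfun_def by fastforce
    then have "\<nu> A = 0" by (metis less_irrefl zero_less_abs_iff)
    then show "A \<in> null_sets N" using \<open>A \<in> sets M\<close> by (simp add: null_sets_def sN eN)
  qed
  then obtain f where f: "f \<in> borel_measurable M" "density M f = N"
    using Radon_Nikodym[of N] sN by auto
  have fA: "(\<integral>\<^sup>+x. f x * indicator A x \<partial>M) = ennreal (\<nu> A)" if "A \<in> sets M" for A
    using emeasure_density[OF f(1) that] eN[OF that] f(2) by simp
  have "(\<integral>\<^sup>+x. f x \<partial>M) = (\<integral>\<^sup>+x. f x * indicator (space M) x \<partial>M)"
    by (rule nn_integral_cong) simp
  also have "\<dots> \<noteq> \<infinity>" using fA[of "space M"] by simp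
  finally have fI: "(\<integral>\<^sup>+x. f x \<partial>M) \<noteq> \<infinity>" .
  then have "AE x in M. f x \<noteq> \<infinity>" by (rule nn_integral_PInf_AE[OF f(1)])
  then have fe: "AE x in M. f x = ennreal (enn2real (f x))"
    by eventually_elim (simp add: less_top)
  have "integrable M (\<lambda>x. enn2real (f x))"
  proof (rule integrableI_nonneg)
    have "(\<integral>\<^sup>+x. ennreal (enn2real (f x)) \<partial>M) = (\<integral>\<^sup>+x. f x \<partial>M)"
      using fe by (intro nn_integral_cong_AE) (auto elim!: eventually_mono)
    then show "(\<integral>\<^sup>+x. ennreal (enn2real (f x)) \<partial>M) < \<infinity>"
      using fI by (simp add: less_top)
  qed (use f in auto)
  moreover have "\<nu> A = (\<integral>x. indicator A x * enn2real (f x) \<partial>M)" if A: "A \<in> sets M" for A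
  proof -
    have "ennreal (\<nu> A) = (\<integral>\<^sup>+x. ennreal (indicator A x * enn2real (f x)) \<partial>M)"
      unfolding fA[OF A, symmetric]
      using fe by (intro nn_integral_cong_AE) (auto elim!: eventually_mono simp: indicator_def)
    then have "(\<integral>x. indicator A x * enn2real (f x) \<partial>M) = enn2real (ennreal (\<nu> A))"
      using f(1) A by (subst integral_eq_nn_integral) auto
    then show ?thesis using pos[OF A] by simp
  qed
  ultimately show ?thesis by blast
qed

text \<open>Jordan decomposition: \<open>\<rho>\<close> is the positive variation, finite by
  \<open>bdd\<close>, and both \<open>\<rho>\<close> and \<open>\<rho> A - \<nu> A\<close> are
  nonnegative, additive and absolutely continuous. The density is the difference of their two
  densities.\<close>

lemma Radon_Nikodym_additive:
  assumes fin: "finite_measure M" and add: "additive_setfun M \<nu>" and ac: "abs_cont_setfun M \<nu>"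
    and bdd: "\<And>A. A \<in> sets M \<Longrightarrow> \<bar>\<nu> A\<bar> \<le> B"
  shows "\<exists>h. integrable M h \<and> (\<forall>A\<in>sets M. \<nu> A = (\<integral>x. indicator A x * h x \<partial>M))"
proof -
  interpret finite_measure M by fact
  define S where "S = (\<lambda>A. {C. C \<in> sets M \<and> C \<subseteq> A})"
  define \<rho> where "\<rho> = (\<lambda>A. SUP C\<in>S A. \<nu> C)"
  have bA: "bdd_above (\<nu> ` S A)" for A
    by (rule bdd_aboveI2[of _ _ B]) (use bdd in \<open>force simp: S_def abs_le_iff\<close>)
  have ne: "S A \<noteq> {}" for A by (auto simp: S_def)
  have up: "\<nu> C \<le> \<rho> A" if "C \<in> sets M" "C \<subseteq> A" for A C
    unfolding \<rho>_def by (rule cSUP_upper[OF _ bA]) (use that in \<open>simp add: S_def\<close>)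
  have least: "\<rho> A \<le> c" if "\<And>C. C \<in> sets M \<Longrightarrow> C \<subseteq> A \<Longrightarrow> \<nu> C \<le> c" for A c
    unfolding \<rho>_def by (rule cSUP_least[OF ne]) (use that in \<open>simp add: S_def\<close>)
  have pos: "\<rho> A \<ge> 0" for A
    using up[of "{}" A] by (simp add: additive_setfun_empty[OF add])
  have addD: "\<nu> (A \<union> B) = \<nu> A + \<nu> B" if "A \<in> sets M" "B \<in> sets M" "A \<inter> B = {}" for A B
    using add that by (simp add: additive_setfun_def)
  have radd: "additive_setfun M \<rho>"
    unfolding additive_setfun_def
  proof (intro ballI impI antisym)
    fix A B assume A: "A \<in> sets M" and B: "B \<in> sets M" and AB: "A \<inter> B = {}"
    show "\<rho> (A \<union> B) \<le> \<rho> A + \<rho> B"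
    proof (rule least)
      fix C assume C: "C \<in> sets M" "C \<subseteq> A \<union> B"
      then have "C = (C \<inter> A) \<union> (C \<inter> B)" by auto
      then have "\<nu> C = \<nu> ((C \<inter> A) \<union> (C \<inter> B))" by simp
      also have "\<dots> = \<nu> (C \<inter> A) + \<nu> (C \<inter> B)"
        by (rule addD) (use A B AB C(1) in auto)
      finally show "\<nu> C \<le> \<rho> A + \<rho> B"
        using up[of "C \<inter> A" A] up[of "C \<inter> B" B] C(1) A B by simp
    qed
    \<comment> \<open>For superadditivity the two suprema are taken one after the other: over
      subsets of \<open>A\<close> with \<open>D\<close> fixed, and afterwards over
      \<open>D\<close>.\<close>
    have "\<rho> A \<le> \<rho> (A \<union> B) - \<nu> D" if D: "D \<in> sets M" "D \<subseteq> B" for D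
    proof (rule least)
      fix C assume C: "C \<in> sets M" "C \<subseteq> A"
      have "\<nu> (C \<union> D) = \<nu> C + \<nu> D" using C D AB by (intro addD) auto
      moreover have "\<nu> (C \<union> D) \<le> \<rho> (A \<union> B)" using C D by (intro up) auto
      ultimately show "\<nu> C \<le> \<rho> (A \<union> B) - \<nu> D" by simp
    qed
    then have "\<nu> D \<le> \<rho> (A \<union> B) - \<rho> A" if "D \<in> sets M" "D \<subseteq> B" for D using that by fastforce
    then have "\<rho> B \<le> \<rho> (A \<union> B) - \<rho> A" by (rule least)
    then show "\<rho> A + \<rho> B \<le> \<rho> (A \<union> B)" by simp
  qed
  have rac: "abs_cont_setfun M \<rho>"
    unfolding abs_cont_setfun_def
  proof (intro allI impI)
    fix e :: real assume "e > 0"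
    then have "e / 2 > 0" by simp
    then obtain d where d: "d > 0" "\<And>A. A \<in> sets M \<Longrightarrow> measure M A < d \<Longrightarrow> \<bar>\<nu> A\<bar> < e / 2"
      using ac unfolding abs_cont_setfun_def by meson
    have "\<bar>\<rho> A\<bar> < e" if A: "A \<in> sets M" "measure M A < d" for A
    proof -
      have "\<rho> A \<le> e / 2"
      proof (rule least)
        fix C assume C: "C \<in> sets M" "C \<subseteq> A"
        then have "measure M C < d" using finite_measure_mono[OF C(2) A(1)] A(2) by simp
        then show "\<nu> C \<le> e / 2" using d(2)[OF C(1)] by linarith
      qed
      then show ?thesis using pos[of A] \<open>e > 0\<close> by simp
    qed
    then show "\<exists>d>0. \<forall>A\<in>sets M. measure M A < d \<longrightarrow> \<bar>\<rho> A\<bar> < e" using d(1) by blast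
  qed
  obtain h1 where h1: "integrable M h1" "\<And>A. A \<in> sets M \<Longrightarrow> \<rho> A = (\<integral>x. indicator A x * h1 x \<partial>M)"
    using Radon_Nikodym_additive_nonneg[OF fin radd rac pos] by blast
  have "additive_setfun M (\<lambda>A. \<rho> A - \<nu> A)"
    using radd add by (simp add: additive_setfun_def)
  moreover have "abs_cont_setfun M (\<lambda>A. \<rho> A - \<nu> A)"
    unfolding abs_cont_setfun_def
  proof (intro allI impI)
    fix e :: real assume "e > 0"
    then have e2: "e / 2 > 0" by simp
    obtain d1 where d1: "d1 > 0" "\<And>A. A \<in> sets M \<Longrightarrow> measure M A < d1 \<Longrightarrow> \<bar>\<nu> A\<bar> < e / 2"
      using ac e2 unfolding abs_cont_setfun_def by meson
    obtain d2 where d2: "d2 > 0" "\<And>A. A \<in> sets M \<Longrightarrow> measure M A < d2 \<Longrightarrow> \<bar>\<rho> A\<bar> < e / 2"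
      using rac e2 unfolding abs_cont_setfun_def by meson
    show "\<exists>d>0. \<forall>A\<in>sets M. measure M A < d \<longrightarrow> \<bar>\<rho> A - \<nu> A\<bar> < e"
    proof (intro exI[of _ "min d1 d2"] conjI ballI impI)
      fix A assume "A \<in> sets M" "measure M A < min d1 d2"
      then show "\<bar>\<rho> A - \<nu> A\<bar> < e" using d1(2)[of A] d2(2)[of A] by simp
    qed (use d1 d2 in simp)
  qed
  moreover have "\<rho> A - \<nu> A \<ge> 0" if "A \<in> sets M" for A using up[OF that, of A] by simp
  ultimately obtain h2 where h2: "integrable M h2" "\<And>A. A \<in> sets M \<Longrightarrow> \<rho> A - \<nu> A = (\<integral>x. indicator A x * h2 x \<partial>M)"
    using Radon_Nikodym_additive_nonneg[OF fin, of "\<lambda>A. \<rho> A - \<nu> A"] by blast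
  show ?thesis
  proof (intro exI[of _ "\<lambda>x. h1 x - h2 x"] conjI ballI)
    fix A assume A: "A \<in> sets M"
    have "(\<integral>x. indicator A x * (h1 x - h2 x) \<partial>M) = (\<integral>x. indicator A x * h1 x - indicator A x * h2 x \<partial>M)"
      by (simp add: right_diff_distrib)
    also have "\<dots> = (\<integral>x. indicator A x * h1 x \<partial>M) - (\<integral>x. indicator A x * h2 x \<partial>M)"
      using A h1(1) h2(1) by (intro Bochner_Integration.integral_diff integrable_indicator_mult)
    finally show "\<nu> A = (\<integral>x. indicator A x * (h1 x - h2 x) \<partial>M)"
      using h1(2)[OF A] h2(2)[OF A] by simp
  qed (use h1 h2 in auto)
qed

text \<open>The free parameter \<open>t\<close> does the work of Hoelder's inequality: it makes the
  first term small at the expense of the second, which can be made small afterwards.\<close>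

lemma Youngs_inequality_scaled:
  fixes a b p q t :: real
  assumes "p > 1" "q > 1" "1/p + 1/q = 1" "t > 0"
  shows "\<bar>a * b\<bar> \<le> t powr p * \<bar>a\<bar> powr p + t powr (- q) * \<bar>b\<bar> powr q"
proof -
  have "\<bar>a * b\<bar> = (t * \<bar>a\<bar>) * (\<bar>b\<bar> / t)" using assms by (simp add: abs_mult)
  also have "\<dots> \<le> (t * \<bar>a\<bar>) powr p / p + (\<bar>b\<bar> / t) powr q / q"
    using assms by (intro Youngs_inequality) auto
  also have "\<dots> \<le> (t * \<bar>a\<bar>) powr p / 1 + (\<bar>b\<bar> / t) powr q / 1"
    using assms by (intro add_mono divide_left_mono) auto
  also have "\<dots> = t powr p * \<bar>a\<bar> powr p + t powr (- q) * \<bar>b\<bar> powr q"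
    using assms by (simp add: powr_mult powr_divide powr_minus field_simps)
  finally show ?thesis .
qed

text \<open>Converse Hoelder inequality. The truncated test function
  \<open>\<bar>h x\<bar> powr (q - 1) * sgn (h x)\<close> satisfies
  \<open>h x * g x = \<bar>g x\<bar> powr p = \<bar>h x\<bar> powr q\<close> on the level set. The
  term divided by \<open>p > 1\<close> is absorbed on the left, leaving a bound uniform in the
  truncation.\<close>

lemma dual_exponent_bound:
  fixes h :: "'b \<Rightarrow> real"
  assumes fin: "finite_measure M" and pq: "p > 1" "q > 1" "1/p + 1/q = 1"
    and h[measurable]: "h \<in> borel_measurable M"
    and le: "\<And>g B. g \<in> borel_measurable M \<Longrightarrow> (\<And>x. \<bar>g x\<bar> \<le> B) \<Longrightarrow> (\<integral>x. h x * g x \<partial>M) \<le> c + (\<integral>x. \<bar>g x\<bar> powr p \<partial>M) / p"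
  shows "integrable M (\<lambda>x. \<bar>h x\<bar> powr q)"
proof (rule integrableI_nonneg)
  interpret finite_measure M by fact
  define f where "f = (\<lambda>k::nat. \<lambda>x. if \<bar>h x\<bar> \<le> real k then \<bar>h x\<bar> powr q else 0)"
  have [measurable]: "f k \<in> borel_measurable M" for k unfolding f_def by measurable
  have If: "integrable M (f k)" for k
    by (rule integrable_const_bound[of _ "real k powr q"]) (use pq in \<open>auto simp: f_def intro!: powr_mono2 AE_I2\<close>)
  have le: "(\<integral>x. f k x \<partial>M) \<le> q * c" for k
  proof -
    define g where "g = (\<lambda>x. if \<bar>h x\<bar> \<le> real k then \<bar>h x\<bar> powr (q - 1) * sgn (h x) else 0)"
    have [measurable]: "g \<in> borel_measurable M" unfolding g_def by measurable
    have gb: "\<bar>g x\<bar> \<le> real k powr (q - 1)" for x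
      using pq by (auto simp: g_def abs_mult sgn_if intro!: powr_mono2)
    have e: "(q - 1) * p = q" using pq by (simp add: field_simps)
    have 1: "h x * g x = f k x" for x
      by (auto simp: g_def f_def sgn_if powr_mult_base abs_if) (auto simp: powr_diff)
    have 2: "\<bar>g x\<bar> powr p = f k x" for x
      using pq by (auto simp: g_def f_def abs_mult sgn_if powr_powr e)
    have "(\<integral>x. f k x \<partial>M) \<le> c + (\<integral>x. f k x \<partial>M) / p"
      using le[of g "real k powr (q - 1)"] gb unfolding 1 2 by simp
    then have "(\<integral>x. f k x \<partial>M) * (1 - 1/p) \<le> c" by (simp add: algebra_simps)
    also have "1 - 1/p = 1/q" using pq by linarith
    finally show ?thesis using pq by (simp add: field_simps)
  qed
  have "(\<integral>\<^sup>+x. ennreal (\<bar>h x\<bar> powr q) \<partial>M) = (SUP k. \<integral>\<^sup>+x. ennreal (f k x) \<partial>M)"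
    unfolding f_def by (rule nn_integral_powr_truncation) measurable
  also have "\<dots> \<le> ennreal (q * c)"
  proof (rule SUP_least)
    fix k
    have "(\<integral>\<^sup>+x. ennreal (f k x) \<partial>M) = ennreal (\<integral>x. f k x \<partial>M)"
      by (rule nn_integral_eq_integral[OF If]) (auto simp: f_def)
    then show "(\<integral>\<^sup>+x. ennreal (f k x) \<partial>M) \<le> ennreal (q * c)" using le[of k] by (simp add: ennreal_leI)
  qed
  finally show "(\<integral>\<^sup>+x. ennreal (\<bar>h x\<bar> powr q) \<partial>M) < \<infinity>" by (simp add: le_less_trans)
qed (use h in auto)

section \<open>Duality and weak compactness of Lp\<close>

lemma integral_simple_function_mult:
  fixes s w :: "'b \<Rightarrow> real"
  assumes s: "simple_function M s" and w: "integrable M w"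
  shows "(\<integral>x. s x * w x \<partial>M) = (\<Sum>y\<in>s ` space M. y * (\<integral>x. indicator (s -` {y} \<inter> space M) x * w x \<partial>M))"
proof -
  have m: "s -` {y} \<inter> space M \<in> sets M" for y using s by (rule simple_functionD)
  have f: "finite (s ` space M)" using s by (rule simple_functionD)
  have "(\<integral>x. s x * w x \<partial>M) = (\<integral>x. (\<Sum>y\<in>s ` space M. y * (indicator (s -` {y} \<inter> space M) x * w x)) \<partial>M)"
  proof (rule Bochner_Integration.integral_cong[OF refl])
    fix x assume x: "x \<in> space M"
    have "(\<Sum>y\<in>s ` space M. y * (indicator (s -` {y} \<inter> space M) x * w x)) = (\<Sum>y\<in>s ` space M. if y = s x then y * w x else 0)"
      using x by (intro sum.cong) (auto simp: indicator_def)
    also have "\<dots> = s x * w x" using f x by simp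
    finally show "s x * w x = (\<Sum>y\<in>s ` space M. y * (indicator (s -` {y} \<inter> space M) x * w x))" ..
  qed
  also have "\<dots> = (\<Sum>y\<in>s ` space M. (\<integral>x. y * (indicator (s -` {y} \<inter> space M) x * w x) \<partial>M))"
    by (intro Bochner_Integration.integral_sum integrable_mult_right integrable_indicator_mult m w)
  finally show ?thesis by simp
qed

lemma simple_approximation:
  fixes h :: "'b \<Rightarrow> real"
  assumes h: "h \<in> borel_measurable M"
  obtains s where "\<And>i::nat. simple_function M (s i)" "\<And>x. x \<in> space M \<Longrightarrow> (\<lambda>i. s i x) \<longlonglongrightarrow> h x"
    "\<And>i x. x \<in> space M \<Longrightarrow> \<bar>s i x\<bar> \<le> 2 * \<bar>h x\<bar>"
proof -
  obtain s where "\<forall>i. simple_function M (s i)" "\<forall>x\<in>space M. (\<lambda>i. s i x) \<longlonglongrightarrow> h x"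
    "\<forall>i. \<forall>x\<in>space M. dist (s i x) 0 \<le> 2 * dist (h x) 0"
    using borel_measurable_implies_sequence_metric[OF h, of 0] by blast
  then show thesis by (intro that[of s]) (auto simp: dist_real_def)
qed

lemma simple_approximation_powr:
  fixes h :: "'b \<Rightarrow> real"
  assumes h[measurable]: "h \<in> borel_measurable M" and p: "p > 0" and int: "integrable M (\<lambda>x. \<bar>h x\<bar> powr p)"
    and s: "\<And>i::nat. simple_function M (s i)" "\<And>x. x \<in> space M \<Longrightarrow> (\<lambda>i. s i x) \<longlonglongrightarrow> h x"
    "\<And>i x. x \<in> space M \<Longrightarrow> \<bar>s i x\<bar> \<le> 2 * \<bar>h x\<bar>"
  shows "(\<lambda>i. \<integral>x. \<bar>h x - s i x\<bar> powr p \<partial>M) \<longlonglongrightarrow> 0" "integrable M (\<lambda>x. \<bar>h x - s i x\<bar> powr p)"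
    "integrable M (\<lambda>x. \<bar>s i x\<bar> powr p)"
proof -
  have [measurable]: "s i \<in> borel_measurable M" for i using s(1) by (rule borel_measurable_simple_function)
  have b: "\<bar>h x - s i x\<bar> powr p \<le> 3 powr p * \<bar>h x\<bar> powr p" if "x \<in> space M" for i x
  proof -
    have "\<bar>h x - s i x\<bar> powr p \<le> (3 * \<bar>h x\<bar>) powr p"
      using s(3)[OF that, of i] p by (intro powr_mono2) auto
    then show ?thesis by (simp add: powr_mult)
  qed
  have b2: "\<bar>s i x\<bar> powr p \<le> 2 powr p * \<bar>h x\<bar> powr p" if "x \<in> space M" for i x
  proof -
    have "\<bar>s i x\<bar> powr p \<le> (2 * \<bar>h x\<bar>) powr p"
      using s(3)[OF that, of i] p by (intro powr_mono2) auto
    then show ?thesis by (simp add: powr_mult)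
  qed
  have w: "integrable M (\<lambda>x. c * \<bar>h x\<bar> powr p)" for c using int by simp
  show "(\<lambda>i. \<integral>x. \<bar>h x - s i x\<bar> powr p \<partial>M) \<longlonglongrightarrow> 0"
    by (rule integral_powr_diff_tendsto_0[OF p _ _ _ w b]) (use s(2) in auto)
  show "integrable M (\<lambda>x. \<bar>h x - s i x\<bar> powr p)"
    by (rule Bochner_Integration.integrable_bound[OF w[of "3 powr p"]]) (use b in \<open>auto intro!: AE_I2\<close>)
  show "integrable M (\<lambda>x. \<bar>s i x\<bar> powr p)"
    by (rule Bochner_Integration.integrable_bound[OF w[of "2 powr p"]]) (use b2 in \<open>auto intro!: AE_I2\<close>)
qed

lemma integral_mult_simple_tendsto:
  fixes h v :: "'b \<Rightarrow> real"
  assumes h[measurable]: "h \<in> borel_measurable M" and v[measurable]: "v \<in> borel_measurable M" and int: "integrable M (\<lambda>x. h x * v x)"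
    and s: "\<And>i::nat. simple_function M (s i)" "\<And>x. x \<in> space M \<Longrightarrow> (\<lambda>i. s i x) \<longlonglongrightarrow> h x"
    "\<And>i x. x \<in> space M \<Longrightarrow> \<bar>s i x\<bar> \<le> 2 * \<bar>h x\<bar>"
  shows "(\<lambda>i. \<integral>x. s i x * v x \<partial>M) \<longlonglongrightarrow> (\<integral>x. h x * v x \<partial>M)"
proof (rule integral_dominated_convergence[where w="\<lambda>x. 2 * \<bar>h x * v x\<bar>"])
  have [measurable]: "s i \<in> borel_measurable M" for i using s(1) by (rule borel_measurable_simple_function)
  show "(\<lambda>x. s i x * v x) \<in> borel_measurable M" for i by measurable
  show "AE x in M. (\<lambda>i. s i x * v x) \<longlonglongrightarrow> h x * v x"
    by (rule AE_I2, intro tendsto_mult tendsto_const s(2))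
  show "AE x in M. norm (s i x * v x) \<le> 2 * \<bar>h x * v x\<bar>" for i
  proof (rule AE_I2)
    fix x assume "x \<in> space M"
    then have "\<bar>s i x\<bar> * \<bar>v x\<bar> \<le> (2 * \<bar>h x\<bar>) * \<bar>v x\<bar>" by (intro mult_right_mono s(3)) auto
    then show "norm (s i x * v x) \<le> 2 * \<bar>h x * v x\<bar>" by (simp add: abs_mult)
  qed
qed (use int in auto)

lemma integrable_Young:
  fixes f g :: "'b \<Rightarrow> real"
  assumes pq: "p > 1" "q > 1" "1/p + 1/q = 1"
    and [measurable]: "f \<in> borel_measurable M" "g \<in> borel_measurable M"
    and int: "integrable M (\<lambda>x. \<bar>f x\<bar> powr p)" "integrable M (\<lambda>x. \<bar>g x\<bar> powr q)"
  shows "integrable M (\<lambda>x. f x * g x)"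
    and "t > 0 \<Longrightarrow> \<bar>\<integral>x. f x * g x \<partial>M\<bar> \<le> t powr p * (\<integral>x. \<bar>f x\<bar> powr p \<partial>M) + t powr (- q) * (\<integral>x. \<bar>g x\<bar> powr q \<partial>M)"
proof -
  have *: "integrable M (\<lambda>x. t powr p * \<bar>f x\<bar> powr p + t powr (- q) * \<bar>g x\<bar> powr q)" for t
    using int by auto
  show I: "integrable M (\<lambda>x. f x * g x)"
  proof (rule Bochner_Integration.integrable_bound[OF *[of 1]])
    show "AE x in M. norm (f x * g x) \<le> norm (1 powr p * \<bar>f x\<bar> powr p + 1 powr (- q) * \<bar>g x\<bar> powr q)"
    proof (rule AE_I2)
      fix x
      show "norm (f x * g x) \<le> norm (1 powr p * \<bar>f x\<bar> powr p + 1 powr (- q) * \<bar>g x\<bar> powr q)"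
        using Youngs_inequality_scaled[OF pq, of 1 "f x" "g x"] by (simp add: order_trans[OF _ abs_ge_self])
    qed
  qed measurable
  show "\<bar>\<integral>x. f x * g x \<partial>M\<bar> \<le> t powr p * (\<integral>x. \<bar>f x\<bar> powr p \<partial>M) + t powr (- q) * (\<integral>x. \<bar>g x\<bar> powr q \<partial>M)" if t: "t > 0"
  proof -
    have "\<bar>\<integral>x. f x * g x \<partial>M\<bar> \<le> (\<integral>x. \<bar>f x * g x\<bar> \<partial>M)" by (rule integral_abs_bound)
    also have "\<dots> \<le> (\<integral>x. t powr p * \<bar>f x\<bar> powr p + t powr (- q) * \<bar>g x\<bar> powr q \<partial>M)"
      by (rule integral_mono[OF integrable_abs[OF I] *]) (rule Youngs_inequality_scaled[OF pq t])
    also have "\<dots> = t powr p * (\<integral>x. \<bar>f x\<bar> powr p \<partial>M) + t powr (- q) * (\<integral>x. \<bar>g x\<bar> powr q \<partial>M)"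
      using int by simp
    finally show ?thesis .
  qed
qed

lemma exists_small_powr:
  fixes e B p :: real
  assumes "e > 0" "p > 0" "B \<ge> 0"
  obtains t where "t > 0" "t powr p * B < e"
proof (rule that[of "(e / (B + 1)) powr (1 / p)"])
  have "((e / (B + 1)) powr (1 / p)) powr p * B = e * (B / (B + 1))"
    using assms by (simp add: powr_powr)
  also have "\<dots> < e * 1" using assms by (intro mult_strict_left_mono) auto
  finally show "((e / (B + 1)) powr (1 / p)) powr p * B < e" by simp
qed (use assms in auto)

text \<open>Simple functions reduce the claim to integrals over sets. Choosing \<open>t\<close>
  makes the contribution of the bounded norms small for all \<open>n\<close> at once, then
  \<open>i\<close> makes the approximation error of \<open>h\<close> small, and \<open>n\<close>
  comes last. Integrability of \<open>h * v\<close> is assumed separately because the lemma also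
  serves, with bounded \<open>h\<close>, to prove that \<open>v\<close> lies in
  \<open>Lp\<close>.\<close>

lemma weak_limit_against_dual:
  fixes w :: "nat \<Rightarrow> 'b \<Rightarrow> real" and v h :: "'b \<Rightarrow> real"
  assumes pq: "p > 1" "q > 1" "1/p + 1/q = 1"
    and w: "\<And>n. integrable M (w n)" "\<And>n. integrable M (\<lambda>x. \<bar>w n x\<bar> powr p)" "\<And>n. (\<integral>x. \<bar>w n x\<bar> powr p \<partial>M) \<le> B"
    and v: "integrable M v"
    and conv: "\<And>A. A \<in> sets M \<Longrightarrow> (\<lambda>n. \<integral>x. indicator A x * w n x \<partial>M) \<longlonglongrightarrow> (\<integral>x. indicator A x * v x \<partial>M)"
    and h[measurable]: "h \<in> borel_measurable M" and hq: "integrable M (\<lambda>x. \<bar>h x\<bar> powr q)" and hv: "integrable M (\<lambda>x. h x * v x)"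
  shows "(\<lambda>n. \<integral>x. h x * w n x \<partial>M) \<longlonglongrightarrow> (\<integral>x. h x * v x \<partial>M)"
proof (rule LIMSEQ_I)
  fix e :: real assume e: "e > 0"
  have [measurable]: "v \<in> borel_measurable M" "\<And>n. w n \<in> borel_measurable M" using v w by auto
  have B: "B \<ge> 0" using w(3)[of 0] by (rule order_trans[rotated]) simp
  obtain s where s: "\<And>i::nat. simple_function M (s i)" "\<And>x. x \<in> space M \<Longrightarrow> (\<lambda>i. s i x) \<longlonglongrightarrow> h x"
    "\<And>i x. x \<in> space M \<Longrightarrow> \<bar>s i x\<bar> \<le> 2 * \<bar>h x\<bar>"
    using simple_approximation[OF h] by blast
  have q0: "q > 0" using pq by simp
  note sp = simple_approximation_powr[OF h q0 hq s]
  have [measurable]: "s i \<in> borel_measurable M" for i using s(1) by (rule borel_measurable_simple_function)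
  have e4: "e / 4 > 0" using e by simp
  obtain t where t: "t > 0" "t powr p * B < e / 4"
    using exists_small_powr[OF e4 _ B, of p] pq by auto
  have "(\<lambda>i. t powr (- q) * (\<integral>x. \<bar>h x - s i x\<bar> powr q \<partial>M)) \<longlonglongrightarrow> t powr (- q) * 0"
    by (intro tendsto_intros sp(1))
  then have "\<forall>\<^sub>F i in sequentially. t powr (- q) * (\<integral>x. \<bar>h x - s i x\<bar> powr q \<partial>M) < e / 4"
    using e4 by (intro order_tendstoD(2)) auto
  moreover have "\<forall>\<^sub>F i in sequentially. dist (\<integral>x. s i x * v x \<partial>M) (\<integral>x. h x * v x \<partial>M) < e / 4"
    by (rule tendstoD[OF integral_mult_simple_tendsto[OF h _ hv s] e4]) simp
  ultimately have "\<forall>\<^sub>F i in sequentially. t powr (- q) * (\<integral>x. \<bar>h x - s i x\<bar> powr q \<partial>M) < e / 4 \<and>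
      dist (\<integral>x. s i x * v x \<partial>M) (\<integral>x. h x * v x \<partial>M) < e / 4"
    by (rule eventually_conj)
  then obtain i where i: "t powr (- q) * (\<integral>x. \<bar>h x - s i x\<bar> powr q \<partial>M) < e / 4"
    "dist (\<integral>x. s i x * v x \<partial>M) (\<integral>x. h x * v x \<partial>M) < e / 4"
    by (auto simp: eventually_sequentially)
  have "(\<lambda>n. \<integral>x. s i x * w n x \<partial>M) \<longlonglongrightarrow> (\<integral>x. s i x * v x \<partial>M)"
    unfolding integral_simple_function_mult[OF s(1) w(1)] integral_simple_function_mult[OF s(1) v]
    by (intro tendsto_intros conv simple_functionD(2)[OF s(1)])
  then have "\<forall>\<^sub>F n in sequentially. dist (\<integral>x. s i x * w n x \<partial>M) (\<integral>x. s i x * v x \<partial>M) < e / 4"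
    using e4 by (rule tendstoD)
  then obtain N where N: "\<And>n. n \<ge> N \<Longrightarrow> dist (\<integral>x. s i x * w n x \<partial>M) (\<integral>x. s i x * v x \<partial>M) < e / 4"
    by (auto simp: eventually_sequentially)
  show "\<exists>N. \<forall>n\<ge>N. norm ((\<integral>x. h x * w n x \<partial>M) - (\<integral>x. h x * v x \<partial>M)) < e"
  proof (intro exI[of _ N] allI impI)
    fix n assume n: "n \<ge> N"
    have Ih: "integrable M (\<lambda>x. w n x * h x)" by (rule integrable_Young(1)[OF pq _ _ w(2) hq]) measurable
    have Is: "integrable M (\<lambda>x. w n x * (h x - s i x))" by (rule integrable_Young(1)[OF pq _ _ w(2) sp(2)]) measurable
    have "(\<integral>x. h x * w n x \<partial>M) - (\<integral>x. s i x * w n x \<partial>M) = (\<integral>x. w n x * (h x - s i x) \<partial>M)"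
    proof -
      have "integrable M (\<lambda>x. w n x * h x - w n x * (h x - s i x))" using Ih Is by (rule Bochner_Integration.integrable_diff)
      then have "integrable M (\<lambda>x. s i x * w n x)" by (simp add: algebra_simps)
      then have "(\<integral>x. h x * w n x \<partial>M) - (\<integral>x. s i x * w n x \<partial>M) = (\<integral>x. h x * w n x - s i x * w n x \<partial>M)"
        using Ih by (intro Bochner_Integration.integral_diff[symmetric]) (simp_all add: mult.commute)
      then show ?thesis by (simp add: algebra_simps)
    qed
    moreover have "\<bar>\<integral>x. w n x * (h x - s i x) \<partial>M\<bar> \<le> t powr p * (\<integral>x. \<bar>w n x\<bar> powr p \<partial>M) + t powr (- q) * (\<integral>x. \<bar>h x - s i x\<bar> powr q \<partial>M)"
      by (rule integrable_Young(2)[OF pq _ _ w(2) sp(2) t(1)]) measurable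
    moreover have "t powr p * (\<integral>x. \<bar>w n x\<bar> powr p \<partial>M) \<le> t powr p * B"
      by (rule mult_left_mono[OF w(3)]) simp
    ultimately show "norm ((\<integral>x. h x * w n x \<partial>M) - (\<integral>x. h x * v x \<partial>M)) < e"
      using i t(2) N[OF n] unfolding dist_real_def real_norm_def by linarith
  qed
qed

text \<open>The values of the functional on indicators form an additive, absolutely continuous set
  function, and its density \<open>h\<close> represents the functional on simple functions. Testing
  with bounded functions places \<open>h\<close> in the dual space, after which density extends the
  representation to all of \<open>L\<close>.\<close>

lemma Riesz_representation_Lp:
  fixes \<Phi> :: "('b \<Rightarrow> real) \<Rightarrow> real"
  assumes fin: "finite_measure M" and pq: "p > 1" "q > 1" "1/p + 1/q = 1"
  defines "L \<equiv> {f. f \<in> borel_measurable M \<and> integrable M (\<lambda>x. \<bar>f x\<bar> powr p)}"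
  assumes add: "\<And>f g. f \<in> L \<Longrightarrow> g \<in> L \<Longrightarrow> \<Phi> (\<lambda>x. f x + g x) = \<Phi> f + \<Phi> g"
    and mult: "\<And>f c. f \<in> L \<Longrightarrow> \<Phi> (\<lambda>x. c * f x) = c * \<Phi> f"
    and bound: "\<And>f. f \<in> L \<Longrightarrow> \<bar>\<Phi> f\<bar> \<le> C * (\<integral>x. \<bar>f x\<bar> powr p \<partial>M) powr (1 / p)"
    and C: "C \<ge> 0"
  shows "\<exists>h. h \<in> borel_measurable M \<and> integrable M (\<lambda>x. \<bar>h x\<bar> powr q) \<and> (\<forall>f\<in>L. \<Phi> f = (\<integral>x. h x * f x \<partial>M))"
proof -
  interpret finite_measure M by fact
  have p0: "p \<ge> 1" "p > 0" using pq by auto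
  have Lm: "f \<in> borel_measurable M" "integrable M (\<lambda>x. \<bar>f x\<bar> powr p)" if "f \<in> L" for f
    using that by (auto simp: L_def)
  have Ladd: "(\<lambda>x. f x + g x) \<in> L" if "f \<in> L" "g \<in> L" for f g
  proof -
    note [measurable] = Lm(1)[OF that(1)] Lm(1)[OF that(2)]
    have "integrable M (\<lambda>x. \<bar>f x + g x\<bar> powr p)"
    proof (rule Bochner_Integration.integrable_bound[of _ "\<lambda>x. 2 powr p * (\<bar>f x\<bar> powr p + \<bar>g x\<bar> powr p)"])
      show "AE x in M. norm (\<bar>f x + g x\<bar> powr p) \<le> norm (2 powr p * (\<bar>f x\<bar> powr p + \<bar>g x\<bar> powr p))"
        using powr_add_le[OF p0(1)] by (intro AE_I2) simp
    qed (use Lm(2)[OF that(1)] Lm(2)[OF that(2)] in auto)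
    then show ?thesis by (simp add: L_def)
  qed
  have Lmult: "(\<lambda>x. c * f x) \<in> L" if "f \<in> L" for f c
    using Lm[OF that] by (simp add: L_def abs_mult powr_mult)
  have Lb: "f \<in> L" if "f \<in> borel_measurable M" "\<And>x. \<bar>f x\<bar> \<le> B" for f B
  proof -
    have "integrable M (\<lambda>x. \<bar>f x\<bar> powr p)"
      by (rule integrable_const_bound[of _ "B powr p"]) (use that p0 in \<open>auto intro!: AE_I2 powr_mono2\<close>)
    then show ?thesis using that by (simp add: L_def)
  qed
  have Lind: "indicator A \<in> L" if "A \<in> sets M" for A
    using that by (intro Lb[of _ 1]) (auto simp: indicator_def)
  have Ldiff: "(\<lambda>x. f x - g x) \<in> L" and diff: "\<Phi> (\<lambda>x. f x - g x) = \<Phi> f - \<Phi> g" if "f \<in> L" "g \<in> L" for f g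
    using Ladd[OF that(1) Lmult[OF that(2), of "-1"]] add[OF that(1) Lmult[OF that(2), of "-1"]] mult[OF that(2), of "-1"]
    by simp_all
  have cont: "(\<lambda>i. \<Phi> (F i)) \<longlonglongrightarrow> \<Phi> f" if "f \<in> L" "\<And>i::nat. F i \<in> L" "(\<lambda>i. \<integral>x. \<bar>f x - F i x\<bar> powr p \<partial>M) \<longlonglongrightarrow> 0" for f F
  proof -
    have "(\<lambda>i. (\<integral>x. \<bar>f x - F i x\<bar> powr p \<partial>M) powr (1 / p)) \<longlonglongrightarrow> 0"
      using tendsto_powr'[OF that(3) tendsto_const[of "1/p"]] p0 by simp
    from tendsto_mult[OF tendsto_const[of C] this]
    have "(\<lambda>i. C * (\<integral>x. \<bar>f x - F i x\<bar> powr p \<partial>M) powr (1 / p)) \<longlonglongrightarrow> 0" by simp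
    then have "(\<lambda>i. \<Phi> f - \<Phi> (F i)) \<longlonglongrightarrow> 0"
      by (rule Lim_null_comparison[rotated])
         (use bound[OF Ldiff[OF that(1,2)]] diff[OF that(1,2)] in auto)
    from tendsto_diff[OF tendsto_const[of "\<Phi> f"] this] show ?thesis by simp
  qed
  \<comment> \<open>\<open>\<Phi>\<close> acts on functions, and a simple function equals its
    canonical sum only on \<open>space M\<close>. The bound forces equal values, since the
    difference has norm zero.\<close>
  have cong: "\<Phi> f = \<Phi> g" if "f \<in> L" "g \<in> L" "\<And>x. x \<in> space M \<Longrightarrow> f x = g x" for f g
  proof -
    have "(\<integral>x. \<bar>f x - g x\<bar> powr p \<partial>M) = (\<integral>x. 0 \<partial>M)"
      by (rule Bochner_Integration.integral_cong) (use that p0 in auto)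
    then show ?thesis using bound[OF Ldiff[OF that(1,2)]] diff[OF that(1,2)] by simp
  qed
  define \<nu> where "\<nu> = (\<lambda>A. \<Phi> (indicator A))"
  have nb: "\<bar>\<nu> A\<bar> \<le> C * measure M A powr (1 / p)" if A: "A \<in> sets M" for A
  proof -
    have "(\<integral>x. \<bar>indicator A x :: real\<bar> powr p \<partial>M) = (\<integral>x. indicator A x \<partial>M)"
      by (rule Bochner_Integration.integral_cong) (auto simp: indicator_def)
    then show ?thesis using bound[OF Lind[OF A]] A by (simp add: \<nu>_def)
  qed
  have nadd: "additive_setfun M \<nu>"
    unfolding additive_setfun_def
  proof (intro ballI impI)
    fix A B assume AB: "A \<in> sets M" "B \<in> sets M" "A \<inter> B = {}"
    have "indicator (A \<union> B) = (\<lambda>x. indicator A x + indicator B x :: real)"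
      using AB(3) by (auto simp: indicator_def fun_eq_iff)
    then show "\<nu> (A \<union> B) = \<nu> A + \<nu> B"
      unfolding \<nu>_def using add[OF Lind[OF AB(1)] Lind[OF AB(2)]] by simp
  qed
  have nac: "abs_cont_setfun M \<nu>"
    unfolding abs_cont_setfun_def
  proof (intro allI impI)
    fix e :: real assume e: "e > 0"
    \<comment> \<open>\<open>C + 1\<close> in place of \<open>C\<close>, which may vanish.\<close>
    define r where "r = e / (C + 1)"
    have r: "r > 0" using e C by (simp add: r_def)
    have "\<bar>\<nu> A\<bar> < e" if A: "A \<in> sets M" "measure M A < r powr p" for A
    proof -
      have "measure M A powr (1 / p) \<le> (r powr p) powr (1 / p)"
        using A p0 by (intro powr_mono2) auto
      also have "\<dots> = r" using r p0 by (simp add: powr_powr)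
      finally have "C * measure M A powr (1 / p) \<le> C * r" using C by (rule mult_left_mono)
      also have "\<dots> < (C + 1) * r" using r by simp
      also have "\<dots> = e" using C by (simp add: r_def)
      finally show ?thesis using nb[OF A(1)] by linarith
    qed
    then show "\<exists>d>0. \<forall>A\<in>sets M. measure M A < d \<longrightarrow> \<bar>\<nu> A\<bar> < e"
      using r by (intro exI[of _ "r powr p"]) auto
  qed
  have nbd: "\<bar>\<nu> A\<bar> \<le> C * measure M (space M) powr (1 / p)" if A: "A \<in> sets M" for A
  proof -
    have "C * measure M A powr (1 / p) \<le> C * measure M (space M) powr (1 / p)"
      using C p0 bounded_measure by (intro mult_left_mono powr_mono2) auto
    then show ?thesis using nb[OF A] by linarith
  qed
  have "\<exists>h. integrable M h \<and> (\<forall>A\<in>sets M. \<nu> A = (\<integral>x. indicator A x * h x \<partial>M))"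
    by (rule Radon_Nikodym_additive[OF fin nadd nac nbd])
  then obtain h where "integrable M h \<and> (\<forall>A\<in>sets M. \<nu> A = (\<integral>x. indicator A x * h x \<partial>M))" ..
  then have h: "integrable M h" "\<And>A. A \<in> sets M \<Longrightarrow> \<nu> A = (\<integral>x. indicator A x * h x \<partial>M)"
    by simp_all
  have [measurable]: "h \<in> borel_measurable M" using h(1) by auto
  have sumL: "(\<lambda>x. \<Sum>y\<in>Y. y * F y x) \<in> L \<and> \<Phi> (\<lambda>x. \<Sum>y\<in>Y. y * F y x) = (\<Sum>y\<in>Y. y * \<Phi> (F y))"
    if "finite Y" "\<And>y. F y \<in> L" for Y and F :: "real \<Rightarrow> 'b \<Rightarrow> real"
    using that(1)
  proof (induction Y)
    case empty
    show ?case using Lmult[OF that(2), of 0] mult[OF that(2), of 0] by simp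
  next
    case (insert y Y)
    then show ?case
      using Ladd[OF Lmult[OF that(2)[of y], of y], of "\<lambda>x. \<Sum>y\<in>Y. y * F y x"]
        add[OF Lmult[OF that(2)[of y], of y], of "\<lambda>x. \<Sum>y\<in>Y. y * F y x"] mult[OF that(2)[of y], of y]
      by simp
  qed
  have simple: "\<Phi> s = (\<integral>x. s x * h x \<partial>M)" if s: "simple_function M s" for s
  proof -
    let ?A = "\<lambda>y. s -` {y} \<inter> space M"
    have m: "?A y \<in> sets M" for y using s by (rule simple_functionD)
    have f: "finite (s ` space M)" using s by (rule simple_functionD)
    have sumA: "(\<lambda>x. \<Sum>y\<in>s ` space M. y * indicator (?A y) x) \<in> L"
      "\<Phi> (\<lambda>x. \<Sum>y\<in>s ` space M. y * indicator (?A y) x) = (\<Sum>y\<in>s ` space M. y * \<nu> (?A y))"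
      using sumL[OF f, of "\<lambda>y. indicator (?A y)"] Lind[OF m] unfolding \<nu>_def by blast+
    have eq: "s x = (\<Sum>y\<in>s ` space M. y * indicator (?A y) x)" if "x \<in> space M" for x
    proof -
      have "(\<Sum>y\<in>s ` space M. y * indicator (?A y) x) = (\<Sum>y\<in>s ` space M. if y = s x then y else 0)"
        using that by (intro sum.cong) (auto simp: indicator_def)
      then show ?thesis using f that by simp
    qed
    have [measurable]: "s \<in> borel_measurable M" by (rule borel_measurable_simple_function[OF s])
    have "integrable M (\<lambda>x. \<bar>s x\<bar> powr p)"
    proof (rule integrable_const_bound)
      show "AE x in M. norm (\<bar>s x\<bar> powr p) \<le> Max ((\<lambda>y. \<bar>y\<bar> powr p) ` s ` space M)"
        using f by (intro AE_I2) simp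
    qed measurable
    then have "s \<in> L" by (simp add: L_def)
    then have "\<Phi> s = (\<Sum>y\<in>s ` space M. y * \<nu> (?A y))"
      unfolding sumA(2)[symmetric] by (rule cong[OF _ sumA(1) eq])
    also have "\<dots> = (\<integral>x. s x * h x \<partial>M)"
      unfolding integral_simple_function_mult[OF s h(1)] using h(2)[OF m] by simp
    finally show ?thesis .
  qed
  \<comment> \<open>At this stage \<open>h\<close> is only integrable, so integrability of the
    product is a hypothesis. It holds for bounded \<open>f\<close>, which suffices to prove
    \<open>hq\<close>; after that it holds for every \<open>f\<close> in \<open>L\<close>.\<close>
  have rep: "\<Phi> f = (\<integral>x. h x * f x \<partial>M)" if f: "f \<in> L" and int: "integrable M (\<lambda>x. f x * h x)" for f
  proof -
    obtain s where s: "\<And>i::nat. simple_function M (s i)" "\<And>x. x \<in> space M \<Longrightarrow> (\<lambda>i. s i x) \<longlonglongrightarrow> f x"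
      "\<And>i x. x \<in> space M \<Longrightarrow> \<bar>s i x\<bar> \<le> 2 * \<bar>f x\<bar>"
      using simple_approximation[OF Lm(1)[OF f]] by blast
    note sp = simple_approximation_powr[OF Lm(1)[OF f] p0(2) Lm(2)[OF f] s]
    have "s i \<in> L" for i using sp(3) borel_measurable_simple_function[OF s(1)] by (simp add: L_def)
    from cont[OF f this sp(1)] have "(\<lambda>i. \<integral>x. s i x * h x \<partial>M) \<longlonglongrightarrow> \<Phi> f"
      by (simp add: simple[OF s(1)])
    moreover have "(\<lambda>i. \<integral>x. s i x * h x \<partial>M) \<longlonglongrightarrow> (\<integral>x. f x * h x \<partial>M)"
      by (rule integral_mult_simple_tendsto[OF Lm(1)[OF f] _ int s]) measurable
    ultimately have "\<Phi> f = (\<integral>x. f x * h x \<partial>M)" by (rule LIMSEQ_unique)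
    then show ?thesis by (simp add: mult.commute)
  qed
  have hq: "integrable M (\<lambda>x. \<bar>h x\<bar> powr q)"
  proof (rule dual_exponent_bound[OF fin pq])
    fix g :: "'b \<Rightarrow> real" and B assume g: "g \<in> borel_measurable M" "\<And>x. \<bar>g x\<bar> \<le> B"
    have "g \<in> L" using g by (rule Lb)
    have "integrable M (\<lambda>x. g x * h x)" by (rule integrable_mult_bounded[OF g h(1)])
    then have "(\<integral>x. h x * g x \<partial>M) = \<Phi> g" using rep[OF \<open>g \<in> L\<close>] by simp
    also have "\<dots> \<le> (\<integral>x. \<bar>g x\<bar> powr p \<partial>M) powr (1 / p) * C"
      using bound[OF \<open>g \<in> L\<close>] by (simp add: mult.commute)
    also have "\<dots> \<le> ((\<integral>x. \<bar>g x\<bar> powr p \<partial>M) powr (1 / p)) powr p / p + C powr q / q"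
      using pq C by (intro Youngs_inequality) auto
    finally show "(\<integral>x. h x * g x \<partial>M) \<le> C powr q / q + (\<integral>x. \<bar>g x\<bar> powr p \<partial>M) / p"
      using p0 by (simp add: powr_powr)
  qed measurable
  show ?thesis
  proof (intro exI[of _ h] conjI ballI)
    fix f assume f: "f \<in> L"
    have "integrable M (\<lambda>x. f x * h x)"
      by (rule integrable_Young(1)[OF pq Lm(1)[OF f] _ Lm(2)[OF f] hq]) measurable
    then show "\<Phi> f = (\<integral>x. h x * f x \<partial>M)" by (rule rep[OF f])
  qed (use hq in auto)
qed

text \<open>Finite intersections of a countable basis. Countability permits diagonal extraction of a
  subsequence, stability under intersection permits the induction over generated sets, and
  \<open>UNIV\<close> arises as the empty intersection.\<close>

lemma countable_Int_stable_generator_borel: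
  obtains G :: "'a::second_countable_topology set set" where "countable G" "Int_stable G" "UNIV \<in> G" "G \<subseteq> sets borel" "sets borel = sigma_sets UNIV G"
proof -
  obtain B :: "'a set set" where B: "countable B" "topological_basis B"
    using ex_countable_basis by blast
  define G where "G = Inter ` {F. F \<subseteq> B \<and> finite F}"
  have "countable {F. F \<subseteq> B \<and> finite F}"
    using countable_Collect_finite_subset[OF B(1)] by (simp add: conj_commute)
  then have 1: "countable G" by (simp add: G_def)
  have 2: "Int_stable G"
    unfolding Int_stable_def G_def
  proof (clarsimp)
    fix F H assume "F \<subseteq> B" "finite F" "H \<subseteq> B" "finite H"
    then show "\<Inter> F \<inter> \<Inter> H \<in> Inter ` {F. F \<subseteq> B \<and> finite F}"
      by (intro image_eqI[of _ _ "F \<union> H"]) auto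
  qed
  have 3: "UNIV \<in> G" unfolding G_def by (intro image_eqI[of _ _ "{}"]) auto
  have Bb: "B \<subseteq> sets borel" using topological_basis_open[OF B(2)] by auto
  have 4: "G \<subseteq> sets borel"
  proof
    fix X assume "X \<in> G"
    then obtain F where F: "F \<subseteq> B" "finite F" "X = \<Inter> F" by (auto simp: G_def)
    show "X \<in> sets borel"
      unfolding F(3) using F(2,1) Bb by (induction F rule: finite_induct) auto
  qed
  have BG: "B \<subseteq> G"
  proof
    fix X assume "X \<in> B" then show "X \<in> G" unfolding G_def by (intro image_eqI[of _ _ "{X}"]) auto
  qed
  have "sets borel = sigma_sets UNIV B"
    using arg_cong[OF borel_eq_countable_basis[OF B], of sets] by simp
  also have "\<dots> \<subseteq> sigma_sets UNIV G" by (rule sigma_sets_mono') (rule BG)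
  finally have "sets borel \<subseteq> sigma_sets UNIV G" .
  moreover have "sigma_sets UNIV G \<subseteq> sets borel"
    using sets.sigma_sets_subset[OF 4] by simp
  ultimately show thesis using that 1 2 3 4 by blast
qed

text \<open>A uniform limit of convergent sequences is Cauchy. This carries convergence of integrals
  from finite to countable disjoint unions.\<close>

lemma convergent_uniform_approx:
  fixes a :: "nat \<Rightarrow> real"
  assumes "\<And>e. e > 0 \<Longrightarrow> \<exists>b. convergent b \<and> (\<forall>n. \<bar>a n - b n\<bar> < e)"
  shows "convergent a"
proof (rule Cauchy_convergent, rule metric_CauchyI)
  fix e :: real assume "e > 0"
  then have e3: "e / 3 > 0" by simp
  then obtain b where b: "convergent b" "\<And>n. \<bar>a n - b n\<bar> < e / 3" using assms by meson
  then have "Cauchy b" by (intro convergent_Cauchy)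
  then obtain M where M: "\<And>m n. m \<ge> M \<Longrightarrow> n \<ge> M \<Longrightarrow> dist (b m) (b n) < e / 3"
    using e3 unfolding Cauchy_def by blast
  show "\<exists>M. \<forall>m\<ge>M. \<forall>n\<ge>M. dist (a m) (a n) < e"
  proof (intro exI[of _ M] allI impI)
    fix m n assume "m \<ge> M" "n \<ge> M"
    then show "dist (a m) (a n) < e"
      using M[of m n] b(2)[of m] b(2)[of n] unfolding dist_real_def by linarith
  qed
qed

text \<open>Equi-integrability: the scaled Young inequality against an indicator gives
  \<open>t powr p * B + t powr (- q) * measure M A\<close>. Choosing \<open>t\<close> first and the
  measure afterwards gives the small bound, and \<open>t = 1\<close> the uniform one.\<close>

lemma bounded_Lp_set_integrals:
  fixes w :: "nat \<Rightarrow> 'b \<Rightarrow> real"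
  assumes fin: "finite_measure M" and pq: "p > 1" "q > 1" "1/p + 1/q = 1"
    and w: "\<And>n. integrable M (w n)" "\<And>n. integrable M (\<lambda>x. \<bar>w n x\<bar> powr p)" "\<And>n. (\<integral>x. \<bar>w n x\<bar> powr p \<partial>M) \<le> B"
  shows "e > 0 \<Longrightarrow> \<exists>d>0. \<forall>n. \<forall>A\<in>sets M. measure M A < d \<longrightarrow> \<bar>\<integral>x. indicator A x * w n x \<partial>M\<bar> < e"
    and "A \<in> sets M \<Longrightarrow> \<bar>\<integral>x. indicator A x * w n x \<partial>M\<bar> \<le> B + measure M (space M)"
proof -
  interpret finite_measure M by fact
  have B: "B \<ge> 0" using w(3)[of 0] by (rule order_trans[rotated]) simp
  have est: "\<bar>\<integral>x. indicator A x * w n x \<partial>M\<bar> \<le> t powr p * B + t powr (- q) * measure M A"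
    if t: "t > 0" and A: "A \<in> sets M" for t A n
  proof -
    have eq: "(\<lambda>x. \<bar>indicator A x :: real\<bar> powr q) = indicator A" by (simp add: indicator_def fun_eq_iff)
    have iq: "integrable M (\<lambda>x. \<bar>indicator A x :: real\<bar> powr q)"
      unfolding eq using A by (simp add: less_top[symmetric])
    have "\<bar>\<integral>x. w n x * indicator A x \<partial>M\<bar> \<le> t powr p * (\<integral>x. \<bar>w n x\<bar> powr p \<partial>M) + t powr (- q) * (\<integral>x. \<bar>indicator A x :: real\<bar> powr q \<partial>M)"
      by (rule integrable_Young(2)[OF pq _ _ w(2) iq t]) (use w(1) A in auto)
    also have "\<dots> \<le> t powr p * B + t powr (- q) * measure M A"
      unfolding eq using A w(3)[of n] by (simp add: mult_left_mono)
    finally show ?thesis by (simp add: mult.commute)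
  qed
  show "\<bar>\<integral>x. indicator A x * w n x \<partial>M\<bar> \<le> B + measure M (space M)" if "A \<in> sets M"
    using est[of 1 A n] that bounded_measure[of A] by simp
  show "\<exists>d>0. \<forall>n. \<forall>A\<in>sets M. measure M A < d \<longrightarrow> \<bar>\<integral>x. indicator A x * w n x \<partial>M\<bar> < e" if e: "e > 0"
  proof -
    have e2: "e / 2 > 0" using e by simp
    obtain t where t: "t > 0" "t powr p * B < e / 2"
      using exists_small_powr[OF e2 _ B, of p] pq by auto
    show ?thesis
    proof (intro exI[of _ "(e / 2) * t powr q"] conjI allI ballI impI)
      show "e / 2 * t powr q > 0" using e2 t by simp
      fix n A assume A: "A \<in> sets M" "measure M A < e / 2 * t powr q"
      have "t powr (- q) * measure M A < t powr (- q) * (e / 2 * t powr q)"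
        using A(2) t by (intro mult_strict_left_mono) auto
      also have "\<dots> = e / 2" using t by (simp add: powr_minus)
      finally show "\<bar>\<integral>x. indicator A x * w n x \<partial>M\<bar> < e"
        using est[OF t(1) A(1), of n] t(2) by linarith
    qed
  qed
qed

text \<open>A diagonal subsequence settles the countable generator \<open>G\<close>. Convergence
  then spreads over the Borel sets: complements are subtracted from \<open>UNIV\<close>, and
  countable disjoint unions are uniform limits of finite ones by equi-integrability.\<close>

lemma convergent_set_integrals_subsequence:
  fixes w :: "nat \<Rightarrow> 'a::euclidean_space \<Rightarrow> real"
  assumes S: "S \<in> sets lebesgue" and fin: "finite_measure (lebesgue_on S)" and pq: "p > 1" "q > 1" "1/p + 1/q = 1"
    and w: "\<And>n. integrable (lebesgue_on S) (w n)" "\<And>n. integrable (lebesgue_on S) (\<lambda>x. \<bar>w n x\<bar> powr p)"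
      "\<And>n. (\<integral>x. \<bar>w n x\<bar> powr p \<partial>lebesgue_on S) \<le> B"
  shows "\<exists>r. strict_mono r \<and> (\<forall>A\<in>sets (lebesgue_on S). convergent (\<lambda>n. \<integral>x. indicator A x * w (r n) x \<partial>lebesgue_on S))"
proof -
  let ?M = "lebesgue_on S"
  interpret finite_measure ?M by fact
  have sp: "space ?M = S" by simp
  have S1: "A \<inter> S \<in> sets ?M" if "A \<in> sets lebesgue" for A
    using that S by (auto simp: sets_restrict_space)
  have cut: "(\<integral>x. indicator A x * f x \<partial>?M) = (\<integral>x. indicator (A \<inter> S) x * f x \<partial>?M)" for A and f :: "'a \<Rightarrow> real"
    by (rule Bochner_Integration.integral_cong) (auto simp: indicator_def)
  have bl: "A \<in> sets lebesgue" if "A \<in> sets borel" for A :: "'a set" using that by simp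
  note small = bounded_Lp_set_integrals(1)[where w=w, OF fin pq w]
  have bnd: "\<bar>\<integral>x. indicator A x * w n x \<partial>?M\<bar> \<le> B + measure ?M (space ?M)" if "A \<in> sets lebesgue" for A n
    unfolding cut[of A] by (rule bounded_Lp_set_integrals(2)[where w=w, OF fin pq w S1[OF that]])
  have int: "integrable ?M (\<lambda>x. indicator A x * w n x)" if "A \<in> sets lebesgue" for A n
  proof -
    have "integrable ?M (\<lambda>x. indicator (A \<inter> S) x * w n x)"
      by (rule integrable_indicator_mult[OF S1[OF that] w(1)])
    then show ?thesis
      by (rule Bochner_Integration.integrable_cong[THEN iffD1, rotated 2]) (auto simp: indicator_def)
  qed
  obtain G :: "'a set set" where G: "countable G" "Int_stable G" "UNIV \<in> G" "G \<subseteq> sets borel" "sets borel = sigma_sets UNIV G"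
    by (rule countable_Int_stable_generator_borel)
  obtain r :: "nat \<Rightarrow> nat" where r: "strict_mono r"
    "\<And>A. A \<in> G \<Longrightarrow> \<exists>l. (\<lambda>n. \<integral>x. indicator A x * w (r n) x \<partial>?M) \<longlonglongrightarrow> l"
  proof (rule function_convergent_subsequence[OF G(1), of "\<lambda>n A. \<integral>x. indicator A x * w n x \<partial>?M" "B + measure ?M (space ?M)"])
    show "norm (\<integral>x. indicator A x * w n x \<partial>?M) \<le> B + measure ?M (space ?M)" if "A \<in> G" for n A
      using bnd[OF bl] that G(4) by auto
  qed (use that in blast)
  define c where "c = (\<lambda>A n. \<integral>x. indicator A x * w (r n) x \<partial>?M)"
  have borel: "convergent (c A)" if A: "A \<in> sets borel" for A
  proof -
    have "A \<in> sigma_sets UNIV G" using A G(5) by simp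
    have "G \<subseteq> Pow UNIV" by simp
    from G(2) this \<open>A \<in> sigma_sets UNIV G\<close> show ?thesis
    proof (induction rule: sigma_sets_induct_disjoint)
      case (basic A)
      then show ?case using r(2) by (auto simp: c_def convergent_def)
    next
      case empty
      show ?case by (simp add: c_def convergent_const)
    next
      case (compl A)
      then have A: "A \<in> sets lebesgue" using G(5) by auto
      have "c (UNIV - A) = (\<lambda>n. c UNIV n - c A n)"
      proof
        fix n
        have "c UNIV n - c A n = (\<integral>x. indicator UNIV x * w (r n) x - indicator A x * w (r n) x \<partial>?M)"
          unfolding c_def by (rule Bochner_Integration.integral_diff[symmetric]) (use int A w(1) in auto)
        also have "\<dots> = c (UNIV - A) n"
          unfolding c_def by (rule Bochner_Integration.integral_cong) (auto simp: indicator_def)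
        finally show "c (UNIV - A) n = c UNIV n - c A n" ..
      qed
      moreover have "convergent (c UNIV)" using r(2)[OF G(3)] by (auto simp: c_def convergent_def)
      ultimately show ?case
        using convergent_diff[of "c UNIV" "c A"] compl by simp
    next
      case (union D)
      have "range D \<subseteq> sets borel" unfolding G(5) by fact
      then have D: "D i \<in> sets lebesgue" for i by auto
      have dis: "disjoint_family D" by fact
      show ?case
      proof (rule convergent_uniform_approx)
        fix e :: real assume "e > 0"
        from small[OF this] obtain d where d: "d > 0"
          "\<And>n A. A \<in> sets ?M \<Longrightarrow> measure ?M A < d \<Longrightarrow> \<bar>\<integral>x. indicator A x * w n x \<partial>?M\<bar> < e" by blast
        \<comment> \<open>The union without its first \<open>k\<close> pieces. The measure of this
          tail tends to zero, so for large \<open>k\<close> its integrals are below \<open>e\<close>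
          for all \<open>n\<close> at once.\<close>
        define R where "R = (\<lambda>k. (\<Union>i. D i) - (\<Union>i<k. D i))"
        have R: "R k \<in> sets lebesgue" for k unfolding R_def using D by auto
        have "(\<lambda>k. measure ?M (R k \<inter> S)) \<longlonglongrightarrow> measure ?M (\<Inter>k. R k \<inter> S)"
          by (rule finite_Lim_measure_decseq) (use S1[OF R] in \<open>auto simp: R_def decseq_def\<close>)
        moreover have "(\<Inter>k. R k \<inter> S) = {}" by (auto simp: R_def)
        ultimately have "(\<lambda>k. measure ?M (R k \<inter> S)) \<longlonglongrightarrow> 0" by simp
        then have "\<forall>\<^sub>F k in sequentially. measure ?M (R k \<inter> S) < d" using d(1) by (rule order_tendstoD)
        then obtain k where k: "measure ?M (R k \<inter> S) < d" by (auto simp: eventually_sequentially)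
        show "\<exists>b. convergent b \<and> (\<forall>n. \<bar>c (\<Union>i. D i) n - b n\<bar> < e)"
        proof (intro exI[of _ "\<lambda>n. \<Sum>i<k. c (D i) n"] conjI allI)
          show "convergent (\<lambda>n. \<Sum>i<k. c (D i) n)"
            using union by (intro convergent_sum) auto
          fix n
          have ind: "indicator (\<Union>i. D i) x = (\<Sum>i<k. indicator (D i) x) + (indicator (R k) x :: real)" for x
          proof -
            have "(\<Sum>i<k. indicator (D i) x) = (indicator (\<Union>i<k. D i) x :: real)"
              by (rule indicator_UN_disjoint[symmetric])
                 (use dis in \<open>auto simp: disjoint_family_on_def\<close>)
            then show ?thesis by (auto simp: R_def indicator_def)
          qed
          have "c (\<Union>i. D i) n = (\<integral>x. (\<Sum>i<k. indicator (D i) x * w (r n) x) + indicator (R k) x * w (r n) x \<partial>?M)"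
            unfolding c_def ind by (simp add: sum_distrib_right distrib_right)
          also have "\<dots> = (\<Sum>i<k. c (D i) n) + (\<integral>x. indicator (R k) x * w (r n) x \<partial>?M)"
          proof -
            have "integrable ?M (\<lambda>x. \<Sum>i<k. indicator (D i) x * w (r n) x)"
              by (intro Bochner_Integration.integrable_sum int D)
            then show ?thesis
              unfolding c_def Bochner_Integration.integral_sum[OF int[OF D], symmetric]
              by (rule Bochner_Integration.integral_add[OF _ int[OF R]])
          qed
          finally show "\<bar>c (\<Union>i. D i) n - (\<Sum>i<k. c (D i) n)\<bar> < e"
            using d(2)[OF S1[OF R] k] by (simp add: cut[of "R k"])
        qed
      qed
    qed
  qed
  have "convergent (c A)" if A: "A \<in> sets ?M" for A
  proof -
    \<comment> \<open>The generator reaches only Borel sets. A Lebesgue set differs from a Borel set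
      by a subset of a null set, which leaves every integral unchanged.\<close>
    have "A \<in> sets (completion lborel)" using A S by (simp add: sets_restrict_space_iff)
    then obtain A' N N' where A': "A = A' \<union> N" "N \<subseteq> N'" "N' \<in> null_sets lborel" "A' \<in> sets lborel"
      by (rule sets_completionE)
    have "AE x in lebesgue. x \<notin> N'"
      using A'(3) by (intro AE_not_in null_sets_completionI)
    then have "AE x in ?M. x \<notin> N'" using S by (auto simp: AE_restrict_space_iff elim!: eventually_mono)
    then have eq: "AE x in ?M. indicator A x = (indicator A' x :: real)"
      by eventually_elim (use A' in \<open>auto simp: indicator_def\<close>)
    have "c A n = c A' n" for n
      unfolding c_def
    proof (rule integral_cong_AE)
      have "A \<in> sets lebesgue" "A' \<in> sets lebesgue" using A A'(4) S by (auto simp: sets_restrict_space_iff)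
      then show "(\<lambda>x. indicator A x * w (r n) x) \<in> borel_measurable ?M" "(\<lambda>x. indicator A' x * w (r n) x) \<in> borel_measurable ?M"
        using int by (blast intro: borel_measurable_integrable)+
      show "AE x in ?M. indicator A x * w (r n) x = indicator A' x * w (r n) x"
        using eq by eventually_elim simp
    qed
    then have "c A = c A'" by (rule ext)
    then show ?thesis using borel[of A'] A'(4) by simp
  qed
  then show ?thesis using r(1) by (auto simp: c_def)
qed

text \<open>The limits of the integrals over sets inherit additivity and the uniform estimates,
  hence have a density \<open>v\<close>, at first merely integrable. Convergence against bounded
  functions together with the bound \<open>B\<close> puts \<open>v\<close> into \<open>Lp\<close>,
  with the exponents exchanged in \<open>dual_exponent_bound\<close>; only then may all of the dual
  space be used for testing.\<close>

lemma weak_compactness_Lp: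
  fixes w :: "nat \<Rightarrow> 'a::euclidean_space \<Rightarrow> real"
  assumes S: "S \<in> sets lebesgue" and fin: "finite_measure (lebesgue_on S)" and pq: "p > 1" "q > 1" "1/p + 1/q = 1"
    and w: "\<And>n. integrable (lebesgue_on S) (w n)" "\<And>n. integrable (lebesgue_on S) (\<lambda>x. \<bar>w n x\<bar> powr p)"
      "\<And>n. (\<integral>x. \<bar>w n x\<bar> powr p \<partial>lebesgue_on S) \<le> B"
  shows "\<exists>r v. strict_mono r \<and> v \<in> borel_measurable (lebesgue_on S) \<and> integrable (lebesgue_on S) (\<lambda>x. \<bar>v x\<bar> powr p) \<and>
    (\<forall>h. h \<in> borel_measurable (lebesgue_on S) \<longrightarrow> integrable (lebesgue_on S) (\<lambda>x. \<bar>h x\<bar> powr q) \<longrightarrow>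
      (\<lambda>n. \<integral>x. h x * w (r n) x \<partial>lebesgue_on S) \<longlonglongrightarrow> (\<integral>x. h x * v x \<partial>lebesgue_on S))"
proof -
  let ?M = "lebesgue_on S"
  interpret finite_measure ?M by fact
  obtain r where r: "strict_mono r" "\<And>A. A \<in> sets ?M \<Longrightarrow> convergent (\<lambda>n. \<integral>x. indicator A x * w (r n) x \<partial>?M)"
    using convergent_set_integrals_subsequence[where w=w, OF S fin pq w] by blast
  define \<nu> where "\<nu> = (\<lambda>A. lim (\<lambda>n. \<integral>x. indicator A x * w (r n) x \<partial>?M))"
  have lim: "(\<lambda>n. \<integral>x. indicator A x * w (r n) x \<partial>?M) \<longlonglongrightarrow> \<nu> A" if "A \<in> sets ?M" for A
    unfolding \<nu>_def using r(2)[OF that] by (rule convergent_LIMSEQ_iff[THEN iffD1])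
  note wr = w(1)[of "r n" for n] w(2)[of "r n" for n] w(3)[of "r n" for n]
  have add: "additive_setfun ?M \<nu>"
    unfolding additive_setfun_def
  proof (intro ballI impI)
    fix A C assume AC: "A \<in> sets ?M" "C \<in> sets ?M" "A \<inter> C = {}"
    have "(\<integral>x. indicator (A \<union> C) x * w (r n) x \<partial>?M) = (\<integral>x. indicator A x * w (r n) x \<partial>?M) + (\<integral>x. indicator C x * w (r n) x \<partial>?M)" for n
    proof -
      have "(\<integral>x. indicator (A \<union> C) x * w (r n) x \<partial>?M) = (\<integral>x. indicator A x * w (r n) x + indicator C x * w (r n) x \<partial>?M)"
        using AC(3) by (intro Bochner_Integration.integral_cong) (auto simp: indicator_def)
      also have "\<dots> = (\<integral>x. indicator A x * w (r n) x \<partial>?M) + (\<integral>x. indicator C x * w (r n) x \<partial>?M)"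
        by (intro Bochner_Integration.integral_add integrable_indicator_mult AC wr)
      finally show ?thesis .
    qed
    then have "(\<lambda>n. \<integral>x. indicator (A \<union> C) x * w (r n) x \<partial>?M) \<longlonglongrightarrow> \<nu> A + \<nu> C"
      using tendsto_add[OF lim[OF AC(1)] lim[OF AC(2)]] by simp
    then show "\<nu> (A \<union> C) = \<nu> A + \<nu> C"
      using lim[of "A \<union> C"] AC by (intro LIMSEQ_unique[of _ "\<nu> (A \<union> C)"]) auto
  qed
  have ac: "abs_cont_setfun ?M \<nu>"
    unfolding abs_cont_setfun_def
  proof (intro allI impI)
    fix e :: real assume "e > 0"
    then have e2: "e / 2 > 0" by simp
    from bounded_Lp_set_integrals(1)[where w=w, OF fin pq w e2] obtain d where d: "d > 0"
      "\<And>n A. A \<in> sets ?M \<Longrightarrow> measure ?M A < d \<Longrightarrow> \<bar>\<integral>x. indicator A x * w n x \<partial>?M\<bar> < e / 2" by blast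
    have "\<bar>\<nu> A\<bar> < e" if A: "A \<in> sets ?M" "measure ?M A < d" for A
    proof -
      have "\<bar>\<nu> A\<bar> \<le> e / 2"
        by (rule LIMSEQ_le_const2[OF tendsto_rabs[OF lim[OF A(1)]]]) (use d(2)[OF A] in \<open>auto intro: less_imp_le\<close>)
      then show ?thesis using \<open>e > 0\<close> by linarith
    qed
    then show "\<exists>d>0. \<forall>A\<in>sets ?M. measure ?M A < d \<longrightarrow> \<bar>\<nu> A\<bar> < e" using d(1) by blast
  qed
  have bdd: "\<bar>\<nu> A\<bar> \<le> B + measure ?M (space ?M)" if A: "A \<in> sets ?M" for A
    by (rule LIMSEQ_le_const2[OF tendsto_rabs[OF lim[OF A]]])
       (use bounded_Lp_set_integrals(2)[where w=w, OF fin pq w A] in auto)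
  have "\<exists>h. integrable ?M h \<and> (\<forall>A\<in>sets ?M. \<nu> A = (\<integral>x. indicator A x * h x \<partial>?M))"
    by (rule Radon_Nikodym_additive[OF fin add ac bdd])
  then obtain v where "integrable ?M v \<and> (\<forall>A\<in>sets ?M. \<nu> A = (\<integral>x. indicator A x * v x \<partial>?M))" ..
  then have v: "integrable ?M v" "\<And>A. A \<in> sets ?M \<Longrightarrow> \<nu> A = (\<integral>x. indicator A x * v x \<partial>?M)" by simp_all
  have [measurable]: "v \<in> borel_measurable ?M" "\<And>n. w n \<in> borel_measurable ?M" using v(1) w(1) by auto
  have conv: "(\<lambda>n. \<integral>x. indicator A x * w (r n) x \<partial>?M) \<longlonglongrightarrow> (\<integral>x. indicator A x * v x \<partial>?M)" if "A \<in> sets ?M" for A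
    using lim[OF that] v(2)[OF that] by simp
  have qp: "1/q + 1/p = 1" using pq by simp
  have vp: "integrable ?M (\<lambda>x. \<bar>v x\<bar> powr p)"
  proof (rule dual_exponent_bound[OF fin pq(2,1) qp])
    fix g :: "'a \<Rightarrow> real" and K assume g: "g \<in> borel_measurable ?M" "\<And>x. \<bar>g x\<bar> \<le> K"
    note [measurable] = g(1)
    have gq: "integrable ?M (\<lambda>x. \<bar>g x\<bar> powr q)"
      by (rule integrable_const_bound[of _ "K powr q"]) (use g pq in \<open>auto intro!: AE_I2 powr_mono2\<close>)
    have gv: "integrable ?M (\<lambda>x. g x * v x)" by (rule integrable_mult_bounded[OF g v(1)])
    \<comment> \<open>This scale makes the coefficient \<open>t powr (- q)\<close> equal to
      \<open>1 / q\<close>, the exact factor that \<open>dual_exponent_bound\<close> can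
      absorb.\<close>
    define t where "t = q powr (1 / q)"
    have t: "t > 0" "t powr (- q) = 1 / q" using pq by (simp_all add: t_def powr_powr powr_minus_divide)
    have "(\<integral>x. g x * w (r n) x \<partial>?M) \<le> t powr p * B + (\<integral>x. \<bar>g x\<bar> powr q \<partial>?M) / q" for n
    proof -
      have "\<bar>\<integral>x. w (r n) x * g x \<partial>?M\<bar> \<le> t powr p * (\<integral>x. \<bar>w (r n) x\<bar> powr p \<partial>?M) + t powr (- q) * (\<integral>x. \<bar>g x\<bar> powr q \<partial>?M)"
        by (rule integrable_Young(2)[OF pq _ _ wr(2) gq t(1)]) measurable
      also have "\<dots> \<le> t powr p * B + (\<integral>x. \<bar>g x\<bar> powr q \<partial>?M) / q"
        using wr(3)[of n] by (simp add: t(2) mult_left_mono)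
      finally show ?thesis by (simp add: mult.commute abs_le_iff)
    qed
    then have "(\<integral>x. g x * v x \<partial>?M) \<le> t powr p * B + (\<integral>x. \<bar>g x\<bar> powr q \<partial>?M) / q"
      by (intro LIMSEQ_le_const2[OF weak_limit_against_dual[OF pq wr v(1) conv g(1) gq gv]]) auto
    then show "(\<integral>x. v x * g x \<partial>?M) \<le> t powr p * B + (\<integral>x. \<bar>g x\<bar> powr q \<partial>?M) / q" by (simp add: mult.commute)
  qed measurable
  show ?thesis
  proof (intro exI[of _ r] exI[of _ v] conjI allI impI)
    fix h assume h: "h \<in> borel_measurable ?M" "integrable ?M (\<lambda>x. \<bar>h x\<bar> powr q)"
    have "integrable ?M (\<lambda>x. v x * h x)"
      by (rule integrable_Young(1)[OF pq _ h(1) vp h(2)]) measurable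
    then have hv: "integrable ?M (\<lambda>x. h x * v x)" by (simp add: mult.commute)
    show "(\<lambda>n. \<integral>x. h x * w (r n) x \<partial>?M) \<longlonglongrightarrow> (\<integral>x. h x * v x \<partial>?M)"
      by (rule weak_limit_against_dual[OF pq wr v(1) conv h hv])
  qed (use r vp in auto)
qed

section \<open>Compactness on the torus\<close>

text \<open>Borel measurability would not control preimages of Lebesgue sets. Here the preimage is a
  countable union of translates of \<open>A \<inter> hcube T\<close>, and translations preserve
  Lebesgue sets.\<close>

lemma red_measurable_lebesgue: 
  assumes T: "T > 0" shows "red T \<in> lebesgue \<rightarrow>\<^sub>M (lebesgue :: 'a::euclidean_space measure)"
proof (rule measurableI)
  fix A :: "'a set" assume A: "A \<in> sets lebesgue"
  have "red T -` A = (\<Union>k\<in>lat. (\<lambda>x. x + (- T *\<^sub>R k)) -` (A \<inter> hcube T))"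
  proof (intro set_eqI iffI)
    fix x assume "x \<in> red T -` A"
    then show "x \<in> (\<Union>k\<in>lat. (\<lambda>x. x + (- T *\<^sub>R k)) -` (A \<inter> hcube T))"
      using red_in_hcube[OF T, of x] by (intro UN_I[of "cell T x"] cell_in_lat) (simp add: red_def)
  next
    fix x assume "x \<in> (\<Union>k\<in>lat. (\<lambda>x. x + (- T *\<^sub>R k)) -` (A \<inter> hcube T))"
    then obtain k where k: "k \<in> lat" "x - T *\<^sub>R k \<in> A" "x - T *\<^sub>R k \<in> hcube T" by auto
    then show "x \<in> red T -` A" using cell_unique[OF T k(1,3)] by (simp add: red_def)
  qed
  moreover have "(\<lambda>x. x + (- T *\<^sub>R k)) -` (A \<inter> hcube T) \<in> sets lebesgue" for k
    using measurable_sets[OF lebesgue_measurable_translation[of "- T *\<^sub>R k"], of "A \<inter> hcube T"] A by simp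
  ultimately show "red T -` A \<inter> space lebesgue \<in> sets lebesgue"
    using countable_lat by (auto intro!: sets.countable_UN')
qed simp

lemma AE_red_cube: 
  assumes "T > 0" shows "AE x in lebesgue_on (cube T). red T x = (x :: 'a::euclidean_space)"
proof -
  have "AE x in lebesgue. x \<in> cube T \<longrightarrow> red T x = (x :: 'a)"
    using AE_hcube_cube[of T] by eventually_elim (use red_hcube[OF assms] in auto)
  then show ?thesis by (simp add: AE_restrict_space_iff)
qed

lemma periodic_extension_in_Lp_torus:
  fixes f :: "'a::euclidean_space \<Rightarrow> real"
  assumes T: "T > 0" and f: "f \<in> borel_measurable (lebesgue_on (cube T))" "integrable (lebesgue_on (cube T)) (\<lambda>x. \<bar>f x\<bar> powr p)"
  shows "(\<lambda>x. f (red T x)) \<in> Lp_torus p T"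
    and "AE x in lebesgue_on (cube T). f (red T x) = f x"
proof -
  show ae: "AE x in lebesgue_on (cube T). f (red T x) = f x"
    using AE_red_cube[OF T] by eventually_elim simp
  have "red T \<in> lebesgue \<rightarrow>\<^sub>M lebesgue_on (cube T :: 'a set)"
    using red_in_hcube[OF T] hcube_subset_cube[of T]
    by (intro measurable_restrict_space2 red_measurable_lebesgue T) auto
  from measurable_compose[OF this f(1)] have m: "(\<lambda>x. f (red T x)) \<in> borel_measurable lebesgue" .
  have "periodic_ae T (\<lambda>x. f (red T x))"
    unfolding periodic_ae_def by (simp add: red_add_lat[OF T Basis_in_lat])
  moreover have "(\<integral>\<^sup>+x. ennreal (\<bar>f (red T x)\<bar> powr p) \<partial>lebesgue_on (cube T)) < \<infinity>"
  proof -
    have "(\<integral>\<^sup>+x. ennreal (\<bar>f (red T x)\<bar> powr p) \<partial>lebesgue_on (cube T)) = (\<integral>\<^sup>+x. ennreal (\<bar>f x\<bar> powr p) \<partial>lebesgue_on (cube T))"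
      using ae by (intro nn_integral_cong_AE) (auto elim!: eventually_mono)
    then show ?thesis by (simp add: nn_integral_eq_integral[OF f(2)])
  qed
  ultimately show "(\<lambda>x. f (red T x)) \<in> Lp_torus p T"
    using m by (simp add: Lp_torus_def nn_integral_cube)
qed

text \<open>Functionals act on functions rather than on classes, but the bound by the seminorm
  \<open>Lp_norm\<close> makes them insensitive to null sets.\<close>

lemma bdd_lin_functional_cong_AE:
  fixes f g :: "'a::euclidean_space \<Rightarrow> real"
  assumes phi: "bdd_lin_functional p T \<phi>" and p: "p \<ge> 1" and f: "f \<in> Lp_torus p T" and g: "g \<in> Lp_torus p T"
    and ae: "AE x in lebesgue_on (cube T). f x = g x"
  shows "\<phi> f = \<phi> g"
proof -
  obtain C where C: "\<And>f. f \<in> Lp_torus p T \<Longrightarrow> \<bar>\<phi> f\<bar> \<le> C * Lp_norm p T f"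
    using phi unfolding bdd_lin_functional_def by blast
  have add: "\<phi> (\<lambda>x. f x + g x) = \<phi> f + \<phi> g" if "f \<in> Lp_torus p T" "g \<in> Lp_torus p T" for f g
    using phi that by (simp add: bdd_lin_functional_def)
  have d: "(\<lambda>x. f x - g x) \<in> Lp_torus p T" by (rule Lp_torus_diff[OF f g p])
  have "(\<integral>x. \<bar>f x - g x\<bar> powr p \<partial>lebesgue_on (cube T)) = (\<integral>x. 0 \<partial>lebesgue_on (cube T :: 'a set))"
    by (rule integral_cong_AE) (use ae Lp_torus_measurable(2)[OF d] in \<open>auto elim!: eventually_mono\<close>)
  then have "Lp_norm p T (\<lambda>x. f x - g x) = 0" by (simp add: Lp_norm_eq[OF d])
  then have "\<phi> (\<lambda>x. f x - g x) = 0" using C[OF d] by simp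
  then show ?thesis using add[OF d g] by simp
qed

text \<open>The functional lives on periodic functions on the space, the Riesz theorem on functions
  on the cube. Composition with \<open>red T\<close> is exactly linear and extends periodically, so
  it transports the functional to the cube; changes on the faces are null sets.\<close>

lemma bdd_lin_functional_representation:
  fixes \<phi> :: "('a::euclidean_space \<Rightarrow> real) \<Rightarrow> real"
  assumes phi: "bdd_lin_functional p T \<phi>" and pq: "p > 1" "q > 1" "1/p + 1/q = 1" and T: "T > 0"
  shows "\<exists>h. h \<in> borel_measurable (lebesgue_on (cube T)) \<and> integrable (lebesgue_on (cube T)) (\<lambda>x. \<bar>h x\<bar> powr q) \<and>
    (\<forall>f\<in>Lp_torus p T. \<phi> f = (\<integral>x. h x * f x \<partial>lebesgue_on (cube T)))"
proof -
  let ?M = "lebesgue_on (cube T :: 'a set)"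
  let ?L = "{f. f \<in> borel_measurable ?M \<and> integrable ?M (\<lambda>x. \<bar>f x\<bar> powr p)}"
  have p: "p \<ge> 1" using pq by simp
  define \<Phi> where "\<Phi> = (\<lambda>f. \<phi> (\<lambda>x. f (red T x)))"
  obtain C where C: "\<And>f. f \<in> Lp_torus p T \<Longrightarrow> \<bar>\<phi> f\<bar> \<le> C * Lp_norm p T f"
    using phi unfolding bdd_lin_functional_def by blast
  have ext: "(\<lambda>x. f (red T x)) \<in> Lp_torus p T" "AE x in ?M. f (red T x) = f x" if "f \<in> ?L" for f
    using periodic_extension_in_Lp_torus[OF T, of f p] that by auto
  have "\<exists>h. h \<in> borel_measurable ?M \<and> integrable ?M (\<lambda>x. \<bar>h x\<bar> powr q) \<and> (\<forall>f\<in>?L. \<Phi> f = (\<integral>x. h x * f x \<partial>?M))"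
  \<comment> \<open>The constant of a bounded functional carries no sign, hence its absolute
    value.\<close>
  proof (rule Riesz_representation_Lp[OF finite_measure_cube pq, where C="\<bar>C\<bar>"])
    fix f g assume f: "f \<in> ?L" and g: "g \<in> ?L"
    show "\<Phi> (\<lambda>x. f x + g x) = \<Phi> f + \<Phi> g"
      unfolding \<Phi>_def using phi ext(1)[OF f] ext(1)[OF g] by (simp add: bdd_lin_functional_def)
  next
    fix f c assume f: "f \<in> ?L"
    show "\<Phi> (\<lambda>x. c * f x) = c * \<Phi> f"
      unfolding \<Phi>_def using phi ext(1)[OF f] by (simp add: bdd_lin_functional_def)
  next
    fix f assume f: "f \<in> ?L"
    have "(\<integral>x. \<bar>f (red T x)\<bar> powr p \<partial>?M) = (\<integral>x. \<bar>f x\<bar> powr p \<partial>?M)"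
      using ext(2)[OF f] Lp_torus_measurable(2)[OF ext(1)[OF f]] f
      by (intro integral_cong_AE) (auto elim!: eventually_mono)
    then have "\<bar>\<Phi> f\<bar> \<le> C * (\<integral>x. \<bar>f x\<bar> powr p \<partial>?M) powr (1 / p)"
      using C[OF ext(1)[OF f]] by (simp add: \<Phi>_def Lp_norm_eq[OF ext(1)[OF f]])
    also have "\<dots> \<le> \<bar>C\<bar> * (\<integral>x. \<bar>f x\<bar> powr p \<partial>?M) powr (1 / p)" by (intro mult_right_mono) auto
    finally show "\<bar>\<Phi> f\<bar> \<le> \<bar>C\<bar> * (\<integral>x. \<bar>f x\<bar> powr p \<partial>?M) powr (1 / p)" .
  qed simp
  then obtain h where h: "h \<in> borel_measurable ?M" "integrable ?M (\<lambda>x. \<bar>h x\<bar> powr q)"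
    "\<And>f. f \<in> ?L \<Longrightarrow> \<Phi> f = (\<integral>x. h x * f x \<partial>?M)" by blast
  have "\<phi> f = (\<integral>x. h x * f x \<partial>?M)" if f: "f \<in> Lp_torus p T" for f
  proof -
    have fL: "f \<in> ?L" using Lp_torus_measurable(2)[OF f] Lp_torus_integrable_powr[OF f] by simp
    have "\<phi> f = \<Phi> f"
      unfolding \<Phi>_def
      by (rule bdd_lin_functional_cong_AE[OF phi p f ext(1)[OF fL]]) (use ext(2)[OF fL] in \<open>auto elim!: eventually_mono\<close>)
    then show ?thesis using h(3)[OF fL] by simp
  qed
  then show ?thesis using h by blast
qed

lemma avg_lebesgue_on: "avg T (u :: 'a::euclidean_space \<Rightarrow> real) = (\<integral>x. u x \<partial>lebesgue_on (cube T)) / T ^ DIM('a)"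
  unfolding avg_def set_lebesgue_integral_def by (subst integral_restrict_space) auto

lemma Lp_torus_diff_const:
  assumes "u \<in> Lp_torus p T" "p \<ge> 1"
  shows "(\<lambda>x. u x - c) \<in> Lp_torus p T"
  by (rule Lp_torus_diff[OF assms(1) bounded_periodic_in_Lp_torus[of "\<lambda>_. c" T "\<bar>c\<bar>" p] assms(2)]) (use assms in auto)

text \<open>Jensen's inequality in \<open>y\<close> for fixed \<open>x\<close>: in the tangent at
  \<open>b = u x - m\<close> the linear term \<open>k * (m - u y)\<close> integrates to zero because
  \<open>m\<close> is the mean. Integrating in \<open>x\<close> gives the volume of the period as
  factor.\<close>

lemma oscillation_le_F0:
  fixes u :: "'a::euclidean_space \<Rightarrow> real"
  assumes u: "u \<in> Lp_torus p T" and p: "p \<ge> 1" and T: "T > 0"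
  shows "ennreal (T ^ DIM('a) * (\<integral>x. \<bar>u x - avg T u\<bar> powr p \<partial>lebesgue_on (cube T))) \<le> F0 p T u"
proof -
  let ?M = "lebesgue_on (cube T :: 'a set)"
  interpret finite_measure ?M by (rule finite_measure_cube)
  note uI = Lp_torus_integrable[OF u p]
  have mT: "measure ?M (cube T) = T ^ DIM('a)" using T by (simp add: measure_cube)
  define m where "m = avg T u"
  have m: "(\<integral>x. u x \<partial>?M) = T ^ DIM('a) * m" using T by (simp add: m_def avg_lebesgue_on)
  have inner: "ennreal (T ^ DIM('a) * \<bar>u x - m\<bar> powr p) \<le> (\<integral>\<^sup>+y. ennreal (\<bar>u x - u y\<bar> powr p) \<partial>?M)" for x
  proof -
    define b where "b = u x - m"
    define k where "k = p * \<bar>b\<bar> powr (p - 1) * sgn b"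
    have "(\<integral>y. \<bar>b\<bar> powr p + k * (m - u y) \<partial>?M) = T ^ DIM('a) * \<bar>b\<bar> powr p"
      using uI m mT by (simp add: algebra_simps)
    then have "ennreal (T ^ DIM('a) * \<bar>b\<bar> powr p) \<le> (\<integral>\<^sup>+y. ennreal (\<bar>b\<bar> powr p + k * (m - u y)) \<partial>?M)"
      using ennreal_integral_le_nn_integral[of ?M "\<lambda>y. \<bar>b\<bar> powr p + k * (m - u y)"] uI by simp
    also have "\<dots> \<le> (\<integral>\<^sup>+y. ennreal (\<bar>u x - u y\<bar> powr p) \<partial>?M)"
      using powr_tangent[OF p, of b "u x - u y" for y]
      by (intro nn_integral_mono ennreal_leI) (simp add: b_def k_def)
    finally show ?thesis by (simp add: b_def)
  qed
  have "integrable ?M (\<lambda>x. \<bar>u x - m\<bar> powr p)"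
    by (rule Lp_torus_integrable_powr[OF Lp_torus_diff_const[OF u p]])
  then have "ennreal (T ^ DIM('a) * (\<integral>x. \<bar>u x - m\<bar> powr p \<partial>?M)) = (\<integral>\<^sup>+x. ennreal (T ^ DIM('a) * \<bar>u x - m\<bar> powr p) \<partial>?M)"
    using T by (subst nn_integral_eq_integral) auto
  also have "\<dots> \<le> F0 p T u"
    unfolding F0_lebesgue_on by (intro nn_integral_mono inner)
  finally show ?thesis by (simp add: m_def)
qed

text \<open>The lower comparison and Jensen's inequality bound the functions minus their means in
  \<open>Lp\<close>. For \<open>p > 1\<close> there is a finite conjugate exponent \<open>q\<close>,
  so the weak limit along densities in \<open>Lq\<close> is a limit against all bounded functionals
  by the representation theorem.\<close>

lemma compactness:
  fixes u :: "nat \<Rightarrow> 'a::euclidean_space \<Rightarrow> real"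
  assumes p: "p > 1" and T: "T > 0" and s: "\<forall>n. 0 < s n" "s \<longlonglongrightarrow> 0"
    and u: "\<And>n. u n \<in> Lp_torus p T" and bound: "\<And>n. ennreal (s n) * Fs p (s n) T (u n) \<le> ennreal C"
  shows "\<exists>r v. strict_mono r \<and> v \<in> Lp_torus p T \<and> avg T v = 0 \<and>
    weak_conv p T (\<lambda>n x. u (r n) x - avg T (u (r n))) v"
proof -
  let ?M = "lebesgue_on (cube T :: 'a set)"
  have p1: "p \<ge> 1" using p by simp
  define q where "q = p / (p - 1)"
  have pq: "q > 1" "1/p + 1/q = 1" using p by (simp_all add: q_def field_simps)
  define K where "K = real DIM('a) * omega TYPE('a) / (p * T ^ DIM('a))"
  have K: "K > 0" using omega_pos[where 'a='a] p T by (simp add: K_def)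
  have "(\<lambda>n. low_const TYPE('a) p T (s n)) \<longlonglongrightarrow> K"
    unfolding K_def by (rule low_const_tendsto[OF p1 T s])
  then have "\<forall>\<^sub>F n in sequentially. K / 2 < low_const TYPE('a) p T (s n)"
    using K by (intro order_tendstoD) auto
  \<comment> \<open>The comparison constant is bounded away from zero only from \<open>N\<close> on.
    Dropping earlier terms is harmless for a subsequence; its final index is
    \<open>r n + N\<close>.\<close>
  then obtain N where N: "\<And>n. n \<ge> N \<Longrightarrow> K / 2 < low_const TYPE('a) p T (s n)"
    by (auto simp: eventually_sequentially)
  \<comment> \<open>\<open>ennreal\<close> sends a negative \<open>C\<close> to zero, so the
    effective bound is the positive part.\<close>
  define C' where "C' = max C 0"
  define B where "B = C' * 2 / (K * T ^ DIM('a))"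
  define w where "w = (\<lambda>n x. u (n + N) x - avg T (u (n + N)))"
  have w: "w n \<in> Lp_torus p T" for n unfolding w_def by (rule Lp_torus_diff_const[OF u p1])
  have wB: "(\<integral>x. \<bar>w n x\<bar> powr p \<partial>?M) \<le> B" for n
  proof -
    define I where "I = (\<integral>x. \<bar>w n x\<bar> powr p \<partial>?M)"
    have I: "I \<ge> 0" by (simp add: I_def)
    have "ennreal (K / 2 * (T ^ DIM('a) * I)) = ennreal (K / 2) * ennreal (T ^ DIM('a) * I)"
      by (rule ennreal_mult') (use K in simp)
    also have "\<dots> \<le> ennreal (low_const TYPE('a) p T (s (n + N))) * F0 p T (u (n + N))"
      using N[of "n + N"] oscillation_le_F0[OF u p1 T] unfolding I_def w_def
      by (intro mult_mono ennreal_leI) auto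
    also have "\<dots> \<le> ennreal (s (n + N)) * Fs p (s (n + N)) T (u (n + N))"
      by (rule Fs_ge_F0[OF Lp_torus_measurable(1,3)[OF u] T p1]) (use s in auto)
    also have "\<dots> \<le> ennreal C" by (rule bound)
    also have "\<dots> \<le> ennreal C'" by (simp add: C'_def ennreal_leI)
    finally have "K / 2 * (T ^ DIM('a) * I) \<le> C'"
      by (subst (asm) ennreal_le_iff) (simp_all add: C'_def)
    then show ?thesis using K T by (simp add: B_def I_def[symmetric] field_simps)
  qed
  obtain r v0 where r: "strict_mono r" and v0: "v0 \<in> borel_measurable ?M" "integrable ?M (\<lambda>x. \<bar>v0 x\<bar> powr p)"
    and conv: "\<And>h. h \<in> borel_measurable ?M \<Longrightarrow> integrable ?M (\<lambda>x. \<bar>h x\<bar> powr q) \<Longrightarrow>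
      (\<lambda>n. \<integral>x. h x * w (r n) x \<partial>?M) \<longlonglongrightarrow> (\<integral>x. h x * v0 x \<partial>?M)"
    using weak_compactness_Lp[where w=w, OF cube_sets_lebesgue finite_measure_cube p pq Lp_torus_integrable[OF w p1] Lp_torus_integrable_powr[OF w] wB]
    by blast
  define v where "v = (\<lambda>x. v0 (red T x))"
  have v: "v \<in> Lp_torus p T" "AE x in ?M. v x = v0 x"
    unfolding v_def using periodic_extension_in_Lp_torus[OF T v0] by auto
  have vm: "v \<in> borel_measurable ?M" by (rule Lp_torus_measurable(2)[OF v(1)])
  have wk: "weak_conv p T (\<lambda>n. w (r n)) v"
    unfolding weak_conv_def
  proof (intro conjI allI impI w v(1))
    fix \<phi> :: "('a \<Rightarrow> real) \<Rightarrow> real" assume "bdd_lin_functional p T \<phi>"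
    from bdd_lin_functional_representation[OF this p pq T] obtain h where
      h: "h \<in> borel_measurable ?M" "integrable ?M (\<lambda>x. \<bar>h x\<bar> powr q)"
      "\<And>f. f \<in> Lp_torus p T \<Longrightarrow> \<phi> f = (\<integral>x. h x * f x \<partial>?M)" by blast
    have "(\<integral>x. h x * v x \<partial>?M) = (\<integral>x. h x * v0 x \<partial>?M)"
      using v(2) h(1) v0(1) vm by (intro integral_cong_AE) (auto elim!: eventually_mono)
    then show "(\<lambda>n. \<phi> (w (r n))) \<longlonglongrightarrow> \<phi> v"
      using conv[OF h(1,2)] by (simp add: h(3)[OF w] h(3)[OF v(1)])
  qed
  \<comment> \<open>The constant function is an admissible bounded density, so the vanishing means
    pass to the weak limit.\<close>
  have "(\<lambda>n. \<integral>x. 1 * w (r n) x \<partial>?M) \<longlonglongrightarrow> (\<integral>x. 1 * v x \<partial>?M)"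
    using T by (intro weak_conv_integral[OF wk p1, of "\<lambda>_. 1" 1]) auto
  moreover have "(\<integral>x. 1 * w n x \<partial>?M) = 0" for n
  proof -
    interpret finite_measure ?M by (rule finite_measure_cube)
    have "(\<integral>x. u (n + N) x - avg T (u (n + N)) \<partial>?M) = (\<integral>x. u (n + N) x \<partial>?M) - T ^ DIM('a) * avg T (u (n + N))"
      using Lp_torus_integrable[OF u p1] T by (simp add: measure_cube)
    then show ?thesis using T by (simp add: w_def avg_lebesgue_on)
  qed
  ultimately have "(\<integral>x. v x \<partial>?M) = 0" using LIMSEQ_unique[OF _ tendsto_const[of "0::real"]] by fastforce
  then have av: "avg T v = 0" by (simp add: avg_lebesgue_on)
  have "strict_mono (\<lambda>n. r n + N)" using r by (simp add: strict_mono_def)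
  then show ?thesis using wk v(1) av unfolding w_def by blast
qed

theorem mainTheorem3:
  fixes p T :: real and s :: "nat \<Rightarrow> real"
  assumes "p \<ge> 1" and "T > 0"
    and "\<forall>n. 0 < s n \<and> s n < 1" and "s \<longlonglongrightarrow> 0"
  defines "K \<equiv> real DIM('a::euclidean_space) * omega TYPE('a) / (p * T ^ DIM('a))"
  shows
   "(p \<noteq> 1 \<longrightarrow> (\<forall>u :: nat \<Rightarrow> 'a \<Rightarrow> real. (\<forall>n. u n \<in> Lp_torus p T) \<longrightarrow>
        (\<exists>C::real. \<forall>n. ennreal (s n) * Fs p (s n) T (u n) \<le> ennreal C) \<longrightarrow>
        (\<exists>r v. strict_mono r \<and> v \<in> Lp_torus p T \<and> avg T v = 0 \<and>
           weak_conv p T (\<lambda>n x. u (r n) x - avg T (u (r n))) v)))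
    \<and> (\<forall>v (u :: nat \<Rightarrow> 'a \<Rightarrow> real). v \<in> Lp_torus p T \<longrightarrow> weak_conv p T u v \<longrightarrow>
        liminf (\<lambda>n. ennreal (s n) * Fs p (s n) T (u n)) \<ge> ennreal K * F0 p T v)
    \<and> (\<forall>v :: 'a \<Rightarrow> real. v \<in> Lp_torus p T \<longrightarrow>
        (\<exists>u. weak_conv p T u v \<and>
           limsup (\<lambda>n. ennreal (s n) * Fs p (s n) T (u n)) \<le> ennreal K * F0 p T v))"
proof (intro conjI allI impI)
  have s: "\<forall>n. 0 < s n" using assms(3) by simp
  { fix u :: "nat \<Rightarrow> 'a \<Rightarrow> real"
    assume "p \<noteq> 1" and u: "\<forall>n. u n \<in> Lp_torus p T"
      and "\<exists>C::real. \<forall>n. ennreal (s n) * Fs p (s n) T (u n) \<le> ennreal C"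
    then obtain C where C: "\<And>n. ennreal (s n) * Fs p (s n) T (u n) \<le> ennreal C" by blast
    have "p > 1" using \<open>p \<noteq> 1\<close> assms(1) by simp
    from compactness[OF this assms(2) s assms(4) _ C] u
    show "\<exists>r v. strict_mono r \<and> v \<in> Lp_torus p T \<and> avg T v = 0 \<and>
           weak_conv p T (\<lambda>n x. u (r n) x - avg T (u (r n))) v" by blast }
  show "ennreal K * F0 p T v \<le> liminf (\<lambda>n. ennreal (s n) * Fs p (s n) T (u n))"
    if "weak_conv p T u v" for v and u :: "nat \<Rightarrow> 'a \<Rightarrow> real"
    unfolding K_def by (rule Gamma_liminf[OF assms(1,2) s assms(4) that])
  show "\<exists>u. weak_conv p T u v \<and> limsup (\<lambda>n. ennreal (s n) * Fs p (s n) T (u n)) \<le> ennreal K * F0 p T v"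
    if "v \<in> Lp_torus p T" for v :: "'a \<Rightarrow> real"
    unfolding K_def by (rule Gamma_limsup[OF assms(1-4) that])
qed

end
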